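(* Assume that $\alpha_1<1$ and that $\langle\mathcal L r,r\rangle\ge\lambda\|r\|^2$ for all $r\in H^1_0(\Omega)$, where $\lambda\ge0$ is some constant. Suppose that a unique solution $u$ of $$\sum_{i=1}^\ell q_i(t)D_t^{\alpha_i}u(x,t)+\mathcal L u(x,t)=f(x,t)\ \text{ in }\Omega\times(0,T],\quad u(\cdot,0)=u_0\text{ in }\Omega,\quad u=0\text{ on }\partial\Omega\times(0,T],$$ and its approximation $u_h$ are in $C([0,T];L_2(\Omega))\cap W^{1,\infty}(\epsilon,T;L_2(\Omega))$ for each $\epsilon\in(0,T]$, and also in $H^1_0(\Omega)$ for each $t>0$. Let $R_h(\cdot,t):=\bigl(\sum_{i=1}^\ell q_i(t)D_t^{\alpha_i}+\mathcal L\bigr)u_h(\cdot,t)-f(\cdot,t)$. Let $\tau>0$ be an arbitrary parameter, and set $\beta:=1-\alpha_1$, $\hat\tau:=\tau/t$, and $\mathcal E_1(t):=(\max\{\tau,t\})^{\alpha_1-1}$ for $t>0$, $\mathcal E_1(0):=0$. Define $$\mathcal R_1(t):=\lambda\,\mathcal E_1(t)+\tau^{-\beta}\sum_{i=1}^\ell\frac{q_i(t)\,t^{-\alpha_i}}{\Gamma(1-\alpha_i)}\bigl[1-\rho_i(\hat\tau)\bigr],$$ where $\rho_i(s):=0$ for $s\ge1$ and $$\rho_i(s):={}_2F_1(\alpha_i,-\beta;\alpha_1;s)-\frac{\Gamma(\alpha_1)\Gamma(1-\alpha_i)}{\Gamma(\alpha_1-\alpha_i)}\,s^\beta\qquad\text{for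 }s\in(0,1).$$ Then $\rho_i(s)\le(1-s)^{1-\alpha_i}<1$ for $s\in(0,1)$ and $i=1,\dots,\ell$, and for $t\in(0,T]$ $$\|(u_h-u)(\cdot,t)\|\le t^{\alpha_1-1}\sup_{0<s\le t}\left\{\frac{\|R_h(\cdot,s)\|}{\mathcal R_1(s)}\right\}.$$ Furthermore, in the last bound one can replace the factor $t^{\alpha_1-1}$ by $\mathcal E_1(t)$.
   Context: $\Omega\subset\mathbb R^d$, $d\in\{1,2,3\}$, is a bounded Lipschitz domain; $T>0$; $\mathcal L$ is a spatial linear second-order elliptic operator; $\|\cdot\|$ and $\langle\cdot,\cdot\rangle$ are the norm and inner product of $L_2(\Omega)$. $\ell$ is a positive integer; $0<\alpha_\ell<\dots<\alpha_1$ are constants; $q_i\in C[0,T]$ with $q_i\ge0$ and $\sum_{i=1}^\ell q_i(t)>0$ on $[0,T]$. For $0<t\le T$ (all $\alpha_i<1$ here), $$\Gamma(1-\alpha_i)\,D_t^{\alpha_i}y(\cdot,t)=t^{-\alpha_i}[y(\cdot,t)-y(\cdot,0)]+\int_0^t\alpha_i(t-s)^{-\alpha_i-1}[y(\cdot,t)-y(\cdot,s)]\,ds.$$ Standing assumption on the approximate solution $u_h$: $u_h(\cdot,0)=u(\cdot,0)$ on $\Omega$ and $u_h(x,t)=u(x,t)$ for $x\in\partial\Omega$, $t>0$. ${}_2F_1$ is the Gauss hypergeometric function; $1/\Gamma(0):=0$, so for $i=1$ the second term in $\rho_i$ vanishes. The supremum takes values in $[0,\infty]$ (the bound being trivial if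 it is $\infty$). *)

theory Defs
  imports "HOL-Analysis.Analysis"
begin

section \<open>The Hilbert space of square-integrable functions\<close>

text \<open>Real-valued square-integrable functions on the whole Euclidean space modulo equality almost
  everywhere. The instances below make the Bochner integral of the library available
  for functions with values in this space.\<close>

definition square_integrable :: "('a::euclidean_space \<Rightarrow> real) \<Rightarrow> bool" where
  "square_integrable f \<longleftrightarrow>
     f \<in> borel_measurable lebesgue \<and> integrable lebesgue (\<lambda>x. (f x)\<^sup>2)"

lemma square_integrable_0 [simp]: "square_integrable (\<lambda>x. 0)"
  by (simp add: square_integrable_def)

lemma square_integrable_mult:
  assumes "square_integrable f" "square_integrable g"
  shows "integrable lebesgue (\<lambda>x. f x * g x)"
proof (rule Bochner_Integration.integrable_bound)
  show "integrable lebesgue (\<lambda>x. (f x)\<^sup>2 + (g x)\<^sup>2)"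
    using assms by (simp add: square_integrable_def)
  show "(\<lambda>x. f x * g x) \<in> borel_measurable lebesgue"
    using assms by (auto simp: square_integrable_def)
  have "\<bar>a * b\<bar> \<le> \<bar>a\<^sup>2 + b\<^sup>2\<bar>" for a b :: real
  proof -
    have "2 * (\<bar>a\<bar> * \<bar>b\<bar>) \<le> a\<^sup>2 + b\<^sup>2"
      using sum_squares_bound[of "\<bar>a\<bar>" "\<bar>b\<bar>"] by (simp add: mult.assoc)
    moreover have "0 \<le> \<bar>a\<bar> * \<bar>b\<bar>" by simp
    ultimately have "\<bar>a\<bar> * \<bar>b\<bar> \<le> a\<^sup>2 + b\<^sup>2" by linarith
    then show ?thesis by (simp add: abs_mult)
  qed
  then show "AE x in lebesgue. norm (f x * g x) \<le> norm ((f x)\<^sup>2 + (g x)\<^sup>2)"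
    by simp
qed

lemma square_integrable_scale:
  "square_integrable f \<Longrightarrow> square_integrable (\<lambda>x. c * f x)"
  by (auto simp: square_integrable_def power_mult_distrib)

lemma square_integrable_add:
  assumes "square_integrable f" "square_integrable g"
  shows "square_integrable (\<lambda>x. f x + g x)"
  using assms square_integrable_mult[OF assms]
  by (auto simp: square_integrable_def power2_sum mult.assoc)

lemma square_integrable_uminus:
  "square_integrable f \<Longrightarrow> square_integrable (\<lambda>x. - f x)"
  using square_integrable_scale[of f "- 1"] by simp

lemma square_integrable_diff:
  assumes "square_integrable f" "square_integrable g"
  shows "square_integrable (\<lambda>x. f x - g x)"
  using square_integrable_add[OF assms(1) square_integrable_uminus[OF assms(2)]] by simp

lemma square_integrable_cong_AE:
  assumes "square_integrable f" "g \<in> borel_measurable lebesgue" "AE x in lebesgue. f x = g x"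
  shows "square_integrable g"
proof -
  have "integrable lebesgue (\<lambda>x. (g x)\<^sup>2) \<longleftrightarrow> integrable lebesgue (\<lambda>x. (f x)\<^sup>2)"
    using assms by (intro integrable_cong_AE) (auto simp: square_integrable_def)
  then show ?thesis using assms by (simp add: square_integrable_def)
qed

lemma square_integrable_zero_iff:
  assumes "square_integrable f"
  shows "(LINT x|lebesgue. f x * f x) = 0 \<longleftrightarrow> (AE x in lebesgue. f x = 0)"
  using integral_nonneg_eq_0_iff_AE[OF square_integrable_mult[OF assms assms]] by simp

quotient_type (overloaded) 'a l2 = "'a::euclidean_space \<Rightarrow> real" / partial:
  "\<lambda>f g. square_integrable f \<and> square_integrable g \<and> (AE x in lebesgue. f x = g x)"
proof (rule part_equivpI)
  show "\<exists>x::'a \<Rightarrow> real. square_integrable x \<and> square_integrable x \<and> (AE xa in lebesgue. x xa = x xa)"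
    by (rule exI[of _ "\<lambda>x. 0"]) simp
  show "symp (\<lambda>f g :: 'a \<Rightarrow> real. square_integrable f \<and> square_integrable g \<and> (AE x in lebesgue. f x = g x))"
    by (auto intro!: sympI simp: eq_commute)
  show "transp (\<lambda>f g :: 'a \<Rightarrow> real. square_integrable f \<and> square_integrable g \<and> (AE x in lebesgue. f x = g x))"
    by (auto intro!: transpI)
qed

instantiation l2 :: (euclidean_space) real_inner
begin

lift_definition zero_l2 :: "'a l2" is "\<lambda>x. 0" by simp
lift_definition plus_l2 :: "'a l2 \<Rightarrow> 'a l2 \<Rightarrow> 'a l2" is "\<lambda>f g x. f x + g x"
  by (auto intro: square_integrable_add)
lift_definition minus_l2 :: "'a l2 \<Rightarrow> 'a l2 \<Rightarrow> 'a l2" is "\<lambda>f g x. f x - g x"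
  by (auto intro: square_integrable_diff)
lift_definition uminus_l2 :: "'a l2 \<Rightarrow> 'a l2" is "\<lambda>f x. - f x"
  by (auto intro: square_integrable_uminus)
lift_definition scaleR_l2 :: "real \<Rightarrow> 'a l2 \<Rightarrow> 'a l2" is "\<lambda>c f x. c * f x"
  by (auto intro: square_integrable_scale)
lift_definition inner_l2 :: "'a l2 \<Rightarrow> 'a l2 \<Rightarrow> real" is
  "\<lambda>f g. LINT x|lebesgue. f x * g x"
proof -
  fix f f' g g' :: "'a \<Rightarrow> real"
  assume f: "square_integrable f \<and> square_integrable f' \<and> (AE x in lebesgue. f x = f' x)"
    and g: "square_integrable g \<and> square_integrable g' \<and> (AE x in lebesgue. g x = g' x)"
  show "(LINT x|lebesgue. f x * g x) = (LINT x|lebesgue. f' x * g' x)"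
    using f g by (intro integral_cong_AE) (auto simp: square_integrable_def)
qed

definition norm_l2 :: "'a l2 \<Rightarrow> real" where "norm_l2 v = sqrt (inner v v)"
definition dist_l2 :: "'a l2 \<Rightarrow> 'a l2 \<Rightarrow> real" where "dist_l2 v w = norm (v - w)"
definition sgn_l2 :: "'a l2 \<Rightarrow> 'a l2" where "sgn_l2 v = scaleR (inverse (norm v)) v"
definition uniformity_l2 :: "('a l2 \<times> 'a l2) filter" where
  "uniformity_l2 = (INF e\<in>{0<..}. principal {(v, w). dist v w < e})"
definition open_l2 :: "'a l2 set \<Rightarrow> bool" where
  "open_l2 U \<longleftrightarrow> (\<forall>v\<in>U. \<forall>\<^sub>F (v', w) in uniformity. v' = v \<longrightarrow> w \<in> U)"

instance
proof
  fix u v w :: "'a l2" and c d :: real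
  show "u + v + w = u + (v + w)"
    by transfer (auto intro!: square_integrable_add simp: algebra_simps)
  show "u + v = v + u"
    by transfer (auto intro!: square_integrable_add simp: algebra_simps)
  show "0 + u = u" by transfer auto
  show "- u + u = 0" by transfer auto
  show "u - v = u + - v"
    by transfer (auto intro!: square_integrable_diff)
  show "c *\<^sub>R (u + v) = c *\<^sub>R u + c *\<^sub>R v"
    by transfer (auto intro!: square_integrable_add square_integrable_scale simp: algebra_simps)
  show "(c + d) *\<^sub>R u = c *\<^sub>R u + d *\<^sub>R u"
    by transfer (auto intro!: square_integrable_add square_integrable_scale simp: algebra_simps)
  show "c *\<^sub>R d *\<^sub>R u = (c * d) *\<^sub>R u"
    by transfer (auto intro!: square_integrable_scale simp: algebra_simps)
  show "1 *\<^sub>R u = u" by transfer auto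
  show "dist u v = norm (u - v)" by (rule dist_l2_def)
  show "sgn u = scaleR (inverse (norm u)) u" by (rule sgn_l2_def)
  show "uniformity = (INF e\<in>{0<..}. principal {(v::'a l2, w). dist v w < e})"
    by (rule uniformity_l2_def)
  show "open U \<longleftrightarrow> (\<forall>v\<in>U. \<forall>\<^sub>F (v', w) in uniformity. v' = v \<longrightarrow> w \<in> U)" for U :: "'a l2 set"
    by (rule open_l2_def)
  show "inner u v = inner v u" by transfer (simp add: mult.commute)
  show "inner (u + v) w = inner u w + inner v w"
  proof (transfer, safe)
    fix f g h :: "'a \<Rightarrow> real"
    assume "square_integrable f" "square_integrable g" "square_integrable h"
    then show "(LINT x|lebesgue. (f x + g x) * h x) =
        (LINT x|lebesgue. f x * h x) + (LINT x|lebesgue. g x * h x)"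
      by (simp add: distrib_right square_integrable_mult)
  qed
  show "inner (c *\<^sub>R u) v = c * inner u v" by transfer (simp add: mult.assoc)
  show "0 \<le> inner u u" by transfer simp
  show "inner u u = 0 \<longleftrightarrow> u = 0"
    by transfer (simp add: square_integrable_zero_iff)
  show "norm u = sqrt (inner u u)" by (rule norm_l2_def)
qed

end

lemma square_integrable_rep_l2 [simp]: "square_integrable (rep_l2 v)"
  using Quotient3_rep_reflp[OF Quotient3_l2] by blast

lemma abs_l2_rep_l2 [simp]: "abs_l2 (rep_l2 v) = v"
  by (rule Quotient3_abs_rep[OF Quotient3_l2])

lemma rep_l2_abs_l2:
  assumes "square_integrable f"
  shows "AE x in lebesgue. rep_l2 (abs_l2 f) x = f x"
  using rep_abs_rsp_left[OF Quotient3_l2, of f f] assms by auto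

lemma abs_l2_eq_iff:
  assumes "square_integrable f" "square_integrable g"
  shows "abs_l2 f = abs_l2 g \<longleftrightarrow> (AE x in lebesgue. f x = g x)"
  using Quotient3_rel[OF Quotient3_l2, of f g] assms by auto

lemma abs_l2_add:
  assumes "square_integrable f" "square_integrable g"
  shows "abs_l2 f + abs_l2 g = abs_l2 (\<lambda>x. f x + g x)"
  using assms by (simp add: plus_l2.abs_eq)

lemma abs_l2_diff:
  assumes "square_integrable f" "square_integrable g"
  shows "abs_l2 f - abs_l2 g = abs_l2 (\<lambda>x. f x - g x)"
  using assms by (simp add: minus_l2.abs_eq)

lemma abs_l2_scaleR:
  assumes "square_integrable f"
  shows "c *\<^sub>R abs_l2 f = abs_l2 (\<lambda>x. c * f x)"
  using assms by (simp add: scaleR_l2.abs_eq)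

lemma abs_l2_zero: "abs_l2 (\<lambda>x. 0) = 0"
  by (simp add: zero_l2_def)

lemma norm_abs_l2:
  assumes "square_integrable f"
  shows "(norm (abs_l2 f))\<^sup>2 = (LINT x|lebesgue. (f x)\<^sup>2)"
  using assms by (simp add: norm_l2_def inner_l2.abs_eq power2_eq_square)

lemma tendsto_abs_l2_dominated:
  fixes f :: "nat \<Rightarrow> 'a::euclidean_space \<Rightarrow> real"
  assumes g: "square_integrable g"
    and f: "\<And>k. square_integrable (f k)"
    and lim: "AE x in lebesgue. (\<lambda>k. f k x) \<longlonglongrightarrow> g x"
    and w: "integrable lebesgue w"
    and bd: "\<And>k. AE x in lebesgue. (f k x - g x)\<^sup>2 \<le> w x"
  shows "(\<lambda>k. abs_l2 (f k)) \<longlonglongrightarrow> abs_l2 g"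
proof -
  have "(\<lambda>k. LINT x|lebesgue. (f k x - g x)\<^sup>2) \<longlonglongrightarrow> (LINT x|(lebesgue :: 'a measure). 0)"
  proof (rule integral_dominated_convergence[where w = w])
    show "AE x in lebesgue. (\<lambda>k. (f k x - g x)\<^sup>2) \<longlonglongrightarrow> 0"
      using lim
    proof eventually_elim
      fix x assume "(\<lambda>k. f k x) \<longlonglongrightarrow> g x"
      then show "(\<lambda>k. (f k x - g x)\<^sup>2) \<longlonglongrightarrow> 0"
        by (auto intro!: tendsto_eq_intros)
    qed
    show "(\<lambda>x. (f k x - g x)\<^sup>2) \<in> borel_measurable lebesgue" for k
      using square_integrable_diff[OF f g] by (auto simp: square_integrable_def)
  qed (use w bd in auto)
  then have "(\<lambda>k. (norm (abs_l2 (f k) - abs_l2 g))\<^sup>2) \<longlonglongrightarrow> 0"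
    by (simp add: abs_l2_diff f g norm_abs_l2 square_integrable_diff)
  then have "(\<lambda>k. sqrt ((norm (abs_l2 (f k) - abs_l2 g))\<^sup>2)) \<longlonglongrightarrow> sqrt 0"
    by (rule tendsto_real_sqrt)
  then have "(\<lambda>k. norm (abs_l2 (f k) - abs_l2 g)) \<longlonglongrightarrow> 0"
    by simp
  then have "(\<lambda>k. abs_l2 (f k) - abs_l2 g) \<longlonglongrightarrow> 0"
    by (rule tendsto_norm_zero_cancel)
  then show ?thesis
    by (rule LIM_zero_cancel)
qed

instance l2 :: (euclidean_space) banach
proof
  fix X :: "nat \<Rightarrow> 'a l2"
  assume X: "Cauchy X"
  have "\<exists>N. \<forall>m\<ge>N. \<forall>n\<ge>N. dist (X m) (X n) < (1/2)^k" for k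
    using metric_CauchyD[OF X, of "(1/2)^k"] by auto
  then obtain N where N: "\<And>k m n. m \<ge> N k \<Longrightarrow> n \<ge> N k \<Longrightarrow> dist (X m) (X n) < (1/2)^k"
    by metis
  define s where "s k = (\<Sum>i\<le>k. N i)" for k
  have sN: "N k \<le> s k" for k unfolding s_def by (rule member_le_sum) auto
  have sNl: "N k \<le> s l" if "k \<le> l" for k l
    unfolding s_def using that by (intro member_le_sum) auto
  define f where "f k = rep_l2 (X (s k))" for k
  have sf [simp]: "square_integrable (f k)" for k by (simp add: f_def)
  have Xf: "X (s k) = abs_l2 (f k)" for k by (simp add: f_def)
  have fm [measurable]: "f k \<in> borel_measurable lebesgue" for k
    using sf[of k] by (simp add: square_integrable_def)
  define d where "d k x = f (Suc k) x - f k x" for k x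
  have sd [simp]: "square_integrable (d k)" for k
    unfolding d_def by (intro square_integrable_diff) auto
  have dint: "(LINT x|lebesgue. (f l x - f k x)\<^sup>2) \<le> (1/4)^k" if "k \<le> l" for k l
  proof -
    have "norm (X (s l) - X (s k)) < (1/2)^k"
      using N[of k "s l" "s k"] sNl[OF that] sN by (simp add: dist_norm)
    then have "(norm (X (s l) - X (s k)))\<^sup>2 \<le> ((1/2)^k)\<^sup>2"
      by (intro power_mono) auto
    also have "\<dots> = (1/4)^k" by (simp add: power2_eq_square flip: power_mult_distrib)
    finally show ?thesis
      by (simp add: Xf abs_l2_diff norm_abs_l2 square_integrable_diff)
  qed
  have "(\<integral>\<^sup>+x. (\<Sum>k. ennreal (2^k * (d k x)\<^sup>2)) \<partial>lebesgue) =
      (\<Sum>k. \<integral>\<^sup>+x. ennreal (2^k * (d k x)\<^sup>2) \<partial>lebesgue)"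
    by (intro nn_integral_suminf) (simp add: d_def)
  also have "\<dots> \<le> (\<Sum>k. ennreal ((1/2)^k))"
  proof (intro suminf_le)
    fix k
    have "(\<integral>\<^sup>+x. ennreal (2^k * (d k x)\<^sup>2) \<partial>lebesgue) = ennreal (LINT x|lebesgue. 2^k * (d k x)\<^sup>2)"
      using sd[of k] by (intro nn_integral_eq_integral) (auto simp: square_integrable_def)
    also have "\<dots> \<le> ennreal (2^k * (1/4)^k)"
      using dint[of k "Suc k"] by (intro ennreal_leI) (simp add: d_def)
    also have "(2::real)^k * (1/4)^k = (1/2)^k" by (simp flip: power_mult_distrib)
    finally show "(\<integral>\<^sup>+x. ennreal (2^k * (d k x)\<^sup>2) \<partial>lebesgue) \<le> ennreal ((1/2)^k)" .
  qed auto
  also have "\<dots> < \<infinity>"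
    by (subst suminf_ennreal2) (auto intro!: summable_geometric)
  finally have "AE x in lebesgue. (\<Sum>k. ennreal (2^k * (d k x)\<^sup>2)) \<noteq> \<infinity>"
    by (intro nn_integral_noteq_infinite) (auto simp: d_def)
  then have conv: "AE x in lebesgue. convergent (\<lambda>k. f k x)"
  proof eventually_elim
    fix x assume "(\<Sum>k. ennreal (2^k * (d k x)\<^sup>2)) \<noteq> \<infinity>"
    then have "summable (\<lambda>k. 2^k * (d k x)\<^sup>2)"
      by (intro summable_suminf_not_top) auto
    moreover have "summable (\<lambda>k. (1/2::real)^k)" by (intro summable_geometric) auto
    ultimately have S: "summable (\<lambda>k. 2^k * (d k x)\<^sup>2 + (1/2)^k)" by (rule summable_add)
    have "summable (\<lambda>k. d k x)"
    proof (rule summable_comparison_test'[OF S])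
      fix k :: nat
      have "2 * (sqrt (2^k) * \<bar>d k x\<bar>) * sqrt ((1/2)^k) \<le>
          (sqrt (2^k) * \<bar>d k x\<bar>)\<^sup>2 + (sqrt ((1/2)^k))\<^sup>2"
        by (rule sum_squares_bound)
      moreover have "sqrt (2^k) * sqrt ((1/2)^k) = 1"
        by (simp flip: real_sqrt_mult power_mult_distrib)
      then have "2 * (sqrt (2^k) * \<bar>d k x\<bar>) * sqrt ((1/2)^k) = 2 * \<bar>d k x\<bar>"
        by (metis (no_types, opaque_lifting) mult.assoc mult.commute mult.right_neutral)
      ultimately have "2 * \<bar>d k x\<bar> \<le> 2^k * (d k x)\<^sup>2 + (1/2)^k"
        by (simp add: power_mult_distrib)
      then show "norm (d k x) \<le> 2^k * (d k x)\<^sup>2 + (1/2)^k"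
        by simp
    qed
    then have "convergent (\<lambda>n. \<Sum>k<n. d k x)"
      by (simp add: summable_iff_convergent)
    then have "convergent (\<lambda>n. (\<Sum>k<n. d k x) + f 0 x)"
      by (intro convergent_add convergent_const)
    moreover have "(\<Sum>k<n. d k x) + f 0 x = f n x" for n
      unfolding d_def by (subst sum_lessThan_telescope) simp
    ultimately show "convergent (\<lambda>k. f k x)" by simp
  qed
  define g where "g x = lim (\<lambda>k. f k x)" for x
  have gm [measurable]: "g \<in> borel_measurable lebesgue"
    unfolding g_def by (rule borel_measurable_lim_metric) simp
  have lim: "AE x in lebesgue. (\<lambda>k. f k x) \<longlonglongrightarrow> g x"
    using conv by eventually_elim (simp add: g_def convergent_LIMSEQ_iff)
  have bound: "(\<integral>\<^sup>+x. ennreal ((g x - f k x)\<^sup>2) \<partial>lebesgue) \<le> ennreal ((1/4)^k)" for k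
  proof -
    have "(\<integral>\<^sup>+x. ennreal ((g x - f k x)\<^sup>2) \<partial>lebesgue) =
        (\<integral>\<^sup>+x. liminf (\<lambda>l. ennreal ((f l x - f k x)\<^sup>2)) \<partial>lebesgue)"
    proof (rule nn_integral_cong_AE)
      show "AE x in lebesgue. ennreal ((g x - f k x)\<^sup>2) = liminf (\<lambda>l. ennreal ((f l x - f k x)\<^sup>2))"
        using lim
      proof eventually_elim
        fix x assume "(\<lambda>l. f l x) \<longlonglongrightarrow> g x"
        then have "(\<lambda>l. ennreal ((f l x - f k x)\<^sup>2)) \<longlonglongrightarrow> ennreal ((g x - f k x)\<^sup>2)"
          by (intro tendsto_intros)
        from lim_imp_Liminf[OF _ this] show "ennreal ((g x - f k x)\<^sup>2) = liminf (\<lambda>l. ennreal ((f l x - f k x)\<^sup>2))"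
          by simp
      qed
    qed
    also have "\<dots> \<le> liminf (\<lambda>l. \<integral>\<^sup>+x. ennreal ((f l x - f k x)\<^sup>2) \<partial>lebesgue)"
      by (rule nn_integral_liminf) simp
    also have "\<dots> \<le> ennreal ((1/4)^k)"
    proof (rule Liminf_le)
      show "\<forall>\<^sub>F l in sequentially. (\<integral>\<^sup>+x. ennreal ((f l x - f k x)\<^sup>2) \<partial>lebesgue) \<le> ennreal ((1/4)^k)"
        using eventually_ge_at_top[of k]
      proof eventually_elim
        fix l assume "k \<le> l"
        have "(\<integral>\<^sup>+x. ennreal ((f l x - f k x)\<^sup>2) \<partial>lebesgue) = ennreal (LINT x|lebesgue. (f l x - f k x)\<^sup>2)"
          using square_integrable_diff[OF sf sf]
          by (intro nn_integral_eq_integral) (auto simp: square_integrable_def)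
        also have "\<dots> \<le> ennreal ((1/4)^k)" using dint[OF \<open>k \<le> l\<close>] by (rule ennreal_leI)
        finally show "(\<integral>\<^sup>+x. ennreal ((f l x - f k x)\<^sup>2) \<partial>lebesgue) \<le> ennreal ((1/4)^k)" .
      qed
    qed simp
    finally show ?thesis .
  qed
  have sgf: "square_integrable (\<lambda>x. g x - f k x)" for k
    unfolding square_integrable_def using bound[of k]
    by (auto intro!: integrableI_bounded simp: le_less_trans)
  have sg: "square_integrable g"
    using square_integrable_add[OF sgf[of 0] sf[of 0]] by simp
  have norm_le: "norm (abs_l2 g - X (s k)) \<le> (1/2)^k" for k
  proof -
    have "ennreal (LINT x|lebesgue. (g x - f k x)\<^sup>2) = (\<integral>\<^sup>+x. ennreal ((g x - f k x)\<^sup>2) \<partial>lebesgue)"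
      using sgf[of k] by (intro nn_integral_eq_integral[symmetric]) (auto simp: square_integrable_def)
    also have "\<dots> \<le> ennreal ((1/4)^k)" by (rule bound)
    finally have "(norm (abs_l2 g - X (s k)))\<^sup>2 \<le> (1/4)^k"
      by (simp add: Xf abs_l2_diff norm_abs_l2 sg sgf)
    also have "(1/4::real)^k = ((1/2)^k)\<^sup>2" by (simp add: power2_eq_square flip: power_mult_distrib)
    finally show ?thesis by (rule power2_le_imp_le) simp
  qed
  have "X \<longlonglongrightarrow> abs_l2 g"
  proof (rule metric_LIMSEQ_I)
    fix e :: real assume "e > 0"
    then obtain k where k: "(1/2::real)^k < e/2"
      using real_arch_pow_inv[of "e/2" "1/2"] by auto
    have "dist (X n) (abs_l2 g) < e" if "n \<ge> N k" for n
    proof -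
      have "dist (X n) (abs_l2 g) \<le> dist (X n) (X (s k)) + dist (X (s k)) (abs_l2 g)"
        by (rule dist_triangle)
      also have "\<dots> < (1/2)^k + (1/2)^k"
        using N[OF that sN] norm_le[of k] by (simp add: dist_norm norm_minus_commute add_less_le_mono)
      finally show ?thesis using k by simp
    qed
    then show "\<exists>n0. \<forall>n\<ge>n0. dist (X n) (abs_l2 g) < e" by blast
  qed
  then show "convergent X" by (rule convergentI)
qed

lemma square_integrable_indicator:
  "A \<in> lmeasurable \<Longrightarrow> square_integrable (indicat_real A)"
  unfolding square_integrable_def by (auto simp: fmeasurable_def power2_eq_square simp flip: indicator_inter_arith)

lemma closed_subspace_l2_eq_UNIV:
  fixes V :: "'a::euclidean_space l2 set"
  assumes V: "closed V" "subspace V"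
    and ind: "\<And>A. A \<in> lmeasurable \<Longrightarrow> abs_l2 (indicator A) \<in> V"
  shows "V = UNIV"
proof -
  have "abs_l2 f \<in> V" if f: "square_integrable f" for f
  proof -
    have fm: "f \<in> borel_measurable lebesgue" using f by (simp add: square_integrable_def)
    obtain F where F: "\<And>i. simple_function lebesgue (F i)"
        "\<And>x. (\<lambda>i. F i x) \<longlonglongrightarrow> f x" "\<And>i x. \<bar>F i x\<bar> \<le> 2 * \<bar>f x\<bar>"
      using borel_measurable_implies_sequence_metric[OF fm, of 0] by (auto simp: dist_real_def)
    have sF: "square_integrable (F i)" for i
      unfolding square_integrable_def
    proof
      show m: "F i \<in> borel_measurable lebesgue" using F(1) by (rule borel_measurable_simple_function)
      show "integrable lebesgue (\<lambda>x. (F i x)\<^sup>2)"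
      proof (rule Bochner_Integration.integrable_bound)
        show "integrable lebesgue (\<lambda>x. 4 * (f x)\<^sup>2)" using f by (simp add: square_integrable_def)
        have "(F i x)\<^sup>2 \<le> 4 * (f x)\<^sup>2" for x
          using power_mono[OF F(3)[of i x], of 2] by (simp add: power_mult_distrib)
        then show "AE x in lebesgue. norm ((F i x)\<^sup>2) \<le> norm (4 * (f x)\<^sup>2)" by simp
      qed (use m in simp)
    qed
    have "abs_l2 (F i) \<in> V" for i
    proof -
      define R where "R = F i ` UNIV - {0}"
      have finR: "finite R" using F(1)[of i] by (simp add: R_def simple_function_def)
      define A where "A y = F i -` {y}" for y
      have A: "A y \<in> lmeasurable" if "y \<in> R" for y
      proof -
        have As: "A y \<in> sets lebesgue"
          using simple_functionD(2)[OF F(1)[of i], of "{y}"] by (simp add: A_def)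
        have "y \<noteq> 0" using that by (simp add: R_def)
        have "integrable lebesgue (indicat_real (A y))"
        proof (rule Bochner_Integration.integrable_bound)
          show "integrable lebesgue (\<lambda>x. (1 / y\<^sup>2) * (F i x)\<^sup>2)"
            using sF[of i] by (simp add: square_integrable_def)
          show "AE x in lebesgue. norm (indicat_real (A y) x) \<le> norm ((1 / y\<^sup>2) * (F i x)\<^sup>2)"
            using \<open>y \<noteq> 0\<close> by (intro AE_I2) (auto simp: A_def indicator_def)
        qed (use As in simp)
        then show ?thesis
          by (auto simp: fmeasurable_def integrable_indicator_iff As)
      qed
      have rep: "F i x = (\<Sum>y\<in>R. y * indicat_real (A y) x)" for x
      proof (cases "F i x = 0")
        case True
        then show ?thesis by (auto simp: R_def A_def indicator_def)
      next
        case False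
        then have "(\<Sum>y\<in>R. y * indicat_real (A y) x) = (\<Sum>y\<in>{F i x}. y * indicat_real (A y) x)"
          by (intro sum.mono_neutral_right finR) (auto simp: R_def A_def indicator_def)
        then show ?thesis by (simp add: A_def)
      qed
      define g where "g y x = y * indicat_real (A y) x" for y x
      have sA: "square_integrable (indicat_real (A y))" if "y \<in> R" for y
        using A that by (intro square_integrable_indicator) auto
      have sg: "square_integrable (g y)" if "y \<in> R" for y
        unfolding g_def by (intro square_integrable_scale sA that)
      have gV: "abs_l2 (g y) \<in> V" if "y \<in> R" for y
        using subspace_scale[OF V(2) ind[OF A[OF that]], of y] sA[OF that]
        by (simp add: abs_l2_scaleR g_def[abs_def])
      have "finite Q \<Longrightarrow> Q \<subseteq> R \<Longrightarrow>
          square_integrable (\<lambda>x. \<Sum>y\<in>Q. g y x) \<and> abs_l2 (\<lambda>x. \<Sum>y\<in>Q. g y x) \<in> V" for Q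
      proof (induction Q rule: finite_induct)
        case empty
        then show ?case using V(2) by (simp add: abs_l2_zero subspace_0)
      next
        case (insert y Q)
        have "abs_l2 (g y) + abs_l2 (\<lambda>x. \<Sum>y\<in>Q. g y x) \<in> V"
          using insert gV V(2) by (intro subspace_add) auto
        then show ?case
          using insert sg by (simp add: abs_l2_add square_integrable_add)
      qed
      from this[OF finR order_refl] show ?thesis
        by (simp add: g_def flip: rep)
    qed
    moreover have "(\<lambda>i. abs_l2 (F i)) \<longlonglongrightarrow> abs_l2 f"
    proof (rule tendsto_abs_l2_dominated[OF f sF, where w = "\<lambda>x. 9 * (f x)\<^sup>2"])
      show "integrable lebesgue (\<lambda>x. 9 * (f x)\<^sup>2)" using f by (simp add: square_integrable_def)
      fix k
      have "(F k x - f x)\<^sup>2 \<le> 9 * (f x)\<^sup>2" for x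
      proof -
        have "\<bar>F k x - f x\<bar> \<le> 3 * \<bar>f x\<bar>" using F(3)[of k x] by linarith
        from power_mono[OF this, of 2] show ?thesis by (simp add: power_mult_distrib)
      qed
      then show "AE x in lebesgue. (F k x - f x)\<^sup>2 \<le> 9 * (f x)\<^sup>2" by simp
    qed (use F in simp)
    ultimately show ?thesis using closed_sequentially[OF V(1), of "\<lambda>i. abs_l2 (F i)"] by simp
  qed
  then have "v \<in> V" for v using abs_l2_rep_l2[of v] square_integrable_rep_l2 by metis
  then show ?thesis by auto
qed

lemma tendsto_abs_l2_indicator:
  fixes A :: "nat \<Rightarrow> 'a::euclidean_space set"
  assumes A: "\<And>k. A k \<in> lmeasurable" and B: "B \<in> lmeasurable" "\<And>k. A k \<subseteq> B"
    and lim: "\<And>x. x \<in> B \<Longrightarrow> eventually (\<lambda>k. x \<in> A k) sequentially"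
  shows "(\<lambda>k. abs_l2 (indicator (A k))) \<longlonglongrightarrow> abs_l2 (indicat_real B)"
proof (rule tendsto_abs_l2_dominated[where w = "indicat_real B"])
  show "integrable lebesgue (indicat_real B)"
    using B(1) by (auto simp: fmeasurable_def)
  show "AE x in lebesgue. (\<lambda>k. indicat_real (A k) x) \<longlonglongrightarrow> indicator B x"
  proof (intro AE_I2 tendsto_eventually)
    fix x
    show "\<forall>\<^sub>F k in sequentially. indicat_real (A k) x = indicator B x"
    proof (cases "x \<in> B")
      case True
      from lim[OF this] show ?thesis by eventually_elim (use True in simp)
    next
      case False
      then have "x \<notin> A k" for k using B(2) by blast
      with False show ?thesis by simp
    qed
  qed
  show "AE x in lebesgue. (indicat_real (A k) x - indicator B x)\<^sup>2 \<le> indicator B x" for k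
    using B(2)[of k] by (intro AE_I2) (auto simp: indicator_def)
qed (use A B square_integrable_indicator in auto)

lemma countable_dense_l2: "\<exists>D::'a::euclidean_space l2 set. countable D \<and> closure D = UNIV"
proof -
  obtain B :: "'a set set" where B: "countable B" "topological_basis B"
    using ex_countable_basis by auto
  define G where "G = Inter ` {F. finite F \<and> F \<subseteq> B}"
  have countG: "countable G"
    unfolding G_def by (intro countable_image countable_Collect_finite_subset B)
  have stable: "Int_stable G"
  proof (rule Int_stableI)
    fix a b assume "a \<in> G" "b \<in> G"
    then obtain F F' where "finite F" "F \<subseteq> B" "a = \<Inter>F" "finite F'" "F' \<subseteq> B" "b = \<Inter>F'"
      by (auto simp: G_def)
    then show "a \<inter> b \<in> G" unfolding G_def
      by (intro image_eqI[of _ _ "F \<union> F'"]) auto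
  qed
  have openG: "open g" if g: "g \<in> G" for g
  proof -
    obtain F where F: "finite F" "F \<subseteq> B" "g = \<Inter>F" using g by (auto simp: G_def)
    have "open S" if "S \<in> F" for S using topological_basis_open[OF B(2), of S] F(2) that by auto
    with F show ?thesis by (simp add: open_Inter)
  qed
  have sigmaG: "sigma_sets UNIV G = sets borel"
  proof
    show "sigma_sets UNIV G \<subseteq> sets borel"
      using openG by (intro sets.sigma_sets_subset[of G borel, simplified]) auto
    have "B \<subseteq> G"
    proof
      fix b assume "b \<in> B"
      then show "b \<in> G" unfolding G_def by (intro image_eqI[of _ _ "{b}"]) auto
    qed
    then show "sets borel \<subseteq> sigma_sets UNIV G"
      unfolding borel_eq_countable_basis[OF B] by (simp add: sigma_sets_mono')
  qed
  define C where "C n = ball (0::'a) (real n)" for n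
  have C: "S \<inter> C n \<in> lmeasurable" if "S \<in> sets lebesgue" for S n
    using that fmeasurable_Int_fmeasurable[of "C n" lebesgue S] by (simp add: C_def Int_commute)
  have CB: "S \<in> sets lebesgue" if "S \<in> sets borel" for S :: "'a set" using that by simp
  define ind where "ind S = abs_l2 (indicat_real S)" for S :: "'a set"
  define T where "T = (\<lambda>(g, n). ind (g \<inter> C n)) ` (G \<times> UNIV)"
  have countT: "countable T" unfolding T_def using countG by auto
  define h :: "(rat \<times> 'a l2) list \<Rightarrow> 'a l2" where "h l = (\<Sum>(q, s)\<leftarrow>l. real_of_rat q *\<^sub>R s)" for l
  define D where "D = h ` lists (UNIV \<times> T)"
  have countD: "countable D"
    unfolding D_def using countT by auto
  have D0: "0 \<in> D" unfolding D_def h_def by (rule image_eqI[of _ _ "[]"]) auto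
  have Dadd: "v + w \<in> D" if vw: "v \<in> D" "w \<in> D" for v w
  proof -
    obtain l m where "l \<in> lists (UNIV \<times> T)" "m \<in> lists (UNIV \<times> T)" "v = h l" "w = h m"
      using vw by (auto simp: D_def)
    then show ?thesis unfolding D_def by (intro image_eqI[of _ _ "l @ m"]) (auto simp: h_def)
  qed
  have Dscale: "real_of_rat q *\<^sub>R v \<in> D" if v: "v \<in> D" for q v
  proof -
    obtain l where l: "l \<in> lists (UNIV \<times> T)" "v = h l" using v by (auto simp: D_def)
    have "real_of_rat q *\<^sub>R h l = h (map (\<lambda>(p, s). (q * p, s)) l)"
      by (induction l) (auto simp: h_def scaleR_add_right of_rat_mult)
    then show ?thesis unfolding D_def using l
      by (intro image_eqI[of _ _ "map (\<lambda>(p, s). (q * p, s)) l"]) auto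
  qed
  have TD: "T \<subseteq> D"
  proof
    fix s assume "s \<in> T"
    then show "s \<in> D" unfolding D_def h_def by (intro image_eqI[of _ _ "[(1, s)]"]) auto
  qed
  define V where "V = closure D"
  have clV: "closed V" by (simp add: V_def)
  have DV: "D \<subseteq> V" by (simp add: V_def closure_subset)
  have Vadd: "v + w \<in> V" if vw: "v \<in> V" "w \<in> V" for v w
  proof -
    obtain x y where "\<And>n. x n \<in> D" "x \<longlonglongrightarrow> v" "\<And>n. y n \<in> D" "y \<longlonglongrightarrow> w"
      using vw unfolding V_def closure_sequential by auto
    then have "\<And>n. x n + y n \<in> D" "(\<lambda>n. x n + y n) \<longlonglongrightarrow> v + w"
      using Dadd by (auto intro: tendsto_add)
    then show ?thesis unfolding V_def closure_sequential by (intro exI[of _ "\<lambda>n. x n + y n"]) auto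
  qed
  have VscaleQ: "real_of_rat q *\<^sub>R v \<in> V" if v: "v \<in> V" for q v
  proof -
    obtain x where "\<And>n. x n \<in> D" "x \<longlonglongrightarrow> v"
      using v unfolding V_def closure_sequential by auto
    then have "\<And>n. real_of_rat q *\<^sub>R x n \<in> D" "(\<lambda>n. real_of_rat q *\<^sub>R x n) \<longlonglongrightarrow> real_of_rat q *\<^sub>R v"
      using Dscale by (auto intro: tendsto_scaleR)
    then show ?thesis
      unfolding V_def closure_sequential by (intro exI[of _ "\<lambda>n. real_of_rat q *\<^sub>R x n"]) auto
  qed
  have Vscale: "c *\<^sub>R v \<in> V" if "v \<in> V" for c v
  proof -
    have "\<exists>q. c < real_of_rat q \<and> real_of_rat q < c + 1 / real (Suc n)" for n
      by (rule of_rat_dense) simp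
    then obtain q where q: "\<And>n. c < real_of_rat (q n)" "\<And>n. real_of_rat (q n) < c + 1 / real (Suc n)"
      by metis
    have "(\<lambda>n. c + 1 / real (Suc n)) \<longlonglongrightarrow> c + 0"
      by (intro tendsto_add tendsto_const LIMSEQ_Suc lim_1_over_n)
    then have lim: "(\<lambda>n. c + 1 / real (Suc n)) \<longlonglongrightarrow> c" by simp
    have "(\<lambda>n. real_of_rat (q n)) \<longlonglongrightarrow> c"
    proof (rule tendsto_sandwich[OF _ _ tendsto_const lim])
      show "\<forall>\<^sub>F n in sequentially. c \<le> real_of_rat (q n)"
        using q(1) by (intro always_eventually allI less_imp_le)
      show "\<forall>\<^sub>F n in sequentially. real_of_rat (q n) \<le> c + 1 / real (Suc n)"
        using q(2) by (intro always_eventually allI less_imp_le)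
    qed
    then have "(\<lambda>n. real_of_rat (q n) *\<^sub>R v) \<longlonglongrightarrow> c *\<^sub>R v" by (intro tendsto_scaleR tendsto_const)
    then show ?thesis
      using closed_sequentially[OF clV, of "\<lambda>n. real_of_rat (q n) *\<^sub>R v"] VscaleQ[OF that] by simp
  qed
  have subV: "subspace V"
    using D0 DV by (auto intro!: subspaceI Vadd Vscale)
  have ind_diff: "ind (S - R) = ind S - ind R"
    if "S \<in> lmeasurable" "R \<in> lmeasurable" "R \<subseteq> S" for S R
  proof -
    have "indicat_real (S - R) = (\<lambda>x. indicat_real S x - indicat_real R x)"
      using that(3) by (intro ext) (auto simp: indicator_def)
    then show ?thesis
      using that by (simp add: ind_def abs_l2_diff square_integrable_indicator)
  qed
  have ind_Un: "ind (S \<union> R) = ind S + ind R"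
    if "S \<in> lmeasurable" "R \<in> lmeasurable" "S \<inter> R = {}" for S R
  proof -
    have "indicat_real (S \<union> R) = (\<lambda>x. indicat_real S x + indicat_real R x)"
      using that(3) by (intro ext) (auto simp: indicator_def)
    then show ?thesis
      using that by (simp add: ind_def abs_l2_add square_integrable_indicator)
  qed
  have ind_empty: "ind {} = 0"
    using abs_l2_zero by (simp add: ind_def indicator_def[abs_def])
  have indC: "ind (A \<inter> C n) \<in> V" if "A \<in> sets borel" for A n
  proof -
    have A: "A \<in> sigma_sets UNIV G" using that sigmaG by simp
    have gen: "ind (g \<inter> C n) \<in> V" if "g \<in> G" for g
      using that TD DV by (force simp: T_def)
    have "G \<subseteq> Pow UNIV" by simp
    from stable this A show ?thesis
    proof (induction rule: sigma_sets_induct_disjoint)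
      case (basic A)
      then show ?case by (rule gen)
    next
      case empty
      then show ?case using ind_empty D0 DV by auto
    next
      case (compl A)
      have "UNIV \<in> G" unfolding G_def by (intro image_eqI[of _ _ "{}"]) auto
      from gen[OF this] have "ind (C n) \<in> V" by simp
      moreover have "A \<in> sets lebesgue" using compl(1) sigmaG by auto
      then have "ind (C n - A \<inter> C n) = ind (C n) - ind (A \<inter> C n)"
        using C[of UNIV n] C[of A n] by (intro ind_diff) auto
      moreover have "(UNIV - A) \<inter> C n = C n - A \<inter> C n" by auto
      ultimately show ?case using compl(2) subV by (simp add: subspace_diff)
    next
      case (union A)
      have Am: "A i \<in> sets lebesgue" for i using union(2) sigmaG by auto
      have fin: "ind ((\<Union>i<k. A i) \<inter> C n) \<in> V" for k
      proof (induction k)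
        case 0
        then show ?case using ind_empty D0 DV by auto
      next
        case (Suc k)
        have "(\<Union>i<Suc k. A i) \<inter> C n = ((\<Union>i<k. A i) \<inter> C n) \<union> (A k \<inter> C n)"
          by (auto simp: less_Suc_eq)
        moreover have "ind \<dots> = ind ((\<Union>i<k. A i) \<inter> C n) + ind (A k \<inter> C n)"
        proof (intro ind_Un C)
          have "A i \<inter> A k = {}" if "i < k" for i
            using union(1) that by (auto simp: disjoint_family_on_def)
          then show "(\<Union>i<k. A i) \<inter> C n \<inter> (A k \<inter> C n) = {}" by blast
        qed (use Am in auto)
        ultimately show ?case using Suc union(3) Vadd by simp
      qed
      have "(\<lambda>k. ind ((\<Union>i<k. A i) \<inter> C n)) \<longlonglongrightarrow> ind ((\<Union>i. A i) \<inter> C n)"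
        unfolding ind_def
      proof (rule tendsto_abs_l2_indicator)
        fix x assume "x \<in> (\<Union>i. A i) \<inter> C n"
        then obtain i where i: "x \<in> A i" "x \<in> C n" by auto
        show "\<forall>\<^sub>F k in sequentially. x \<in> (\<Union>i<k. A i) \<inter> C n"
          using eventually_gt_at_top[of i] by eventually_elim (use i in auto)
      qed (use Am in \<open>auto intro!: C\<close>)
      then show ?case
        using closed_sequentially[OF clV, of "\<lambda>k. ind ((\<Union>i<k. A i) \<inter> C n)"] fin by simp
    qed
  qed
  have indall: "ind A \<in> V" if A: "A \<in> lmeasurable" for A
  proof -
    have "A \<in> sets (completion lborel)" using A by (simp add: fmeasurable_def)
    from sets_completionE[OF this] obtain S N N' where
      SN: "A = S \<union> N" "N \<subseteq> N'" "N' \<in> null_sets lborel" "S \<in> sets lborel" by metis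
    have S: "S \<in> sets borel" using SN(4) by simp
    have AE: "AE x in lebesgue. x \<notin> N'"
      using SN(3) by (intro AE_not_in) (simp add: null_sets_completionI)
    have "ind (A \<inter> C n) = ind (S \<inter> C n)" for n
    proof -
      have "AE x in lebesgue. indicat_real (A \<inter> C n) x = indicator (S \<inter> C n) x"
        using AE by eventually_elim (use SN(1,2) in \<open>auto simp: indicator_def\<close>)
      then show ?thesis
        unfolding ind_def using A C[of A n] C[OF CB[OF S], of n]
        by (subst abs_l2_eq_iff) (auto intro!: square_integrable_indicator simp: fmeasurable_def)
    qed
    then have "ind (A \<inter> C n) \<in> V" for n using indC[OF S] by simp
    moreover have "(\<lambda>n. ind (A \<inter> C n)) \<longlonglongrightarrow> ind A"
      unfolding ind_def
    proof (rule tendsto_abs_l2_indicator)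
      fix x assume "x \<in> A"
      obtain m where m: "norm x < real m" using reals_Archimedean2 by blast
      show "\<forall>\<^sub>F k in sequentially. x \<in> A \<inter> C k"
        using eventually_ge_at_top[of m] by eventually_elim (use m \<open>x \<in> A\<close> in \<open>auto simp: C_def\<close>)
    qed (use A in \<open>auto intro!: C fmeasurableD\<close>)
    ultimately show ?thesis using closed_sequentially[OF clV, of "\<lambda>n. ind (A \<inter> C n)"] by simp
  qed
  have "V = UNIV"
    using closed_subspace_l2_eq_UNIV[OF clV subV] indall by (simp add: ind_def)
  then show ?thesis using countD V_def by blast
qed

instance l2 :: (euclidean_space) second_countable_topology
proof
  obtain D :: "'a l2 set" where D: "countable D" "closure D = UNIV"
    using countable_dense_l2 by blast
  define B where "B = (\<lambda>(d, n). ball d (1 / real (Suc n))) ` (D \<times> UNIV)"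
  have "topological_basis B"
  proof (rule topological_basisI)
    fix U :: "'a l2 set" and x assume U: "open U" "x \<in> U"
    then obtain e where e: "e > 0" "ball x e \<subseteq> U" using openE by blast
    obtain n where n: "1 / real (Suc n) < e / 2" using nat_approx_posE[of "e/2"] e by auto
    have "x \<in> closure D" using D by simp
    then obtain d where d: "d \<in> D" "dist d x < 1 / real (Suc n)"
      using closure_approachable[of x D] by (metis of_nat_0_less_iff zero_less_Suc zero_less_divide_1_iff)
    have "ball d (1 / real (Suc n)) \<subseteq> ball x e"
    proof
      fix y assume "y \<in> ball d (1 / real (Suc n))"
      then have "dist x y < 1 / real (Suc n) + 1 / real (Suc n)"
        using d(2) dist_triangle[of x y d] by (simp add: dist_commute)
      then show "y \<in> ball x e" using n by simp
    qed
    then show "\<exists>B'\<in>B. x \<in> B' \<and> B' \<subseteq> U"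
      using d e by (intro bexI[of _ "ball d (1 / real (Suc n))"]) (auto simp: B_def)
  qed (auto simp: B_def)
  moreover have "countable B" unfolding B_def using D(1) by auto
  ultimately show "\<exists>B::'a l2 set set. countable B \<and> open = generate_topology B"
    using topological_basis_imp_subbasis by blast
qed


section \<open>Domains, test functions and Sobolev spaces\<close>

text \<open>Near every boundary point, and in suitable Cartesian coordinates with last axis \<open>n\<close>,
  the domain is the part of a ball lying strictly above the graph of a Lipschitz function.\<close>
definition lipschitz_domain :: "'a::euclidean_space set \<Rightarrow> bool" where
  "lipschitz_domain \<Omega> \<longleftrightarrow> open \<Omega> \<and> connected \<Omega> \<and> \<Omega> \<noteq> {} \<and>
     (\<forall>p\<in>frontier \<Omega>. \<exists>n \<gamma> M r. norm n = 1 \<and> r > 0 \<and> M-lipschitz_on {z. z \<bullet> n = 0} \<gamma> \<and>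
        (\<forall>y\<in>ball p r. y \<in> \<Omega> \<longleftrightarrow> \<gamma> (y - (y \<bullet> n) *\<^sub>R n) < y \<bullet> n))"

definition partial_deriv :: "'a::euclidean_space \<Rightarrow> ('a \<Rightarrow> real) \<Rightarrow> 'a \<Rightarrow> real" where
  "partial_deriv i \<phi> x = frechet_derivative \<phi> (at x) i"

primrec C_k :: "nat \<Rightarrow> ('a::euclidean_space \<Rightarrow> real) \<Rightarrow> bool" where
  "C_k 0 \<phi> \<longleftrightarrow> continuous_on UNIV \<phi>"
| "C_k (Suc k) \<phi> \<longleftrightarrow> (\<forall>x. \<phi> differentiable (at x)) \<and> (\<forall>i\<in>Basis. C_k k (partial_deriv i \<phi>))"

definition test_functions :: "'a::euclidean_space set \<Rightarrow> ('a \<Rightarrow> real) set" where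
  "test_functions \<Omega> = {\<phi>. (\<forall>k. C_k k \<phi>) \<and> (\<exists>K. compact K \<and> K \<subseteq> \<Omega> \<and> (\<forall>x. x \<notin> K \<longrightarrow> \<phi> x = 0))}"

text \<open>The space L2 over a set is identified with the closed subspace of those elements of
  L2 over the whole space that vanish almost everywhere outside the set.\<close>
definition l2_on :: "'a::euclidean_space set \<Rightarrow> 'a l2 set" where
  "l2_on \<Omega> = {v. AE x in lebesgue. x \<notin> \<Omega> \<longrightarrow> rep_l2 v x = 0}"

definition has_weak_partial :: "'a::euclidean_space set \<Rightarrow> 'a \<Rightarrow> 'a l2 \<Rightarrow> 'a l2 \<Rightarrow> bool" where
  "has_weak_partial \<Omega> i v g \<longleftrightarrow> g \<in> l2_on \<Omega> \<and>
     (\<forall>\<phi>\<in>test_functions \<Omega>. (LINT x|lebesgue_on \<Omega>. rep_l2 v x * partial_deriv i \<phi> x) =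
                         - (LINT x|lebesgue_on \<Omega>. rep_l2 g x * \<phi> x))"

definition weak_partial :: "'a::euclidean_space set \<Rightarrow> 'a \<Rightarrow> 'a l2 \<Rightarrow> 'a l2" where
  "weak_partial \<Omega> i v = (THE g. has_weak_partial \<Omega> i v g)"

definition H1 :: "'a::euclidean_space set \<Rightarrow> 'a l2 set" where
  "H1 \<Omega> = {v \<in> l2_on \<Omega>. \<forall>i\<in>Basis. \<exists>g. has_weak_partial \<Omega> i v g}"

text \<open>The closure of the test functions in \<open>H1 \<Omega>\<close>, which encodes zero boundary values.\<close>
definition H10 :: "'a::euclidean_space set \<Rightarrow> 'a l2 set" where
  "H10 \<Omega> = {v \<in> H1 \<Omega>. \<forall>\<epsilon>>0. \<exists>\<phi>\<in>test_functions \<Omega>.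
     (norm (v - abs_l2 \<phi>))\<^sup>2 +
     (\<Sum>i\<in>Basis. (norm (weak_partial \<Omega> i v - abs_l2 (partial_deriv i \<phi>)))\<^sup>2) < \<epsilon>\<^sup>2}"

definition L_infty ::
    "real \<Rightarrow> real \<Rightarrow> 'b::{banach, second_countable_topology} set \<Rightarrow> (real \<Rightarrow> 'b) \<Rightarrow> bool" where
  "L_infty a b X g \<longleftrightarrow> g \<in> borel_measurable (lebesgue_on {a<..<b}) \<and>
     (\<exists>M. AE t in lebesgue_on {a<..<b}. g t \<in> X \<and> norm (g t) \<le> M)"

definition W1_infty ::
    "real \<Rightarrow> real \<Rightarrow> 'b::{banach, second_countable_topology} set \<Rightarrow> (real \<Rightarrow> 'b) \<Rightarrow> bool" where
  "W1_infty a b X y \<longleftrightarrow> L_infty a b X y \<and>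
     (\<exists>g. L_infty a b X g \<and>
        (\<forall>\<phi>\<in>test_functions {a<..<b}. (LINT t|lebesgue_on {a<..<b}. deriv \<phi> t *\<^sub>R y t) =
                                  - (LINT t|lebesgue_on {a<..<b}. \<phi> t *\<^sub>R g t)))"

definition regular :: "'a::euclidean_space set \<Rightarrow> real \<Rightarrow> (real \<Rightarrow> 'a l2) \<Rightarrow> bool" where
  "regular \<Omega> T y \<longleftrightarrow>
     continuous_on {0..T} y \<and> (\<forall>t\<in>{0..T}. y t \<in> l2_on \<Omega>) \<and>
     (\<forall>\<epsilon>\<in>{0<..T}. W1_infty \<epsilon> T (l2_on \<Omega>) y) \<and>
     (\<forall>t\<in>{0<..T}. y t \<in> H10 \<Omega>)"


section \<open>The elliptic operator\<close>

definition bounded_coeff :: "'a::euclidean_space set \<Rightarrow> ('a \<Rightarrow> real) \<Rightarrow> bool" where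
  "bounded_coeff \<Omega> g \<longleftrightarrow>
     g \<in> borel_measurable (lebesgue_on \<Omega>) \<and> (\<exists>M. AE x in lebesgue_on \<Omega>. \<bar>g x\<bar> \<le> M)"

text \<open>Second-order operators in divergence form, with \<open>i\<close> and \<open>j\<close> ranging over the
  coordinate directions:
  \<open>L v = - (\<Sum>i j. \<partial>i (a i j * \<partial>j v)) + (\<Sum>j. b j * \<partial>j v) + c * v\<close>.\<close>
definition elliptic_coeffs ::
    "'a::euclidean_space set \<Rightarrow> ('a \<Rightarrow> 'a \<Rightarrow> 'a \<Rightarrow> real) \<Rightarrow> ('a \<Rightarrow> 'a \<Rightarrow> real) \<Rightarrow> ('a \<Rightarrow> real) \<Rightarrow> bool" where
  "elliptic_coeffs \<Omega> a b c \<longleftrightarrow>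
     (\<forall>i\<in>Basis. \<forall>j\<in>Basis. bounded_coeff \<Omega> (a i j)) \<and>
     (\<forall>j\<in>Basis. bounded_coeff \<Omega> (b j)) \<and> bounded_coeff \<Omega> c \<and>
     (\<exists>\<theta>>0. AE x in lebesgue_on \<Omega>. \<forall>\<xi>.
        \<theta> * (norm \<xi>)\<^sup>2 \<le> (\<Sum>i\<in>Basis. \<Sum>j\<in>Basis. a i j x * (\<xi> \<bullet> i) * (\<xi> \<bullet> j)))"

definition elliptic_form ::
    "'a::euclidean_space set \<Rightarrow> ('a \<Rightarrow> 'a \<Rightarrow> 'a \<Rightarrow> real) \<Rightarrow> ('a \<Rightarrow> 'a \<Rightarrow> real) \<Rightarrow> ('a \<Rightarrow> real) \<Rightarrow>
     ('a \<Rightarrow> real) \<Rightarrow> ('a \<Rightarrow> 'a \<Rightarrow> real) \<Rightarrow> ('a \<Rightarrow> real) \<Rightarrow> ('a \<Rightarrow> 'a \<Rightarrow> real) \<Rightarrow> real" where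
  "elliptic_form \<Omega> a b c v Dv w Dw =
     (LINT x|lebesgue_on \<Omega>. (\<Sum>i\<in>Basis. \<Sum>j\<in>Basis. a i j x * Dv j x * Dw i x) +
                         (\<Sum>j\<in>Basis. b j x * Dv j x) * w x + c x * v x * w x)"

text \<open>For \<open>v\<close> in \<open>H1 \<Omega>\<close>, the distribution \<open>L v\<close> and (for \<open>v\<close>, \<open>w\<close> in \<open>H10 \<Omega>\<close>) the duality
  pairing of \<open>L v\<close> with \<open>w\<close>, which is the L2 inner product whenever \<open>L v\<close> is in L2.\<close>
definition elliptic_op ::
    "'a::euclidean_space set \<Rightarrow> ('a \<Rightarrow> 'a \<Rightarrow> 'a \<Rightarrow> real) \<Rightarrow> ('a \<Rightarrow> 'a \<Rightarrow> real) \<Rightarrow> ('a \<Rightarrow> real) \<Rightarrow>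
     'a l2 \<Rightarrow> ('a \<Rightarrow> real) \<Rightarrow> real" where
  "elliptic_op \<Omega> a b c v \<phi> =
     elliptic_form \<Omega> a b c (rep_l2 v) (\<lambda>i. rep_l2 (weak_partial \<Omega> i v)) \<phi> (\<lambda>i. partial_deriv i \<phi>)"

definition elliptic_pairing ::
    "'a::euclidean_space set \<Rightarrow> ('a \<Rightarrow> 'a \<Rightarrow> 'a \<Rightarrow> real) \<Rightarrow> ('a \<Rightarrow> 'a \<Rightarrow> real) \<Rightarrow> ('a \<Rightarrow> real) \<Rightarrow>
     'a l2 \<Rightarrow> 'a l2 \<Rightarrow> real" where
  "elliptic_pairing \<Omega> a b c v w =
     elliptic_form \<Omega> a b c (rep_l2 v) (\<lambda>i. rep_l2 (weak_partial \<Omega> i v))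
       (rep_l2 w) (\<lambda>i. rep_l2 (weak_partial \<Omega> i w))"


section \<open>The multiterm fractional equation and its residual\<close>

text \<open>The Caputo derivative of order \<open>\<alpha> < 1\<close> at \<open>t > 0\<close>, with a Bochner integral.\<close>
definition frac_deriv ::
    "real \<Rightarrow> (real \<Rightarrow> 'b::{banach, second_countable_topology}) \<Rightarrow> real \<Rightarrow> 'b" where
  "frac_deriv \<alpha> y t =
     (1 / Gamma (1 - \<alpha>)) *\<^sub>R
       (t powr (- \<alpha>) *\<^sub>R (y t - y 0) +
        (LBINT s:{0<..<t}. (\<alpha> * (t - s) powr (- \<alpha> - 1)) *\<^sub>R (y t - y s)))"

definition multiterm_deriv ::
    "nat \<Rightarrow> (nat \<Rightarrow> real) \<Rightarrow> (nat \<Rightarrow> real \<Rightarrow> real) \<Rightarrow>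
     (real \<Rightarrow> 'b::{banach, second_countable_topology}) \<Rightarrow> real \<Rightarrow> 'b" where
  "multiterm_deriv l \<alpha> q y t = (\<Sum>i=1..l. q i t *\<^sub>R frac_deriv (\<alpha> i) y t)"

definition locally_integrable :: "'a::euclidean_space set \<Rightarrow> ('a \<Rightarrow> real) \<Rightarrow> bool" where
  "locally_integrable \<Omega> g \<longleftrightarrow> (\<forall>K. compact K \<longrightarrow> K \<subseteq> \<Omega> \<longrightarrow> set_integrable lebesgue K g)"

text \<open>The residual of \<open>y\<close> at time \<open>t\<close> as a distribution, acting on test functions.\<close>
definition residual ::
    "'a::euclidean_space set \<Rightarrow> nat \<Rightarrow> (nat \<Rightarrow> real) \<Rightarrow> (nat \<Rightarrow> real \<Rightarrow> real) \<Rightarrow>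
     ('a l2 \<Rightarrow> ('a \<Rightarrow> real) \<Rightarrow> real) \<Rightarrow> ('a \<Rightarrow> real \<Rightarrow> real) \<Rightarrow>
     (real \<Rightarrow> 'a l2) \<Rightarrow> real \<Rightarrow> ('a \<Rightarrow> real) \<Rightarrow> real" where
  "residual \<Omega> l \<alpha> q L f y t \<phi> =
     (LINT x|lebesgue_on \<Omega>. rep_l2 (multiterm_deriv l \<alpha> q y t) x * \<phi> x) + L (y t) \<phi> -
     (LINT x|lebesgue_on \<Omega>. f x t * \<phi> x)"

text \<open>The L2 norm of a distribution: at most one \<open>r\<close> qualifies, and the value is \<open>\<infinity>\<close> if
  the distribution is not represented by an L2 function.\<close>
definition distr_l2_norm :: "'a::euclidean_space set \<Rightarrow> (('a \<Rightarrow> real) \<Rightarrow> real) \<Rightarrow> ennreal" where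
  "distr_l2_norm \<Omega> F =
     (INF r\<in>{r \<in> l2_on \<Omega>. \<forall>\<phi>\<in>test_functions \<Omega>. F \<phi> = (LINT x|lebesgue_on \<Omega>. rep_l2 r x * \<phi> x)}.
        ennreal (norm r))"

definition solution ::
    "'a::euclidean_space set \<Rightarrow> real \<Rightarrow> nat \<Rightarrow> (nat \<Rightarrow> real) \<Rightarrow> (nat \<Rightarrow> real \<Rightarrow> real) \<Rightarrow>
     ('a l2 \<Rightarrow> ('a \<Rightarrow> real) \<Rightarrow> real) \<Rightarrow> ('a \<Rightarrow> real \<Rightarrow> real) \<Rightarrow> 'a l2 \<Rightarrow>
     (real \<Rightarrow> 'a l2) \<Rightarrow> bool" where
  "solution \<Omega> T l \<alpha> q L f u0 u \<longleftrightarrow>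
     regular \<Omega> T u \<and> u 0 = u0 \<and>
     (\<forall>t\<in>{0<..T}. \<forall>\<phi>\<in>test_functions \<Omega>. residual \<Omega> l \<alpha> q L f u t \<phi> = 0)"


section \<open>The barrier function and its residual\<close>

definition gauss_2F1 :: "real \<Rightarrow> real \<Rightarrow> real \<Rightarrow> real \<Rightarrow> real" where
  "gauss_2F1 a b c z =
     (\<Sum>n. pochhammer a n * pochhammer b n / (pochhammer c n * fact n) * z ^ n)"

text \<open>\<open>rGamma 0 = 0\<close>, so the second term vanishes for \<open>i = 1\<close>.\<close>
definition rho :: "(nat \<Rightarrow> real) \<Rightarrow> nat \<Rightarrow> real \<Rightarrow> real" where
  "rho \<alpha> i s =
     (if s \<ge> 1 then 0
      else let \<beta> = 1 - \<alpha> 1 in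
        gauss_2F1 (\<alpha> i) (- \<beta>) (\<alpha> 1) s
        - Gamma (\<alpha> 1) * Gamma (1 - \<alpha> i) * rGamma (\<alpha> 1 - \<alpha> i) * s powr \<beta>)"

definition E1 :: "(nat \<Rightarrow> real) \<Rightarrow> real \<Rightarrow> real \<Rightarrow> real" where
  "E1 \<alpha> \<tau> t = (if t = 0 then 0 else (max \<tau> t) powr (\<alpha> 1 - 1))"

definition R1 ::
    "nat \<Rightarrow> (nat \<Rightarrow> real) \<Rightarrow> (nat \<Rightarrow> real \<Rightarrow> real) \<Rightarrow> real \<Rightarrow> real \<Rightarrow> real \<Rightarrow> real" where
  "R1 l \<alpha> q lam \<tau> t =
     (let \<beta> = 1 - \<alpha> 1 in
        lam * E1 \<alpha> \<tau> t
        + \<tau> powr (- \<beta>) *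
            (\<Sum>i=1..l. q i t * t powr (- \<alpha> i) / Gamma (1 - \<alpha> i) * (1 - rho \<alpha> i (\<tau> / t))))"

end

theory Submission
  imports Defs
begin

text \<open>The error \<open>e = u\<^sub>h - u\<close> vanishes at time \<open>0\<close> and solves the multiterm equation with the residual
as right-hand side. Testing this equation at time \<open>t\<close> with \<open>e t\<close> itself removes the space variable:
the elliptic part contributes at least \<open>lam * \<parallel>e t\<parallel>^2\<close> by coercivity, and the Cauchy-Schwarz inequality
under the Caputo integral gives \<open>\<langle>D e, e\<rangle> \<ge> \<parallel>e\<parallel> * D \<parallel>e\<parallel>\<close> (\<open>frac_deriv_norm_le\<close>). Hence, wherever
\<open>e \<noteq> 0\<close>, the scalar function \<open>\<parallel>e\<parallel>\<close> is a subsolution of the fractional ordinary differential equation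
whose right-hand side is the norm of the residual. On the other hand \<open>E1\<close> solves this equation with
right-hand side exactly \<open>R1\<close>. If \<open>C\<close> is the supremum of the quotients, then \<open>\<parallel>e\<parallel> \<le> C * E1\<close>
follows from a maximum principle (\<open>barrier_comparison\<close>): at a positive maximum of
\<open>v = \<parallel>e\<parallel> - C * E1\<close> the integrand of every Caputo derivative of \<open>v\<close> is nonnegative and the boundary
term is positive, so all these derivatives are positive, which contradicts the two equations. The jump of \<open>E1\<close> at
\<open>0\<close> does no harm: \<open>v\<close> is \<open>0\<close> at time \<open>0\<close> and its limit from the right is nonpositive, so a positive
supremum is a maximum attained at a positive time.

That \<open>E1\<close> has the residual \<open>R1\<close> is a computation with one primitive. After scaling \<open>t\<close> to \<open>1\<close>, the
function \<open>(1-x)^-a * (1 - x^-b) + x^-b * F(x)\<close> with \<open>F = 2F1(a,-b;1-b)\<close> is a primitive of the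
Caputo kernel applied to \<open>x^-b\<close>, because the series of \<open>F\<close> gives \<open>(x^-b * F)' = -b * x^(-b-1) * (1-x)^-a\<close>. Its
value at \<open>x = 1\<close> comes from expressing \<open>F\<close> through the incomplete beta integral
(\<open>F21_conv_beta_integral\<close>), and the same formula yields the bound for \<open>rho\<close> (\<open>F21_le\<close>).

Two facts justify the testing. First, \<open>e t\<close> lies in \<open>H10\<close> with the expected weak derivatives, and the
equation, which is known against test functions only, extends to \<open>e t\<close> by density
(\<open>energy_identity\<close>); this rests on the uniqueness of weak derivatives, that is on the fundamental lemma
of the calculus of variations, for which smooth bumps are constructed. Second, a continuous function
in \<open>W\<^sup>1\<^sup>,\<^sup>\<infinity>\<close> is Lipschitz (\<open>W1_infty_imp_lipschitz\<close>), which makes the Caputo integrals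
absolutely convergent at their singular end \<open>s = t\<close> (\<open>caputo_integrable\<close>).\<close>

section \<open>The hypergeometric function of the barrier\<close>

text \<open>The third parameter of the hypergeometric function exceeds the second by one, so the two Pochhammer
symbols telescope. This turns the coefficients into those of the binomial series divided by \<open>n - b\<close>.\<close>
lemma pochhammer_quotient_shift:
  fixes b :: real
  assumes "b < 1" "b \<noteq> 0"
  shows "pochhammer (-b) n / pochhammer (1 - b) n = - b / (real n - b)"
proof -
  have "pochhammer (-b) n * (real n - b) = - b * pochhammer (1 - b) n"
    using pochhammer_Suc[of "-b" n] pochhammer_rec[of "-b" n] by (simp add: add.commute)
  moreover have "pochhammer (1 - b) n > 0"
    using assms by (intro pochhammer_pos) simp
  moreover have "real n - b \<noteq> 0"
    using assms by (cases n) auto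
  ultimately show ?thesis by (simp add: field_simps)
qed

lemma pochhammer_sums_powr:
  fixes a x :: real
  assumes "\<bar>x\<bar> < 1"
  shows "(\<lambda>n. pochhammer a n / fact n * x ^ n) sums (1 - x) powr (- a)"
proof -
  have "(-a gchoose n) * (-x) ^ n = pochhammer a n / fact n * x ^ n" for n
    by (simp add: gbinomial_pochhammer power_minus[of x] flip: power_add)
  with gen_binomial_real[of "-x" "-a"] assms show ?thesis by simp
qed

text \<open>With \<open>b = 1 - \<alpha> 1\<close> and \<open>a = \<alpha> i\<close> this is the hypergeometric part of \<open>rho\<close>.\<close>
definition F21 :: "real \<Rightarrow> real \<Rightarrow> real \<Rightarrow> real" where
  "F21 a b x = gauss_2F1 a (- b) (1 - b) x"

lemma F21_series:
  assumes "0 < b" "b < 1"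
  shows "F21 a b x = (\<Sum>n. (- b / (real n - b) * (pochhammer a n / fact n)) * x ^ n)"
proof -
  have "pochhammer a n * pochhammer (-b) n / (pochhammer (1 - b) n * fact n) =
      - b / (real n - b) * (pochhammer a n / fact n)" for n
  proof -
    have "pochhammer a n * pochhammer (-b) n / (pochhammer (1 - b) n * fact n) =
        pochhammer (-b) n / pochhammer (1 - b) n * (pochhammer a n / fact n)"
      by (simp add: mult.commute)
    then show ?thesis using pochhammer_quotient_shift[of b n] assms by simp
  qed
  then show ?thesis by (simp add: F21_def gauss_2F1_def)
qed

lemma F21_summable:
  fixes x :: real
  assumes "0 < a" "0 < b" "b < 1" "\<bar>x\<bar> < 1"
  shows "summable (\<lambda>n. (- b / (real n - b) * (pochhammer a n / fact n)) * x ^ n)"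
proof (rule summable_comparison_test')
  have "summable (\<lambda>n. pochhammer a n / fact n * \<bar>x\<bar> ^ n)"
    using pochhammer_sums_powr[of "\<bar>x\<bar>" a] assms(4) by (auto simp: sums_iff)
  then show "summable (\<lambda>n. b / (1 - b) * (pochhammer a n / fact n * \<bar>x\<bar> ^ n))"
    by (rule summable_mult)
  fix n :: nat assume "n \<ge> 1"
  have p: "pochhammer a n > 0" using assms by (intro pochhammer_pos)
  have "\<bar>- b / (real n - b)\<bar> \<le> b / (1 - b)"
    using \<open>n \<ge> 1\<close> assms by (auto simp: abs_if intro!: divide_left_mono)
  then have "\<bar>- b / (real n - b)\<bar> * (pochhammer a n / fact n * \<bar>x\<bar> ^ n) \<le>
     b / (1 - b) * (pochhammer a n / fact n * \<bar>x\<bar> ^ n)"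
    using p by (intro mult_right_mono) auto
  then show "norm ((- b / (real n - b) * (pochhammer a n / fact n)) * x ^ n) \<le> b / (1 - b) * (pochhammer a n / fact n * \<bar>x\<bar> ^ n)"
    using p by (simp add: abs_mult power_abs mult.assoc)
qed

text \<open>The factor \<open>n - b\<close> produced by \<open>x * d/dx - b\<close> cancels the denominators, leaving the binomial series.\<close>
lemma F21_deriv:
  fixes x :: real
  assumes "0 < a" "0 < b" "b < 1" "\<bar>x\<bar> < 1"
  obtains F' where "(F21 a b has_real_derivative F') (at x)"
    "x * F' - b * F21 a b x = - b * (1 - x) powr (- a)"
proof -
  define c where "c n = - b / (real n - b) * (pochhammer a n / fact n)" for n
  have sm: "summable (\<lambda>n. c n * y ^ n)" if "\<bar>y\<bar> < 1" for y
    unfolding c_def using F21_summable assms that by blast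
  obtain K where K: "\<bar>x\<bar> < K" "K < 1" using dense assms(4) by blast
  have der: "((\<lambda>x. \<Sum>n. c n * x^n) has_real_derivative (\<Sum>n. diffs c n * x^n)) (at x)"
    by (rule termdiffs_strong[of _ K]) (use sm[of K] K in auto)
  moreover have "(\<lambda>x. \<Sum>n. c n * x^n) = F21 a b"
    using F21_series assms by (auto simp: c_def)
  moreover
  have sd: "summable (\<lambda>n. diffs c n * x^n)"
    by (rule termdiff_converges[of x 1]) (use sm assms in auto)
  have "(\<lambda>n. x * (of_nat n * c n * x^(n - Suc 0))) sums (x * (\<Sum>n. diffs c n * x^n))"
    by (intro sums_mult diffs_equiv sd)
  moreover have "x * (of_nat n * c n * x^(n - Suc 0)) = of_nat n * c n * x ^ n" for n
    by (cases n) auto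
  ultimately have 1: "(\<lambda>n. of_nat n * c n * x ^ n) sums (x * (\<Sum>n. diffs c n * x^n))" by simp
  have 2: "(\<lambda>n. b * (c n * x ^ n)) sums (b * F21 a b x)"
    using sm[OF assms(4)] F21_series[of b a x] assms by (intro sums_mult) (simp add: c_def sums_iff)
  have "of_nat n * c n * x ^ n - b * (c n * x ^ n) = - b * (pochhammer a n / fact n * x ^ n)" for n
  proof -
    have "real n - b \<noteq> 0" using assms by (cases n) auto
    then have "(real n - b) * c n = - b * (pochhammer a n / fact n)"
      by (simp add: c_def)
    then have "(real n - b) * c n * x ^ n = - b * (pochhammer a n / fact n) * x ^ n" by simp
    then show ?thesis by (simp only: algebra_simps)
  qed
  with sums_diff[OF 1 2] have "(\<lambda>n. - b * (pochhammer a n / fact n * x ^ n)) sums (x * (\<Sum>n. diffs c n * x^n) - b * F21 a b x)"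
    by simp
  moreover have "(\<lambda>n. - b * (pochhammer a n / fact n * x ^ n)) sums (- b * (1 - x) powr (- a))"
    using assms by (intro sums_mult pochhammer_sums_powr)
  ultimately have "x * (\<Sum>n. diffs c n * x^n) - b * F21 a b x = - b * (1 - x) powr (- a)"
    by (rule sums_unique2)
  moreover have "(F21 a b has_real_derivative (\<Sum>n. diffs c n * x^n)) (at x)"
    using der \<open>(\<lambda>x. \<Sum>n. c n * x^n) = F21 a b\<close> by simp
  ultimately show ?thesis using that by blast
qed

lemma powr_F21_deriv:
  fixes x :: real
  assumes "0 < a" "0 < b" "b < 1" "0 < x" "x < 1"
  shows "((\<lambda>x. x powr (- b) * F21 a b x) has_real_derivative
           - b * x powr (- b - 1) * (1 - x) powr (- a)) (at x)"
proof -
  obtain F' where F': "(F21 a b has_real_derivative F') (at x)"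
    "x * F' - b * F21 a b x = - b * (1 - x) powr (- a)"
    by (rule F21_deriv[of a b x]) (use assms in auto)
  have "((\<lambda>x. x powr (- b) * F21 a b x) has_real_derivative
     ((- b) * x powr (- b - 1)) * F21 a b x + F' * x powr (- b)) (at x)"
    by (intro DERIV_mult has_real_derivative_powr F' assms)
  moreover have e: "x powr (- b) = x * x powr (- b - 1)"
    using assms by (simp add: powr_diff)
  have "((- b) * x powr (- b - 1)) * F21 a b x + F' * x powr (- b) =
     x powr (- b - 1) * (x * F' - b * F21 a b x)"
    unfolding e by algebra
  ultimately show ?thesis using F'(2) by (metis mult.assoc mult.commute)
qed

lemma F21_at_0: "0 < b \<Longrightarrow> b < 1 \<Longrightarrow> F21 a b 0 = 1"
  using powser_zero[of "\<lambda>n. - b / (real n - b) * (pochhammer a n / fact n)"] by (simp add: F21_series)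

definition beta_kernel :: "real \<Rightarrow> real \<Rightarrow> real \<Rightarrow> real" where
  "beta_kernel a b x = x powr (- b) * (1 - x) powr (- a)"

lemma beta_kernel_has_integral:
  assumes "a < 1" "b < 1"
  shows "(beta_kernel a b has_integral Beta (1 - b) (1 - a)) {0..1}"
  using has_integral_Beta_real[of "1 - b" "1 - a"] assms by (simp add: beta_kernel_def[abs_def])

lemma beta_kernel_integrable:
  assumes "a < 1" "b < 1" "0 \<le> s" "s \<le> 1"
  shows "beta_kernel a b integrable_on {0..s}"
  using has_integral_integrable[OF beta_kernel_has_integral[OF assms(1,2)]]
  by (rule integrable_subinterval_real) (use assms in auto)

lemma beta_kernel_integral_deriv:
  assumes "a < 1" "b < 1" "0 < s" "s < 1"
  shows "((\<lambda>s. integral {0..s} (beta_kernel a b)) has_real_derivative beta_kernel a b s) (at s)"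
proof -
  have "((\<lambda>s. integral {0..s} (beta_kernel a b)) has_vector_derivative beta_kernel a b s) (at s within {0..1})"
  proof (rule integral_has_vector_derivative_continuous_at[where S = "{}", simplified])
    show "beta_kernel a b integrable_on {0..1}"
      using beta_kernel_integrable assms by simp
    show "continuous (at s within {0..1}) (beta_kernel a b)"
      unfolding beta_kernel_def[abs_def] continuous_within using assms
      by (intro tendsto_mult tendsto_powr tendsto_diff tendsto_const tendsto_ident_at) auto
  qed (use assms in auto)
  then have "((\<lambda>s. integral {0..s} (beta_kernel a b)) has_vector_derivative beta_kernel a b s) (at s within {0<..<1})"
    by (rule has_vector_derivative_within_subset) auto
  then show ?thesis
    unfolding has_real_derivative_iff_has_vector_derivative
    by (subst (asm) has_vector_derivative_within_open) (use assms in auto)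
qed

text \<open>Both sides have the same derivative on \<open>(0,1)\<close>. Their difference is therefore constant, and it tends to
\<open>0\<close> at \<open>0\<close> because \<open>F21 a b x - (1 - x) powr (1 - a)\<close> vanishes to first order there, \<open>b < 1\<close>, and the integral tends to \<open>0\<close>.\<close>
lemma F21_conv_beta_integral:
  assumes "0 < a" "a < 1" "0 < b" "b < 1" "0 < s" "s < 1"
  shows "s powr (- b) * F21 a b s =
           s powr (- b) * (1 - s) powr (1 - a) + (1 - a - b) * integral {0..s} (beta_kernel a b)"
proof -
  define Q where "Q s = integral {0..s} (beta_kernel a b)" for s
  define f where "f s = s powr (- b) * (F21 a b s - (1 - s) powr (1 - a)) - (1 - a - b) * Q s" for s
  have f0: "(f has_real_derivative 0) (at x)" if x: "0 < x" "x < 1" for x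
  proof -
    have "((\<lambda>s. s powr (- b) * F21 a b s - s powr (- b) * (1 - s) powr (1 - a) - (1 - a - b) * Q s) has_real_derivative
      - b * x powr (- b - 1) * (1 - x) powr (- a) -
       ((-b * x powr (-b - 1)) * (1 - x) powr (1 - a) + ((1 - a) * (1 - x) powr (1 - a - of_nat 1) * -1) * x powr (-b))
       - (1 - a - b) * beta_kernel a b x) (at x)"
      unfolding Q_def
      by (intro DERIV_diff powr_F21_deriv DERIV_mult has_real_derivative_powr DERIV_fun_powr DERIV_cmult beta_kernel_integral_deriv)
         (use assms x in \<open>auto intro!: derivative_eq_intros\<close>)
    moreover have e: "x powr (- b) = x * x powr (-b-1)" "(1 - x) powr (1 - a) = (1 - x) * (1 - x) powr (- a)"
      using x by (simp_all add: powr_diff powr_minus field_simps)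
    have alg: "- b * X * Y - (- b * X * ((1 - x) * Y) + (1 - a) * Y * - 1 * (x * X)) -
        (1 - a - b) * (x * X * Y) = 0" for X Y
      by (simp add: algebra_simps)
    have "1 - a - of_nat 1 = - a" by simp
    then have "- b * x powr (- b - 1) * (1 - x) powr (- a) -
       ((-b * x powr (-b - 1)) * (1 - x) powr (1 - a) + ((1 - a) * (1 - x) powr (1 - a - of_nat 1) * -1) * x powr (-b))
       - (1 - a - b) * beta_kernel a b x = 0"
      using alg unfolding beta_kernel_def e by (simp only:)
    ultimately show ?thesis unfolding f_def[abs_def] by (simp add: right_diff_distrib)
  qed
  have const: "f x = f s" if "0 < x" "x < 1" for x
    using DERIV_isconst3[of 0 1 x s f] that assms f0 by auto
  have "(f \<longlongrightarrow> 0) (at_right 0)"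
  proof -
    have ev: "eventually (\<lambda>x::real. 0 < x \<and> x < 1) (at_right 0)"
      unfolding eventually_at_right_field by (auto intro!: exI[of _ 1])
    obtain F' where F': "(F21 a b has_real_derivative F') (at 0)"
      by (rule F21_deriv[of a b 0]) (use assms in auto)
    define g where "g s = F21 a b s - (1 - s) powr (1 - a)" for s
    have "((\<lambda>s. F21 a b s - (1 - s) powr (1 - a)) has_real_derivative F' - (1 - a) * (1 - 0) powr (1 - a - of_nat 1) * -1) (at 0)"
      by (intro DERIV_diff F' DERIV_fun_powr) (auto intro!: derivative_eq_intros)
    then obtain G where "(g has_real_derivative G) (at 0)" unfolding g_def[abs_def] by blast
    then have "((\<lambda>h. (g h - g 0) / (h - 0)) \<longlongrightarrow> G) (at_right 0)"
      unfolding has_field_derivative_iff by (rule tendsto_mono[OF at_le, rotated]) simp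
    moreover have "g 0 = 0" using F21_at_0[of b a] assms by (simp add: g_def)
    ultimately have "((\<lambda>h. g h / h) \<longlongrightarrow> G) (at_right 0)" by simp
    moreover have "((\<lambda>h. h powr (1 - b)) \<longlongrightarrow> 0) (at_right 0)"
      using assms by (intro tendsto_zero_powrI[OF tendsto_ident_at tendsto_const]) (auto simp: eventually_at_filter)
    ultimately have "((\<lambda>h. h powr (1 - b) * (g h / h)) \<longlongrightarrow> 0 * G) (at_right 0)"
      by (intro tendsto_mult)
    moreover have "eventually (\<lambda>h. h powr (1 - b) * (g h / h) = h powr (-b) * g h) (at_right 0)"
      using ev by eventually_elim (simp add: powr_diff powr_minus field_simps)
    ultimately have 1: "((\<lambda>h. h powr (-b) * g h) \<longlongrightarrow> 0) (at_right 0)"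
      by (simp add: tendsto_cong)
    have "continuous_on {0..1} Q"
      unfolding Q_def using beta_kernel_integrable assms by (intro indefinite_integral_continuous_1) auto
    then have "(Q \<longlongrightarrow> Q 0) (at_right 0)"
      by (rule continuous_on_Icc_at_rightD) auto
    moreover have "Q 0 = 0" by (simp add: Q_def)
    ultimately have "((\<lambda>h. h powr (-b) * g h - (1 - a - b) * Q h) \<longlongrightarrow> 0 - (1 - a - b) * 0) (at_right 0)"
      using 1 by (intro tendsto_intros) simp_all
    then show ?thesis by (simp add: f_def[abs_def] g_def)
  qed
  moreover have "((\<lambda>_. f s) \<longlongrightarrow> f s) (at_right (0::real))" by simp
  then have "(f \<longlongrightarrow> f s) (at_right 0)"
  proof (rule Lim_transform_eventually)
    show "\<forall>\<^sub>F x in at_right 0. f s = f x"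
      unfolding eventually_at_right_field using const by (auto intro!: exI[of _ 1])
  qed
  ultimately have "f s = 0"
    using tendsto_unique trivial_limit_at_right_real by blast
  then show ?thesis by (simp add: f_def Q_def algebra_simps)
qed

text \<open>The value at \<open>1\<close> of \<open>F21 a b\<close> in Gauss' formula, and the coefficient of the power in \<open>rho\<close>. Written with \<open>rGamma\<close> it is \<open>0\<close>
when \<open>a = 1 - b\<close>.\<close>
definition gauss_const :: "real \<Rightarrow> real \<Rightarrow> real" where
  "gauss_const a b = Gamma (1 - b) * Gamma (1 - a) * rGamma (1 - b - a)"

lemma gauss_const_eq: "gauss_const a b = (1 - a - b) * Beta (1 - b) (1 - a)"
proof -
  have "rGamma (1 - b - a) = (1 - a - b) * rGamma (1 - b + (1 - a))"
    using rGamma_plus1[of "1 - b - a"] by (simp add: algebra_simps)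
  then show ?thesis by (simp add: gauss_const_def Beta_altdef)
qed

lemma one_minus_powr_tendsto_0:
  assumes "0 < c"
  shows "((\<lambda>s::real. (1 - s) powr c) \<longlongrightarrow> 0) (at_left 1)"
proof (rule tendsto_zero_powrI[OF _ tendsto_const])
  have "((\<lambda>s::real. 1 - s) \<longlongrightarrow> 1 - 1) (at_left 1)"
    by (intro tendsto_intros)
  then show "((\<lambda>s::real. 1 - s) \<longlongrightarrow> 0) (at_left 1)" by simp
qed (use assms in \<open>auto simp: eventually_at_filter\<close>)

text \<open>Gauss' summation theorem for these parameters, read off from the complete beta integral.\<close>
lemma F21_tendsto_at_1:
  assumes "0 < a" "a < 1" "0 < b" "b < 1"
  shows "((\<lambda>s. s powr (- b) * F21 a b s) \<longlongrightarrow> gauss_const a b) (at_left 1)"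
proof -
  define Q where "Q s = integral {0..s} (beta_kernel a b)" for s
  have "continuous_on {0..1} Q"
    unfolding Q_def using beta_kernel_integrable assms by (intro indefinite_integral_continuous_1) auto
  then have "(Q \<longlongrightarrow> Q 1) (at_left 1)"
    by (rule continuous_on_Icc_at_leftD) auto
  moreover have "Q 1 = Beta (1 - b) (1 - a)"
    unfolding Q_def using beta_kernel_has_integral[of a b] assms by (simp add: integral_unique)
  moreover have h: "((\<lambda>s::real. (1 - s) powr (1 - a)) \<longlongrightarrow> 0) (at_left 1)"
    using assms by (intro one_minus_powr_tendsto_0) simp
  ultimately have "((\<lambda>s. s powr (- b) * (1 - s) powr (1 - a) + (1 - a - b) * Q s)
      \<longlongrightarrow> 1 powr (-b) * 0 + (1 - a - b) * Beta (1 - b) (1 - a)) (at_left 1)"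
    by (intro tendsto_add tendsto_mult[OF _ h] tendsto_mult[OF tendsto_const] tendsto_powr tendsto_const tendsto_ident_at) auto
  moreover have "\<forall>\<^sub>F s in at_left 1. s powr (- b) * (1 - s) powr (1 - a) + (1 - a - b) * Q s = s powr (- b) * F21 a b s"
    unfolding eventually_at_left_field
    using F21_conv_beta_integral[OF assms] by (auto intro!: exI[of _ 0] simp: Q_def)
  ultimately show ?thesis by (simp add: tendsto_cong gauss_const_eq)
qed

text \<open>In terms of the beta integral the left-hand side is \<open>(1 - s) powr (1 - a)\<close> minus a nonnegative multiple
of the integral over \<open>{s..1}\<close>, the factor being \<open>(1 - a - b) * s powr b\<close>.\<close>
lemma F21_le:
  assumes "0 < a" "a < 1" "0 < b" "b < 1" "a + b \<le> 1" "0 < s" "s < 1"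
  shows "F21 a b s - gauss_const a b * s powr b \<le> (1 - s) powr (1 - a)"
proof -
  have "integral {0..s} (beta_kernel a b) \<le> integral {0..1} (beta_kernel a b)"
    using assms by (intro integral_subset_le beta_kernel_integrable) (auto simp: beta_kernel_def)
  also have "\<dots> = Beta (1 - b) (1 - a)"
    using beta_kernel_has_integral[of a b] assms by (simp add: integral_unique)
  finally have "(1 - a - b) * integral {0..s} (beta_kernel a b) \<le> gauss_const a b"
    unfolding gauss_const_eq using assms by (intro mult_left_mono) auto
  then have "s powr b * (s powr (-b) * F21 a b s) \<le> s powr b * (s powr (-b) * (1 - s) powr (1 - a) + gauss_const a b)"
    using F21_conv_beta_integral[of a b s] assms by (intro mult_left_mono) auto
  then have le: "s powr b * (s powr (-b) * F21 a b s) \<le>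
      s powr b * (s powr (-b) * (1 - s) powr (1 - a)) + s powr b * gauss_const a b"
    by (simp only: distrib_left)
  have e: "s powr b * (s powr (-b) * z) = z" for z
    using assms by (simp add: powr_minus)
  show ?thesis
    using le unfolding e by (simp add: mult.commute)
qed

section \<open>The Caputo derivative of the barrier\<close>

text \<open>The fundamental theorem for improper integrals on a bounded interval; a nonnegative integrand makes
convergence of the primitive at both ends sufficient for integrability.\<close>
lemma set_integral_FTC_nonneg:
  fixes f F :: "real \<Rightarrow> real"
  assumes "a < b"
    and F: "\<And>x. a < x \<Longrightarrow> x < b \<Longrightarrow> (F has_real_derivative f x) (at x)"
    and f: "\<And>x. a < x \<Longrightarrow> x < b \<Longrightarrow> isCont f x" "\<And>x. a < x \<Longrightarrow> x < b \<Longrightarrow> 0 \<le> f x"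
    and lim: "(F \<longlongrightarrow> A) (at_right a)" "(F \<longlongrightarrow> B) (at_left b)"
  shows "set_integrable lborel {a<..<b} f" "(LBINT x:{a<..<b}. f x) = B - A"
proof -
  have AE: "AE x in lborel. ereal a < ereal x \<longrightarrow> ereal x < ereal b \<longrightarrow> 0 \<le> f x"
    using f(2) by simp
  have lim': "((F \<circ> real_of_ereal) \<longlongrightarrow> A) (at_right (ereal a))" "((F \<circ> real_of_ereal) \<longlongrightarrow> B) (at_left (ereal b))"
    using lim by (simp_all add: ereal_tendsto_simps1)
  show "set_integrable lborel {a<..<b} f"
    using interval_integral_FTC_nonneg(1)[of a b F f A B, OF _ _ _ AE lim'] assms by simp
  show "(LBINT x:{a<..<b}. f x) = B - A"
    using interval_integral_FTC_nonneg(2)[of a b F f A B, OF _ _ _ AE lim'] assms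
    by (simp add: interval_integral_Ioo)
qed

text \<open>The first summand of the primitive \<open>N\<close> below: the singularity \<open>(1 - x) powr (- a)\<close> is beaten by the
first-order zero of the second factor.\<close>
lemma powr_gap_tendsto_at_1:
  fixes a b :: real
  assumes "0 < a" "a < 1" "0 < b" "b < 1"
  shows "((\<lambda>x. (1 - x) powr (- a) * (1 - x powr (- b))) \<longlongrightarrow> 0) (at_left 1)"
proof (rule Lim_null_comparison)
  have "((\<lambda>x::real. (1 - x) powr (1 - a)) \<longlongrightarrow> 0) (at_left 1)"
    using assms by (intro one_minus_powr_tendsto_0) simp
  then have "((\<lambda>x::real. (1 - x) powr (1 - a) / x) \<longlongrightarrow> 0 / 1) (at_left 1)"
    by (intro tendsto_divide tendsto_ident_at) auto
  then show "((\<lambda>x::real. (1 - x) powr (1 - a) / x) \<longlongrightarrow> 0) (at_left 1)" by simp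
  have "norm ((1 - x) powr (- a) * (1 - x powr (- b))) \<le> (1 - x) powr (1 - a) / x"
    if x: "0 < x" "x < 1" for x :: real
  proof -
    \<comment> \<open>As \<open>b < 1\<close>, \<open>0 \<le> x^-b - 1 \<le> x^-1 - 1 = (1 - x) / x\<close>.\<close>
    have "x powr (- b) \<le> x powr (- 1)"
      using x assms by (intro powr_mono') auto
    moreover have "1 \<le> x powr (- b)"
      using powr_mono'[of "-b" 0 x] x assms by simp
    ultimately have "\<bar>1 - x powr (- b)\<bar> \<le> (1 - x) / x"
      using x by (simp add: powr_minus field_simps)
    then have "(1 - x) powr (- a) * \<bar>1 - x powr (- b)\<bar> \<le> (1 - x) powr (- a) * ((1 - x) / x)"
      by (rule mult_left_mono) simp
    also have "(1 - x) powr (- a) * ((1 - x) / x) = (1 - x) powr (1 - a) / x"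
      using x by (simp add: powr_diff powr_minus field_simps)
    finally show ?thesis by (simp add: abs_mult)
  qed
  then show "\<forall>\<^sub>F x in at_left 1. norm ((1 - x) powr (- a) * (1 - x powr (- b))) \<le> (1 - x) powr (1 - a) / x"
    unfolding eventually_at_left_field by (auto intro!: exI[of _ 0])
qed

text \<open>Differentiating the product \<open>(1 - x) powr (- a) * (1 - x powr (- b))\<close> produces the Caputo kernel and one further
term, which is exactly cancelled by the derivative of \<open>x powr (- b) * F21 a b x\<close>.\<close>
lemma kernel_primitive:
  fixes a b t s :: real
  assumes "0 < a" "a < 1" "0 < b" "b < 1" "0 < s" "s < t"
  defines "N \<equiv> \<lambda>x. (1 - x) powr (- a) * (1 - x powr (- b)) + x powr (- b) * F21 a b x"
  shows "((\<lambda>s. - (t powr (- a - b)) * N (s / t)) has_real_derivative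
     a * (t - s) powr (- a - 1) * (s powr (- b) - t powr (- b))) (at s)"
proof -
  define x where "x = s / t"
  have x: "0 < x" "x < 1" "s = t * x" "t > 0" using assms by (auto simp: x_def)
  have xb: "x powr (- b) = x * x powr (- b - 1)" and xa: "(1 - x) powr (- a) = (1 - x) * (1 - x) powr (- a - 1)"
    using x by (simp_all add: powr_diff)
  have "(N has_real_derivative
     ((-a) * (1 - x) powr (- a - of_nat 1) * -1) * (1 - x powr (-b)) + (0 - (-b) * x powr (-b - 1)) * (1 - x) powr (-a)
      + - b * x powr (- b - 1) * (1 - x) powr (- a)) (at x)"
    unfolding N_def
    by (intro DERIV_add powr_F21_deriv DERIV_mult DERIV_fun_powr DERIV_diff DERIV_const has_real_derivative_powr)
       (use assms x in \<open>auto intro!: derivative_eq_intros\<close>)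
  then have N: "(N has_real_derivative a * (1 - x) powr (- a - 1) * (1 - x powr (-b))) (at (s / t))"
    by (simp add: x_def)
  have "((\<lambda>s. s / t) has_real_derivative 1 / t) (at s)"
    using x by (auto intro!: derivative_eq_intros)
  from DERIV_chain2[OF N this] have "((\<lambda>s. - (t powr (- a - b)) * N (s / t)) has_real_derivative
      - (t powr (- a - b)) * (a * (1 - x) powr (- a - 1) * (1 - x powr (- b)) * (1 / t))) (at s)"
    by (intro DERIV_cmult)
  moreover have "a * (t - s) powr (- a - 1) * (s powr (- b) - t powr (- b)) =
     - (t powr (- a - b)) * (a * (1 - x) powr (- a - 1) * (1 - x powr (- b)) * (1 / t))"
  proof -
    have "t - s = t * (1 - x)" using x by (simp add: algebra_simps)
    then have 1: "(t - s) powr (- a - 1) = t powr (- a - 1) * (1 - x) powr (- a - 1)"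
      using x by (simp add: powr_mult)
    have 2: "s powr (- b) = t powr (- b) * x powr (- b)"
      using x by (simp add: powr_mult)
    have 3: "t powr (- a - 1) * t powr (- b) = t powr (- a - b) * (1 / t)"
      using x by (simp add: powr_diff powr_minus field_simps)
    have "a * (t powr (- a - 1) * (1 - x) powr (- a - 1)) * (t powr (- b) * x powr (- b) - t powr (- b)) =
        - (t powr (- a - 1) * t powr (- b)) * (a * (1 - x) powr (- a - 1) * (1 - x powr (- b)))"
      by (simp add: algebra_simps)
    then show ?thesis unfolding 1 2 3 by (simp add: mult_ac)
  qed
  ultimately show ?thesis by simp
qed

text \<open>\<open>E1\<close> and \<open>rho\<close> as functions of plain real parameters.\<close>
definition barrier :: "real \<Rightarrow> real \<Rightarrow> real \<Rightarrow> real" where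
  "barrier b \<tau> t = (if t = 0 then 0 else (max \<tau> t) powr (- b))"

definition barrier_defect :: "real \<Rightarrow> real \<Rightarrow> real \<Rightarrow> real" where
  "barrier_defect a b s = (if s \<ge> 1 then 0 else F21 a b s - gauss_const a b * s powr b)"

text \<open>For \<open>t \<le> \<tau>\<close> the barrier is constant on \<open>(0,t]\<close>, and only the jump at \<open>0\<close> contributes. For \<open>t > \<tau>\<close>
the integral is split at \<open>\<tau>\<close>, where the barrier stops being constant.\<close>
lemma barrier_kernel_integral:
  fixes a b t \<tau> :: real
  assumes "0 < a" "a < 1" "0 < b" "b < 1" "0 < \<tau>" "0 < t"
  shows "set_integrable lborel {0<..<t} (\<lambda>s. a * (t - s) powr (- a - 1) * (barrier b \<tau> t - barrier b \<tau> s))" (is ?A)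
    and "t powr (- a) * barrier b \<tau> t + (LBINT s:{0<..<t}. a * (t - s) powr (- a - 1) * (barrier b \<tau> t - barrier b \<tau> s))
      = \<tau> powr (- b) * (t powr (- a) * (1 - barrier_defect a b (\<tau> / t)))" (is ?B)
proof -
  define f where "f s = a * (t - s) powr (- a - 1) * (barrier b \<tau> t - barrier b \<tau> s)" for s
  have "set_integrable lborel {0<..<t} f \<and>
     t powr (- a) * barrier b \<tau> t + (LBINT s:{0<..<t}. f s) = \<tau> powr (- b) * (t powr (- a) * (1 - barrier_defect a b (\<tau> / t)))"
  proof (cases "t \<le> \<tau>")
    case True
    then have f0: "f s = 0" if "s \<in> {0<..<t}" for s
      using that assms by (simp add: f_def barrier_def max_def)
    have "set_integrable lborel {0<..<t} f \<longleftrightarrow> set_integrable lborel {0<..<t} (\<lambda>s. 0::real)"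
      by (intro set_integrable_cong) (use f0 in auto)
    moreover have "(LBINT s:{0<..<t}. f s) = (LBINT s:{0<..<t}. 0)"
      by (intro set_lebesgue_integral_cong) (use f0 in auto)
    ultimately show ?thesis
      using True assms by (simp add: barrier_def barrier_defect_def set_integrable_def set_lebesgue_integral_def max_def)
  next
    case False
    then have t: "\<tau> < t" by simp
    \<comment> \<open>The scaled variable, so that \<open>\<tau>\<close> becomes \<open>x\<close> and \<open>t\<close> becomes \<open>1\<close>.\<close>
    define x where "x = \<tau> / t"
    have x: "0 < x" "x < 1" "\<tau> = t * x" using assms t by (auto simp: x_def)
    define K where "K = gauss_const a b"
    define N where "N x = (1 - x) powr (- a) * (1 - x powr (- b)) + x powr (- b) * F21 a b x" for x
    define f1 where "f1 s = (\<tau> powr (- b) - t powr (- b)) * (a * (t - s) powr (- a - 1))" for s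
    define f2 where "f2 s = a * (t - s) powr (- a - 1) * (s powr (- b) - t powr (- b))" for s
    have mono: "t powr (- b) \<le> s powr (- b)" if "0 < s" "s \<le> t" for s
      using that assms by (intro powr_mono2') auto
    have d1: "((\<lambda>s. (\<tau> powr (- b) - t powr (- b)) * (t - s) powr (- a)) has_real_derivative f1 s) (at s)" if "s < t" for s
    proof -
      have "((\<lambda>s. (\<tau> powr (- b) - t powr (- b)) * (t - s) powr (- a)) has_real_derivative
         (\<tau> powr (- b) - t powr (- b)) * ((- a) * (t - s) powr (- a - of_nat 1) * -1)) (at s)"
        by (intro DERIV_cmult DERIV_fun_powr) (use that in \<open>auto intro!: derivative_eq_intros\<close>)
      then show ?thesis by (simp add: f1_def)
    qed
    have "((\<lambda>s. (\<tau> powr (- b) - t powr (- b)) * (t - s) powr (- a)) \<longlongrightarrow> (\<tau> powr (- b) - t powr (- b)) * (t - z) powr (- a)) (at z within S)"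
      if "z < t" for z S
      using DERIV_isCont[OF d1[OF that]] by (meson continuous_within continuous_at_imp_continuous_at_within)
    note l1 = this
    have i1: "set_integrable lborel {0<..<\<tau>} f1" "(LBINT x:{0<..<\<tau>}. f1 x) =
       (\<tau> powr (- b) - t powr (- b)) * (t - \<tau>) powr (- a) - (\<tau> powr (- b) - t powr (- b)) * (t - 0) powr (- a)"
      by (rule set_integral_FTC_nonneg[OF \<open>0 < \<tau>\<close> d1 _ _ l1 l1];
          use t assms mono[of \<tau>] in \<open>auto simp: f1_def[abs_def] intro!: continuous_intros mult_nonneg_nonneg\<close>)+
    have d2: "((\<lambda>s. - (t powr (- a - b)) * N (s / t)) has_real_derivative f2 s) (at s)" if "0 < s" "s < t" for s
      unfolding N_def f2_def using assms that by (intro kernel_primitive) auto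
    have l2a: "((\<lambda>s. - (t powr (- a - b)) * N (s / t)) \<longlongrightarrow> - (t powr (- a - b)) * N x) (at_right \<tau>)"
      unfolding x_def using DERIV_isCont[OF d2[of \<tau>]] t assms
      by (meson continuous_within continuous_at_imp_continuous_at_within)
    have "(N \<longlongrightarrow> 0 + K) (at_left 1)"
      unfolding N_def K_def by (intro tendsto_add powr_gap_tendsto_at_1 F21_tendsto_at_1 assms)
    moreover have "filterlim (\<lambda>s. s / t) (at_left 1) (at_left t)"
    proof (rule filterlim_at_withinI)
      have "((\<lambda>s. s / t) \<longlongrightarrow> t / t) (at_left t)" by (intro tendsto_intros) (use assms in auto)
      then show "((\<lambda>s. s / t) \<longlongrightarrow> 1) (at_left t)" using assms by simp
      show "\<forall>\<^sub>F s in at_left t. s / t \<in> {..<1} - {1}"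
        using assms by (auto simp: eventually_at_filter)
    qed
    ultimately have "((\<lambda>s. N (s / t)) \<longlongrightarrow> K) (at_left t)"
      using filterlim_compose by fastforce
    then have l2b: "((\<lambda>s. - (t powr (- a - b)) * N (s / t)) \<longlongrightarrow> - (t powr (- a - b)) * K) (at_left t)"
      by (intro tendsto_intros)
    have i2: "set_integrable lborel {\<tau><..<t} f2" "(LBINT x:{\<tau><..<t}. f2 x) = - (t powr (- a - b)) * K - - (t powr (- a - b)) * N x"
      by (rule set_integral_FTC_nonneg[OF t d2 _ _ l2a l2b];
          use t assms mono in \<open>auto simp: f2_def[abs_def] intro!: continuous_intros mult_nonneg_nonneg\<close>)+
    have e1: "f s = - f1 s" if "s \<in> {0<..<\<tau>}" for s
      using that t by (simp add: f_def f1_def barrier_def max_def algebra_simps)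
    have e2: "f s = - f2 s" if "s \<in> {\<tau><..<t}" for s
      using that t assms by (simp add: f_def f2_def barrier_def max_def algebra_simps)
    have j1: "set_integrable lborel {0<..<\<tau>} f" "(LBINT s:{0<..<\<tau>}. f s) = - (LBINT s:{0<..<\<tau>}. f1 s)"
    proof -
      have "set_integrable lborel {0<..<\<tau>} f \<longleftrightarrow> set_integrable lborel {0<..<\<tau>} (\<lambda>s. - f1 s)"
        by (intro set_integrable_cong) (use e1 in auto)
      then show "set_integrable lborel {0<..<\<tau>} f" using i1(1) by (simp add: set_integrable_def)
      have "(LBINT s:{0<..<\<tau>}. f s) = (LBINT s:{0<..<\<tau>}. - f1 s)"
        by (intro set_lebesgue_integral_cong) (use e1 in auto)
      then show "(LBINT s:{0<..<\<tau>}. f s) = - (LBINT s:{0<..<\<tau>}. f1 s)" by (simp add: set_lebesgue_integral_def)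
    qed
    have j2: "set_integrable lborel {\<tau><..<t} f" "(LBINT s:{\<tau><..<t}. f s) = - (LBINT s:{\<tau><..<t}. f2 s)"
    proof -
      have "set_integrable lborel {\<tau><..<t} f \<longleftrightarrow> set_integrable lborel {\<tau><..<t} (\<lambda>s. - f2 s)"
        by (intro set_integrable_cong) (use e2 in auto)
      then show "set_integrable lborel {\<tau><..<t} f" using i2(1) by (simp add: set_integrable_def)
      have "(LBINT s:{\<tau><..<t}. f s) = (LBINT s:{\<tau><..<t}. - f2 s)"
        by (intro set_lebesgue_integral_cong) (use e2 in auto)
      then show "(LBINT s:{\<tau><..<t}. f s) = - (LBINT s:{\<tau><..<t}. f2 s)" by (simp add: set_lebesgue_integral_def)
    qed
    have fm: "set_borel_measurable lborel {0<..<t} f"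
      unfolding set_borel_measurable_def f_def barrier_def by measurable
    have AE: "AE s in lborel. s \<in> {0<..<\<tau>} \<union> {\<tau><..<t} \<longleftrightarrow> s \<in> {0<..<t}"
      using AE_lborel_singleton[of \<tau>] by eventually_elim (use t assms in auto)
    have u: "set_integrable lborel ({0<..<\<tau>} \<union> {\<tau><..<t}) f"
      by (intro set_integrable_Un j1 j2) auto
    have ui: "(LBINT s:({0<..<\<tau>} \<union> {\<tau><..<t}). f s) = (LBINT s:{0<..<\<tau>}. f s) + (LBINT s:{\<tau><..<t}. f s)"
      by (intro set_integral_Un j1 j2) auto
    have "set_integrable lborel {0<..<t} f"
      unfolding set_integrable_def
    proof (rule integrable_cong_AE_imp)
      show "integrable lborel (\<lambda>x. indicator ({0<..<\<tau>} \<union> {\<tau><..<t}) x *\<^sub>R f x)"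
        using u by (simp add: set_integrable_def)
      show "AE x in lborel. indicat_real ({0<..<\<tau>} \<union> {\<tau><..<t}) x *\<^sub>R f x = indicat_real {0<..<t} x *\<^sub>R f x"
        using AE by eventually_elim (auto simp: indicator_def)
    qed (use fm in \<open>simp add: set_borel_measurable_def\<close>)
    moreover have "(LBINT s:{0<..<t}. f s) = (LBINT s:({0<..<\<tau>} \<union> {\<tau><..<t}). f s)"
      unfolding set_lebesgue_integral_def
    proof (rule integral_cong_AE)
      show "AE x in lborel. indicat_real {0<..<t} x *\<^sub>R f x = indicat_real ({0<..<\<tau>} \<union> {\<tau><..<t}) x *\<^sub>R f x"
        using AE by eventually_elim (auto simp: indicator_def)
      show "(\<lambda>x. indicator ({0<..<\<tau>} \<union> {\<tau><..<t}) x *\<^sub>R f x) \<in> borel_measurable lborel"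
        using u by (auto simp: set_integrable_def)
    qed (use fm in \<open>simp add: set_borel_measurable_def\<close>)
    moreover have "t powr (- a) * barrier b \<tau> t + (LBINT s:({0<..<\<tau>} \<union> {\<tau><..<t}). f s) =
        \<tau> powr (- b) * (t powr (- a) * (1 - barrier_defect a b (\<tau> / t)))"
    proof -
      define A where "A = t powr (- a)"
      define B where "B = t powr (- b)"
      define Y where "Y = x powr (- b)"
      define Z where "Z = (1 - x) powr (- a)"
      have tx: "t - \<tau> = t * (1 - x)" using x by (simp add: algebra_simps)
      have p: "\<tau> powr (- b) = B * Y" "t powr (- a - b) = A * B" "(t - \<tau>) powr (- a) = A * Z"
      proof -
        show "\<tau> powr (- b) = B * Y" using x by (simp add: B_def Y_def powr_mult)
        show "t powr (- a - b) = A * B" by (simp add: A_def B_def powr_diff powr_minus field_simps)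
        show "(t - \<tau>) powr (- a) = A * Z" unfolding tx A_def Z_def by (rule powr_mult)
      qed
      have yb: "Y * x powr b = 1" using x by (simp add: Y_def powr_minus)
      have bt: "barrier b \<tau> t = B" using t assms by (simp add: barrier_def B_def max_def)
      have bd: "barrier_defect a b (\<tau> / t) = F21 a b x - K * x powr b"
        unfolding barrier_defect_def K_def x_def[symmetric] using x(2) by simp
      have "B * Y * (A * (1 - (F21 a b x - K * x powr b))) =
          A * B * Y - A * B * Y * F21 a b x + A * B * K * (Y * x powr b)"
        by (simp add: algebra_simps)
      also have "\<dots> = A * B + (- ((B * Y - B) * (A * Z) - (B * Y - B) * A) +
          - (- (A * B) * K - - (A * B) * (Z * (1 - Y) + Y * F21 a b x)))"
        unfolding yb by (simp add: algebra_simps)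
      finally show ?thesis
        unfolding ui j1(2) j2(2) i1(2) i2(2) bt bd p N_def Y_def[symmetric] Z_def[symmetric]
          diff_zero A_def[symmetric] B_def[symmetric] by (rule sym)
    qed
    ultimately show ?thesis by simp
  qed
  then show ?A ?B by (simp_all add: f_def[abs_def])
qed

section \<open>Smooth steps and bumps\<close>

lemma partial_deriv_eq:
  assumes "(\<phi> has_derivative D) (at x)"
  shows "partial_deriv i \<phi> x = D i"
  using frechet_derivative_at[OF assms] by (simp add: partial_deriv_def)

lemma differentiable_has_partial_deriv:
  "\<phi> differentiable (at x) \<Longrightarrow> (\<phi> has_derivative (\<lambda>h. partial_deriv h \<phi> x)) (at x)"
  by (simp add: partial_deriv_def frechet_derivative_works)

lemma partial_deriv_real:
  fixes g :: "real \<Rightarrow> real"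
  assumes "(g has_real_derivative g') (at x)"
  shows "partial_deriv h g x = h * g'"
  using partial_deriv_eq[of g "(*) g'" x h] assms by (simp add: has_field_derivative_def mult.commute)

lemma C_k_differentiable: "C_k (Suc k) \<phi> \<Longrightarrow> \<phi> differentiable (at x)"
  by simp

lemma C_k_mono: "C_k (Suc k) \<phi> \<Longrightarrow> C_k k \<phi>"
proof (induction k arbitrary: \<phi>)
  case 0
  then show ?case
    by (auto intro!: continuous_at_imp_continuous_on differentiable_imp_continuous_within)
next
  case (Suc k)
  have "\<phi> differentiable at x" for x using Suc.prems by (rule C_k_differentiable)
  moreover have "C_k (Suc k) (partial_deriv i \<phi>)" if "i \<in> Basis" for i
    using Suc.prems that unfolding C_k.simps(2)[of "Suc k"] by blast
  then have "C_k k (partial_deriv i \<phi>)" if "i \<in> Basis" for i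
    using Suc.IH that by blast
  ultimately show ?case unfolding C_k.simps(2)[of k] by blast
qed

lemma C_k_continuous: "C_k k \<phi> \<Longrightarrow> continuous_on UNIV \<phi>"
  by (induction k) (auto dest: C_k_mono simp del: C_k.simps(2))

lemma partial_deriv_add:
  assumes "\<And>x. f differentiable (at x)" "\<And>x. g differentiable (at x)"
  shows "partial_deriv i (\<lambda>x. f x + g x) = (\<lambda>x. partial_deriv i f x + partial_deriv i g x)"
  by (intro ext partial_deriv_eq has_derivative_add differentiable_has_partial_deriv assms)

lemma partial_deriv_mult:
  assumes "\<And>x. f differentiable (at x)" "\<And>x. g differentiable (at x)"
  shows "partial_deriv i (\<lambda>x. f x * g x) = (\<lambda>x. f x * partial_deriv i g x + partial_deriv i f x * g x)"
  by (intro ext partial_deriv_eq has_derivative_mult differentiable_has_partial_deriv assms)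

lemma partial_deriv_const: "partial_deriv i (\<lambda>x. c) = (\<lambda>x. 0)"
  by (intro ext partial_deriv_eq has_derivative_const)

lemma C_k_const [intro]: "C_k k (\<lambda>x. c)"
  by (induction k arbitrary: c) (auto simp: partial_deriv_const)

lemma C_k_add: "C_k k f \<Longrightarrow> C_k k g \<Longrightarrow> C_k k (\<lambda>x. f x + g x)"
proof (induction k arbitrary: f g)
  case 0
  then show ?case by (auto intro: continuous_on_add)
next
  case (Suc k)
  then show ?case by (auto simp: partial_deriv_add)
qed

lemma C_k_mult: "C_k k f \<Longrightarrow> C_k k g \<Longrightarrow> C_k k (\<lambda>x. f x * g x)"
proof (induction k arbitrary: f g)
  case 0
  then show ?case by (auto intro: continuous_on_mult)
next
  case (Suc k)
  have "C_k k f" "C_k k g" using Suc.prems C_k_mono by blast+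
  with Suc show ?case by (auto simp: partial_deriv_mult intro!: C_k_add)
qed

lemma C_k_cmult: "C_k k f \<Longrightarrow> C_k k (\<lambda>x. c * f x)"
  by (intro C_k_mult C_k_const)

lemma C_k_diff: "C_k k f \<Longrightarrow> C_k k g \<Longrightarrow> C_k k (\<lambda>x. f x - g x)"
  using C_k_add[of k f "\<lambda>x. (-1) * g x"] C_k_cmult[of k g "-1"] by simp

lemma C_k_prod: "finite I \<Longrightarrow> (\<And>i. i \<in> I \<Longrightarrow> C_k k (f i)) \<Longrightarrow> C_k k (\<lambda>x. \<Prod>i\<in>I. f i x)"
  by (induction I rule: finite_induct) (auto intro: C_k_mult)

text \<open>Smooth functions of several variables are obtained from those of one variable along a direction \<open>v\<close>.\<close>
lemma C_k_compose_affine: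
  fixes g :: "real \<Rightarrow> real" and v :: "'a::euclidean_space"
  assumes "C_k k g"
  shows "C_k k (\<lambda>x. g (c * (x \<bullet> v) + d))"
  using assms
proof (induction k arbitrary: g)
  case 0
  then have "continuous_on UNIV g" by simp
  then have "continuous_on UNIV (\<lambda>x::'a. g (c * (x \<bullet> v) + d))"
    by (rule continuous_on_compose2) (auto intro!: continuous_intros)
  then show ?case by simp
next
  case (Suc k)
  have der: "((\<lambda>x. g (c * (x \<bullet> v) + d)) has_derivative
      (\<lambda>h. (c * (h \<bullet> v)) * partial_deriv 1 g (c * (x \<bullet> v) + d))) (at x)" for x :: 'a
  proof -
    let ?y = "c * (x \<bullet> v) + d"
    have D: "(g has_derivative (\<lambda>h. partial_deriv h g ?y)) (at ?y)"
      using Suc.prems by (intro differentiable_has_partial_deriv) simp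
    have "partial_deriv h g ?y = h * partial_deriv 1 g ?y" for h
      using linear_cmul[OF has_derivative_linear[OF D], of h 1] by simp
    then have g: "(g has_derivative (\<lambda>h. h * partial_deriv 1 g ?y)) (at ?y)"
      by (intro has_derivative_eq_rhs[OF D] ext)
    have "((\<lambda>x. c * (x \<bullet> v) + d) has_derivative (\<lambda>h. c * (h \<bullet> v))) (at x)"
      by (auto intro!: derivative_eq_intros)
    from has_derivative_compose[OF this g] show ?thesis .
  qed
  have pd: "partial_deriv i (\<lambda>x. g (c * (x \<bullet> v) + d)) =
      (\<lambda>x. (c * (i \<bullet> v)) * partial_deriv 1 g (c * (x \<bullet> v) + d))" for i :: 'a
    by (intro ext partial_deriv_eq der)
  have "C_k k (partial_deriv 1 g)" using Suc.prems by simp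
  then have "C_k k (partial_deriv i (\<lambda>x::'a. g (c * (x \<bullet> v) + d)))" for i
    unfolding pd by (intro C_k_cmult Suc.IH)
  moreover have "(\<lambda>x::'a. g (c * (x \<bullet> v) + d)) differentiable (at x)" for x
    using der[of x] by (rule differentiableI)
  ultimately show ?case by simp
qed

lemma C_k_real:
  fixes g :: "real \<Rightarrow> real"
  assumes "\<And>x. (g has_real_derivative g' x) (at x)" "C_k k g'"
  shows "C_k (Suc k) g"
proof -
  have "partial_deriv 1 g = g'"
    using partial_deriv_real[OF assms(1), of 1] by auto
  then show ?thesis using assms
    by (auto simp: real_differentiable_def has_field_derivative_def intro: differentiableI)
qed

text \<open>The family is closed under differentiation up to linear combinations (\<open>flat_exp_deriv\<close>), so smoothness of
all members follows by one induction.\<close>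
definition flat_exp :: "nat \<Rightarrow> real \<Rightarrow> real" where
  "flat_exp n x = (if x > 0 then (1 / x) ^ n * exp (- (1 / x)) else 0)"

lemma flat_exp_deriv: "(flat_exp n has_real_derivative flat_exp (n + 2) x - real n * flat_exp (n + 1) x) (at x)"
proof -
  consider "x > 0" | "x < 0" | "x = 0" by linarith
  then show ?thesis
  proof cases
    case 1
    have "((\<lambda>x. (1 / x) ^ n * exp (- (1 / x))) has_real_derivative flat_exp (n + 2) x - real n * flat_exp (n + 1) x) (at x)"
    proof (cases n)
      case 0
      then show ?thesis using 1
        by (auto intro!: derivative_eq_intros simp: flat_exp_def field_simps power2_eq_square)
    next
      case (Suc m)
      have i: "((\<lambda>x. 1 / x) has_real_derivative - ((1 / x)\<^sup>2)) (at x)"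
        using 1 by (auto intro!: derivative_eq_intros simp: power2_eq_square)
      have "((\<lambda>x. (1 / x) ^ Suc m * exp (- (1 / x))) has_real_derivative
          (1 + real m) * (- ((1 / x)\<^sup>2) * (1 / x) ^ m) * exp (- (1 / x)) +
          exp (- (1 / x)) * - (- ((1 / x)\<^sup>2)) * (1 / x) ^ Suc m) (at x)"
        by (intro DERIV_mult DERIV_power_Suc DERIV_fun_exp DERIV_minus i)
      moreover have "(1 + real m) * (- ((1 / x)\<^sup>2) * (1 / x) ^ m) * exp (- (1 / x)) +
          exp (- (1 / x)) * - (- ((1 / x)\<^sup>2)) * (1 / x) ^ Suc m = flat_exp (n + 2) x - real n * flat_exp (n + 1) x"
      proof -
        have f: "flat_exp k x = (1 / x) ^ k * exp (- (1 / x))" for k using 1 by (simp add: flat_exp_def)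
        show ?thesis unfolding f Suc by (simp add: power_add algebra_simps power2_eq_square del: power_divide power_one)
      qed
      ultimately show ?thesis unfolding Suc by simp
    qed
    then show ?thesis
      by (rule has_field_derivative_transform_within_open[where S = "{0<..}"]) (use 1 in \<open>auto simp: flat_exp_def\<close>)
  next
    case 2
    have "((\<lambda>x. 0) has_real_derivative flat_exp (n + 2) x - real n * flat_exp (n + 1) x) (at x)"
      using 2 by (simp add: flat_exp_def)
    then show ?thesis
      by (rule has_field_derivative_transform_within_open[where S = "{..<0}"]) (use 2 in \<open>auto simp: flat_exp_def\<close>)
  next
    case 3
    have "((\<lambda>h. flat_exp n h / h) \<longlongrightarrow> 0) (at 0)"
    proof (rule filterlim_split_at)
      have "\<forall>\<^sub>F h in at_left 0. 0 = flat_exp n h / h"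
        by (auto simp: eventually_at_filter flat_exp_def)
      then show "((\<lambda>h. flat_exp n h / h) \<longlongrightarrow> 0) (at_left 0)"
        by (rule Lim_transform_eventually[OF tendsto_const])
      have "((\<lambda>h. inverse h ^ (n + 1) / exp (inverse h)) \<longlongrightarrow> (0::real)) (at_right 0)"
        by (rule filterlim_compose[OF tendsto_power_div_exp_0 filterlim_inverse_at_top_right])
      moreover have "\<forall>\<^sub>F h in at_right 0. inverse h ^ (n + 1) / exp (inverse h) = flat_exp n h / h"
        by (auto simp: eventually_at_filter flat_exp_def exp_minus field_simps)
      ultimately show "((\<lambda>h. flat_exp n h / h) \<longlongrightarrow> 0) (at_right 0)"
        by (rule Lim_transform_eventually)
    qed
    then have "(flat_exp n has_real_derivative 0) (at 0)"
      by (simp add: has_field_derivative_iff flat_exp_def)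
    then show ?thesis using 3 by (simp add: flat_exp_def)
  qed
qed

lemma C_k_flat_exp: "C_k k (flat_exp n)"
proof (induction k arbitrary: n)
  case 0
  show ?case using DERIV_isCont[OF flat_exp_deriv] by (simp add: continuous_on_eq_continuous_at)
next
  case (Suc k)
  show ?case
    by (rule C_k_real[OF flat_exp_deriv]) (intro C_k_diff C_k_cmult Suc.IH)
qed

text \<open>The step is the normalised primitive of the bump \<open>exp (-1/x) * exp (-1/(1-x))\<close>.\<close>
lemma smooth_step_exists:
  obtains \<psi> \<psi>' :: "real \<Rightarrow> real" where
    "\<And>k. C_k k \<psi>" "\<And>x. x \<le> 0 \<Longrightarrow> \<psi> x = 0" "\<And>x. x \<ge> 1 \<Longrightarrow> \<psi> x = 1" "mono \<psi>"
    "\<And>x. (\<psi> has_real_derivative \<psi>' x) (at x)" "continuous_on UNIV \<psi>'" "\<And>x. 0 \<le> \<psi>' x"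
    "\<And>x. x \<le> 0 \<or> x \<ge> 1 \<Longrightarrow> \<psi>' x = 0"
proof -
  define h where "h x = flat_exp 0 x * flat_exp 0 (1 - x)" for x
  have hC: "C_k k h" for k
    using C_k_compose_affine[OF C_k_flat_exp[of k 0], of "-1" "1::real" 1]
    unfolding h_def by (intro C_k_mult C_k_flat_exp) simp
  have hc: "continuous_on UNIV h" using C_k_continuous[OF hC[of 0]] .
  have h0: "0 \<le> h x" for x by (simp add: h_def flat_exp_def)
  have hz: "h x = 0" if "x \<le> 0 \<or> x \<ge> 1" for x using that by (auto simp: h_def flat_exp_def)
  \<comment> \<open>Starting at \<open>-1\<close> rather than \<open>0\<close> keeps \<open>0\<close> inside the interval where \<open>P\<close> is differentiated.\<close>
  define P where "P x = integral {-1..x} h" for x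
  have P0: "P x = 0" if "x \<le> 0" for x
  proof -
    have "integral {-1..x} h = integral {-1..x} (\<lambda>x. 0)"
      by (rule integral_cong) (use that hz in auto)
    then show ?thesis by (simp add: P_def)
  qed
  have P: "(P has_real_derivative h x) (at x)" for x
  proof (cases "x < 0")
    case True
    have "((\<lambda>x. 0) has_real_derivative h x) (at x)" using True hz by simp
    then show ?thesis
      by (rule has_field_derivative_transform_within_open[where S = "{..<0}"]) (use True P0 in auto)
  next
    case False
    have "(P has_real_derivative h x) (at x within {-1..x+1})"
      unfolding P_def by (rule integral_has_real_derivative) (use hc False in \<open>auto intro: continuous_on_subset\<close>)
    then have "(P has_real_derivative h x) (at x within {-1<..<x+1})"
      by (rule DERIV_subset) auto
    moreover have "at x within {-1<..<x+1} = at x"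
      using False by (intro at_within_open) auto
    ultimately show ?thesis by simp
  qed
  have Pm: "P x \<le> P y" if "x \<le> y" for x y
    using that by (rule DERIV_nonneg_imp_nondecreasing) (use P h0 in blast)
  \<comment> \<open>\<open>P\<close> increases strictly somewhere, so the normalising constant \<open>P 1\<close> is positive.\<close>
  obtain z where z: "1/4 < z" "z < 3/4" "P (3/4) - P (1/4) = (3/4 - 1/4) * h z"
    using MVT2[of "1/4" "3/4" P h] P by auto
  have "h z > 0" using z by (simp add: h_def flat_exp_def)
  with z Pm[of 0 "1/4"] P0[of 0] Pm[of "3/4" 1] have P1: "P 1 > 0" by simp
  have P1': "P x = P 1" if "x \<ge> 1" for x
  proof (cases "x = 1")
    case False
    with that obtain w where "1 < w" "P x - P 1 = (x - 1) * h w"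
      using MVT2[of 1 x P h] P by auto
    then show ?thesis using hz[of w] by simp
  qed simp
  define \<psi> where "\<psi> x = 1 / P 1 * P x" for x
  define \<psi>' where "\<psi>' x = 1 / P 1 * h x" for x
  have d: "(\<psi> has_real_derivative \<psi>' x) (at x)" for x
    unfolding \<psi>_def \<psi>'_def by (intro DERIV_cmult P)
  show thesis
  proof
    show "C_k k \<psi>" for k
    proof -
      have "C_k (Suc k) \<psi>"
        by (rule C_k_real[OF d]) (use hC in \<open>auto simp: \<psi>'_def[abs_def] intro!: C_k_cmult simp del: times_divide_eq_left\<close>)
      then show ?thesis by (rule C_k_mono)
    qed
    show "\<psi> x = 0" if "x \<le> 0" for x using P0[OF that] by (simp add: \<psi>_def)
    show "\<psi> x = 1" if "x \<ge> 1" for x using P1'[OF that] P1 by (simp add: \<psi>_def)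
    show "mono \<psi>" using Pm P1 by (auto intro!: monoI simp: \<psi>_def divide_right_mono)
    show "(\<psi> has_real_derivative \<psi>' x) (at x)" for x by (rule d)
    show "continuous_on UNIV \<psi>'" unfolding \<psi>'_def by (intro continuous_intros hc)
    show "0 \<le> \<psi>' x" for x using h0 P1 by (simp add: \<psi>'_def)
    show "\<psi>' x = 0" if "x \<le> 0 \<or> x \<ge> 1" for x using hz[OF that] by (simp add: \<psi>'_def)
  qed
qed

text \<open>Products of steps that become steeper at the faces of the box.\<close>
lemma box_bumps_exist:
  fixes a b :: "'a::euclidean_space"
  obtains B :: "nat \<Rightarrow> 'a \<Rightarrow> real" where
    "\<And>n k. C_k k (B n)" "\<And>n x. 0 \<le> B n x" "\<And>n x. B n x \<le> 1"
    "\<And>n x. x \<notin> cbox a b \<Longrightarrow> B n x = 0" "\<And>x. (\<lambda>n. B n x) \<longlonglongrightarrow> indicator (box a b) x"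
proof -
  obtain \<psi> \<psi>' :: "real \<Rightarrow> real" where \<psi>: "\<And>k. C_k k \<psi>" "\<And>x. x \<le> 0 \<Longrightarrow> \<psi> x = 0" "\<And>x. x \<ge> 1 \<Longrightarrow> \<psi> x = 1" "mono \<psi>"
    using smooth_step_exists by metis
  have \<psi>01: "0 \<le> \<psi> x" "\<psi> x \<le> 1" for x
    using \<psi>(2)[of x] \<psi>(3)[of x] monoD[OF \<psi>(4), of 0 x] monoD[OF \<psi>(4), of x 1] \<psi>(2)[of 0] \<psi>(3)[of 1] by linarith+
  define B where "B n x = (\<Prod>i\<in>Basis. \<psi> (real n * (x \<bullet> i - a \<bullet> i)) * \<psi> (real n * (b \<bullet> i - x \<bullet> i)))" for n x
  show thesis
  proof
    show "C_k k (B n)" for n k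
      unfolding B_def
    proof (intro C_k_prod C_k_mult finite_Basis)
      fix i :: 'a
      show "C_k k (\<lambda>x. \<psi> (real n * (x \<bullet> i - a \<bullet> i)))"
        using C_k_compose_affine[OF \<psi>(1)[of k], of "real n" i "- (real n * (a \<bullet> i))"] by (simp add: right_diff_distrib)
      show "C_k k (\<lambda>x. \<psi> (real n * (b \<bullet> i - x \<bullet> i)))"
        using C_k_compose_affine[OF \<psi>(1)[of k], of "- real n" i "real n * (b \<bullet> i)"] by (simp add: right_diff_distrib)
    qed
    show "0 \<le> B n x" "B n x \<le> 1" for n x
      unfolding B_def using \<psi>01 by (auto intro!: prod_nonneg prod_le_1 mult_nonneg_nonneg mult_le_one)
    have z: "B n x = 0" if nin: "x \<notin> box a b" for n x
    proof -
      obtain i where i: "i \<in> Basis" "\<not> (a \<bullet> i < x \<bullet> i \<and> x \<bullet> i < b \<bullet> i)" using nin unfolding mem_box by blast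
      then have "real n * (x \<bullet> i - a \<bullet> i) \<le> 0 \<or> real n * (b \<bullet> i - x \<bullet> i) \<le> 0"
        by (auto simp: mult_le_0_iff)
      then have "\<psi> (real n * (x \<bullet> i - a \<bullet> i)) * \<psi> (real n * (b \<bullet> i - x \<bullet> i)) = 0"
        using \<psi>(2) by auto
      with i show ?thesis by (auto simp: B_def)
    qed
    then show "B n x = 0" if "x \<notin> cbox a b" for n x using that box_subset_cbox by blast
    show "(\<lambda>n. B n x) \<longlonglongrightarrow> indicator (box a b) x" for x
    proof (cases "x \<in> box a b")
      case True
      have "eventually (\<lambda>n. \<forall>i\<in>Basis. \<psi> (real n * (x \<bullet> i - a \<bullet> i)) * \<psi> (real n * (b \<bullet> i - x \<bullet> i)) = 1) sequentially"
      proof (intro eventually_ball_finite ballI finite_Basis)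
        fix i :: 'a assume i: "i \<in> Basis"
        define d where "d = min (x \<bullet> i - a \<bullet> i) (b \<bullet> i - x \<bullet> i)"
        have d: "d > 0" using True i by (auto simp: d_def mem_box)
        obtain N where N: "1 < real N * d" using d reals_Archimedean3 by blast
        have "\<psi> (real n * (x \<bullet> i - a \<bullet> i)) * \<psi> (real n * (b \<bullet> i - x \<bullet> i)) = 1" if "n \<ge> N" for n
        proof -
          have "real N * d \<le> real n * (x \<bullet> i - a \<bullet> i)" "real N * d \<le> real n * (b \<bullet> i - x \<bullet> i)"
            using that d by (auto simp: d_def intro!: mult_mono)
          with N show ?thesis using \<psi>(3) by simp
        qed
        then show "\<forall>\<^sub>F n in sequentially. \<psi> (real n * (x \<bullet> i - a \<bullet> i)) * \<psi> (real n * (b \<bullet> i - x \<bullet> i)) = 1"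
          unfolding eventually_sequentially by blast
      qed
      then have "eventually (\<lambda>n. 1 = B n x) sequentially"
        by eventually_elim (simp add: B_def)
      then show ?thesis using True by (simp add: Lim_transform_eventually[OF tendsto_const])
    next
      case False
      then show ?thesis using z by simp
    qed
  qed
qed

section \<open>Test functions and weak derivatives\<close>

lemma test_function_integral:
  assumes "\<phi> \<in> test_functions \<Omega>" "\<Omega> \<in> sets lebesgue"
  shows "(LINT x|lebesgue_on \<Omega>. v x * \<phi> x) = (LINT x|lebesgue. v x * \<phi> x)"
proof -
  have "indicator \<Omega> x *\<^sub>R (v x * \<phi> x) = v x * \<phi> x" for x
    using assms(1) by (auto simp: test_functions_def indicator_def)
  then have "(\<lambda>x. indicator \<Omega> x *\<^sub>R (v x * \<phi> x)) = (\<lambda>x. v x * \<phi> x)" by (rule ext)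
  then show ?thesis using assms(2) by (simp add: integral_restrict_space del: real_scaleR_def)
qed

lemma sigma_finite_lebesgue: "sigma_finite_measure (lebesgue :: 'a::euclidean_space measure)"
proof
  show "\<exists>A::'a set set. countable A \<and> A \<subseteq> sets lebesgue \<and> \<Union>A = space lebesgue \<and> (\<forall>a\<in>A. emeasure lebesgue a \<noteq> \<infinity>)"
  proof (intro exI conjI ballI)
    show "countable (range (\<lambda>n::nat. ball (0::'a) (real n)))" by simp
    show "\<Union>(range (\<lambda>n::nat. ball (0::'a) (real n))) = space lebesgue"
      using reals_Archimedean2 by auto
    fix A assume "A \<in> range (\<lambda>n::nat. ball (0::'a) (real n))"
    then have "A \<in> lmeasurable" by auto
    then show "emeasure lebesgue A \<noteq> \<infinity>" by (auto simp: fmeasurable_def)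
  qed auto
qed

text \<open>Open boxes form an intersection-stable generator of the Borel sets, so all Borel sets have integral zero
by Dynkin's theorem, and then all Lebesgue sets.\<close>
lemma AE_zero_if_box_integrals_zero:
  fixes w :: "'a::euclidean_space \<Rightarrow> real"
  assumes w: "integrable lebesgue w" "(LINT x|lebesgue. w x) = 0"
    and box: "\<And>a b. (LINT x:box a b|lebesgue. w x) = 0"
  shows "AE x in lebesgue. w x = 0"
proof (rule sigma_finite_measure.density_zero[OF sigma_finite_lebesgue w(1)])
  define G where "G = range (\<lambda>(a, b). box a b :: 'a set)"
  have si: "set_integrable lebesgue A w" if "A \<in> sets lebesgue" for A
    using w(1) that unfolding set_integrable_def by (intro integrable_mult_indicator)
  have borel: "(LINT x:A|lebesgue. w x) = 0" if A: "A \<in> sigma_sets UNIV G" for A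
  proof -
    have stable: "Int_stable G"
      unfolding Int_stable_def G_def by (auto simp: box_Int_box)
    have leb: "A \<in> sets lebesgue" if "A \<in> sigma_sets UNIV G" for A
    proof -
      have "A \<in> sets (borel :: 'a measure)" using that unfolding borel_eq_box G_def by simp
      then show ?thesis by simp
    qed
    have "G \<subseteq> Pow UNIV" by simp
    from stable this A show ?thesis
    proof (induction rule: sigma_sets_induct_disjoint)
      case (basic A)
      then show ?case using box by (auto simp: G_def)
    next
      case empty
      then show ?case by (simp add: set_lebesgue_integral_def)
    next
      case (compl A)
      have A: "A \<in> sets lebesgue" using compl(1) by (rule leb)
      then have "(LINT x:A \<union> (UNIV - A)|lebesgue. w x) =
          (LINT x:A|lebesgue. w x) + (LINT x:UNIV - A|lebesgue. w x)"
        by (intro set_integral_Un si) auto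
      moreover have "A \<union> (UNIV - A) = UNIV" by auto
      ultimately show ?case using compl w(2) by (simp add: set_lebesgue_integral_def)
    next
      case (union A)
      have m: "A i \<in> sets lebesgue" for i using union(2) by (intro leb) auto
      have "(LINT x:(\<Union>i. A i)|lebesgue. w x) = (\<Sum>i. LINT x:A i|lebesgue. w x)"
        by (rule lebesgue_integral_countable_add)
           (use m union(1) in \<open>auto simp: disjoint_family_on_def intro!: si\<close>)
      then show ?case using union(3) by simp
    qed
  qed
  fix A :: "'a set" assume "A \<in> sets lebesgue"
  then have "A \<in> sets (completion lborel)" by simp
  from sets_completionE[OF this] obtain S N N' where
    SN: "A = S \<union> N" "N \<subseteq> N'" "N' \<in> null_sets lborel" "S \<in> sets lborel" by metis
  have "AE x in lebesgue. x \<notin> N'"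
    using SN(3) by (intro AE_not_in) (simp add: null_sets_completionI)
  then have AE: "AE x in lebesgue. indicat_real A x *\<^sub>R w x = indicat_real S x *\<^sub>R w x"
    by eventually_elim (use SN(1,2) in \<open>auto simp: indicator_def\<close>)
  have S: "S \<in> sets lebesgue" using SN(4) by simp
  have "(LINT x:A|lebesgue. w x) = (LINT x:S|lebesgue. w x)"
    unfolding set_lebesgue_integral_def
    using si[OF S] si[OF \<open>A \<in> sets lebesgue\<close>]
    by (intro integral_cong_AE AE) (auto simp: set_integrable_def)
  also have "\<dots> = 0"
    using SN(4) by (intro borel) (simp add: G_def borel_eq_box)
  finally show "(LINT x:A|lebesgue. w x) = 0" .
qed

text \<open>By dominated convergence along \<open>box_bumps_exist\<close>, the integral of \<open>v\<close> over every box whose closure lies in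
\<open>\<Omega>\<close> vanishes, so \<open>v\<close> vanishes almost everywhere on each such box. Countably many of them, with their faces,
cover \<open>\<Omega>\<close>.\<close>
lemma fundamental_lemma_calculus_of_variations:
  fixes v :: "'a::euclidean_space \<Rightarrow> real"
  assumes \<Omega>: "open \<Omega>" and v: "square_integrable v"
    and zero: "\<And>\<phi>. \<phi> \<in> test_functions \<Omega> \<Longrightarrow> (LINT x|lebesgue_on \<Omega>. v x * \<phi> x) = 0"
  shows "AE x in lebesgue. x \<in> \<Omega> \<longrightarrow> v x = 0"
proof -
  have \<Omega>s: "\<Omega> \<in> sets lebesgue" using \<Omega> by simp
  have vm: "v \<in> borel_measurable lebesgue" using v by (simp add: square_integrable_def)
  have vi: "integrable lebesgue (\<lambda>x. v x * indicat_real A x)" if "A \<in> lmeasurable" for A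
    using v that by (intro square_integrable_mult square_integrable_indicator)
  have box: "(LINT x|lebesgue. v x * indicat_real (box a b) x) = 0" if ab: "cbox a b \<subseteq> \<Omega>" for a b
  proof -
    obtain B :: "nat \<Rightarrow> 'a \<Rightarrow> real" where B:
      "\<And>n k. C_k k (B n)" "\<And>n x. 0 \<le> B n x" "\<And>n x. B n x \<le> 1"
      "\<And>n x. x \<notin> cbox a b \<Longrightarrow> B n x = 0" "\<And>x. (\<lambda>n. B n x) \<longlonglongrightarrow> indicator (box a b) x"
      using box_bumps_exist[of a b] by metis
    have test: "B n \<in> test_functions \<Omega>" for n
      using B(1,4) ab compact_cbox[of a b] unfolding test_functions_def by blast
    have Bm: "B n \<in> borel_measurable lebesgue" for n
      using borel_measurable_continuous_onI[OF C_k_continuous[of 0 "B n", OF B(1)]]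
      by (intro measurable_completion) simp
    have "(\<lambda>n. LINT x|lebesgue. v x * B n x) \<longlonglongrightarrow> (LINT x|lebesgue. v x * indicat_real (box a b) x)"
    proof (rule integral_dominated_convergence)
      show "integrable lebesgue (\<lambda>x. \<bar>v x * indicat_real (cbox a b) x\<bar>)"
        by (intro integrable_abs vi) auto
      show "AE x in lebesgue. (\<lambda>n. v x * B n x) \<longlonglongrightarrow> v x * indicat_real (box a b) x"
        by (intro AE_I2 tendsto_mult tendsto_const B)
      show "AE x in lebesgue. norm (v x * B n x) \<le> \<bar>v x * indicat_real (cbox a b) x\<bar>" for n
      proof (intro AE_I2)
        fix x
        show "norm (v x * B n x) \<le> \<bar>v x * indicat_real (cbox a b) x\<bar>"
          using B(2)[of n x] B(3)[of n x] B(4)[of x n] by (cases "x \<in> cbox a b") (auto simp: abs_mult intro: mult_left_le)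
      qed
    qed (use vm Bm borel_measurable_integrable[OF vi[of "box a b"]] in auto)
    moreover have "(LINT x|lebesgue. v x * B n x) = 0" for n
      using zero[OF test] test_function_integral[OF test \<Omega>s] by simp
    ultimately show ?thesis by (simp add: LIMSEQ_const_iff)
  qed
  have AE: "AE x in lebesgue. x \<in> box a b \<longrightarrow> v x = 0" if ab: "cbox a b \<subseteq> \<Omega>" for a b
  proof -
    have "AE x in lebesgue. v x * indicat_real (box a b) x = 0"
    proof (rule AE_zero_if_box_integrals_zero)
      show "integrable lebesgue (\<lambda>x. v x * indicat_real (box a b) x)" by (intro vi) auto
      show "(LINT x|lebesgue. v x * indicat_real (box a b) x) = 0" by (rule box[OF ab])
      fix c d :: 'a
      let ?c = "\<Sum>i\<in>Basis. max (a \<bullet> i) (c \<bullet> i) *\<^sub>R i" and ?d = "\<Sum>i\<in>Basis. min (b \<bullet> i) (d \<bullet> i) *\<^sub>R i"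
      have "cbox ?c ?d \<subseteq> cbox a b" by (auto simp: mem_box)
      then have "(LINT x|lebesgue. v x * indicat_real (box ?c ?d) x) = 0"
        using ab by (intro box) auto
      moreover have "indicator (box c d) x *\<^sub>R (v x * indicat_real (box a b) x) = v x * indicat_real (box ?c ?d) x" for x
        unfolding box_Int_box[symmetric] by (auto simp: indicator_def)
      ultimately show "(LINT x:box c d|lebesgue. v x * indicat_real (box a b) x) = 0"
        by (simp only: set_lebesgue_integral_def)
    qed
    then show ?thesis by eventually_elim (auto simp: indicator_def split: if_splits)
  qed
  obtain D where D: "countable D" "\<And>X. X \<in> D \<Longrightarrow> X \<subseteq> \<Omega>" "\<And>X. X \<in> D \<Longrightarrow> \<exists>a b. X = cbox a b" "\<Union>D = \<Omega>"
    using open_countable_Union_open_cbox[OF \<Omega>] by (metis Pow_iff subsetD)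
  have "AE x in lebesgue. x \<in> X \<longrightarrow> v x = 0" if X: "X \<in> D" for X
  proof -
    obtain a b where ab: "X = cbox a b" using D(3)[OF X] by blast
    have "AE x in lebesgue. x \<notin> cbox a b - box a b"
      using negligible_frontier_interval[of a b] by (intro AE_not_in) (simp add: negligible_iff_null_sets)
    moreover have "AE x in lebesgue. x \<in> box a b \<longrightarrow> v x = 0"
      using AE[of a b] D(2)[OF X] ab by blast
    ultimately show ?thesis unfolding ab by eventually_elim auto
  qed
  then have "AE x in lebesgue. \<forall>X\<in>D. x \<in> X \<longrightarrow> v x = 0"
    using D(1) by (subst AE_ball_countable) auto
  then show ?thesis by eventually_elim (use D(4) in blast)
qed

lemma test_function_square_integrable:
  fixes \<phi> :: "'a::euclidean_space \<Rightarrow> real"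
  assumes "\<phi> \<in> test_functions \<Omega>"
  shows "square_integrable \<phi>"
proof -
  obtain K where K: "compact K" "\<And>x. x \<notin> K \<Longrightarrow> \<phi> x = 0" and C: "C_k 0 \<phi>"
    using assms by (auto simp: test_functions_def simp del: C_k.simps)
  have c: "continuous_on UNIV \<phi>" using C by (rule C_k_continuous)
  then have m: "\<phi> \<in> borel_measurable lebesgue"
    by (intro measurable_completion) (simp add: borel_measurable_continuous_onI)
  have "bounded (\<phi> ` K)"
    using K(1) c by (intro compact_imp_bounded compact_continuous_image) (auto intro: continuous_on_subset)
  then obtain M where M: "\<And>x. x \<in> K \<Longrightarrow> \<bar>\<phi> x\<bar> \<le> M" by (auto simp: bounded_iff)
  have "integrable lebesgue (\<lambda>x. (\<phi> x)\<^sup>2)"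
  proof (rule Bochner_Integration.integrable_bound)
    show "integrable lebesgue (\<lambda>x. M\<^sup>2 * indicat_real K x)"
      using lmeasurable_compact[OF K(1)] by (auto simp: fmeasurable_def)
    show "AE x in lebesgue. norm ((\<phi> x)\<^sup>2) \<le> norm (M\<^sup>2 * indicat_real K x)"
    proof (intro AE_I2)
      fix x show "norm ((\<phi> x)\<^sup>2) \<le> norm (M\<^sup>2 * indicat_real K x)"
        using M[of x] K(2)[of x] power_mono[of "\<bar>\<phi> x\<bar>" M 2] by (cases "x \<in> K") auto
    qed
  qed (use m in simp)
  with m show ?thesis by (simp add: square_integrable_def)
qed

lemma partial_deriv_test_function:
  assumes "\<phi> \<in> test_functions \<Omega>" "i \<in> Basis"
  shows "partial_deriv i \<phi> \<in> test_functions \<Omega>"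
proof -
  obtain K where K: "compact K" "K \<subseteq> \<Omega>" "\<And>x. x \<notin> K \<Longrightarrow> \<phi> x = 0" and C: "\<And>k. C_k k \<phi>"
    using assms by (auto simp: test_functions_def simp del: C_k.simps)
  have "C_k k (partial_deriv i \<phi>)" for k using C[of "Suc k"] assms(2) by simp
  moreover have "partial_deriv i \<phi> x = 0" if "x \<notin> K" for x
  proof (rule partial_deriv_eq[where D = "\<lambda>_. 0"])
    show "(\<phi> has_derivative (\<lambda>_. 0)) (at x)"
      by (rule has_derivative_transform_within_open[of "\<lambda>_. 0" _ _ _ "- K"])
         (use K that compact_imp_closed[OF K(1)] in auto)
  qed
  ultimately show ?thesis using K unfolding test_functions_def by blast
qed

lemma test_functions_diff:
  assumes "\<phi> \<in> test_functions \<Omega>" "\<theta> \<in> test_functions \<Omega>"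
  shows "(\<lambda>x. \<phi> x - \<theta> x) \<in> test_functions \<Omega>"
proof -
  obtain K L where "compact K" "K \<subseteq> \<Omega>" "\<And>x. x \<notin> K \<Longrightarrow> \<phi> x = 0" "compact L" "L \<subseteq> \<Omega>" "\<And>x. x \<notin> L \<Longrightarrow> \<theta> x = 0"
    using assms by (auto simp: test_functions_def simp del: C_k.simps)
  then have "compact (K \<union> L) \<and> K \<union> L \<subseteq> \<Omega> \<and> (\<forall>x. x \<notin> K \<union> L \<longrightarrow> \<phi> x - \<theta> x = 0)" by auto
  moreover have "C_k k (\<lambda>x. \<phi> x - \<theta> x)" for k
    using assms by (intro C_k_diff) (auto simp: test_functions_def)
  ultimately show ?thesis unfolding test_functions_def by blast
qed

lemma rep_l2_diff_AE: "AE x in lebesgue. rep_l2 (v - w) x = rep_l2 v x - rep_l2 w x"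
proof -
  have "v - w = abs_l2 (\<lambda>x. rep_l2 v x - rep_l2 w x)"
    using abs_l2_diff[of "rep_l2 v" "rep_l2 w"] by simp
  then show ?thesis by (simp add: rep_l2_abs_l2 square_integrable_diff)
qed

lemma rep_l2_measurable [measurable]: "rep_l2 v \<in> borel_measurable lebesgue"
  using square_integrable_rep_l2[of v] by (simp add: square_integrable_def)

lemma l2_eq_0_iff: "v = 0 \<longleftrightarrow> (AE x in lebesgue. rep_l2 v x = 0)"
  using abs_l2_eq_iff[of "rep_l2 v" "\<lambda>x. 0"] by (simp add: abs_l2_zero)

lemma l2_on_diff:
  assumes "v \<in> l2_on \<Omega>" "w \<in> l2_on \<Omega>"
  shows "v - w \<in> l2_on \<Omega>"
  using assms rep_l2_diff_AE[of v w] unfolding l2_on_def by auto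

lemma test_function_integral_diff:
  fixes g h :: "'a::euclidean_space l2"
  assumes \<phi>: "\<phi> \<in> test_functions \<Omega>" and \<Omega>: "open \<Omega>"
  shows "(LINT x|lebesgue_on \<Omega>. rep_l2 (g - h) x * \<phi> x) =
         (LINT x|lebesgue_on \<Omega>. rep_l2 g x * \<phi> x) - (LINT x|lebesgue_on \<Omega>. rep_l2 h x * \<phi> x)"
proof -
  have s: "\<Omega> \<in> sets lebesgue" using \<Omega> by simp
  have \<phi>s: "square_integrable \<phi>" by (rule test_function_square_integrable[OF \<phi>])
  have "(LINT x|lebesgue. rep_l2 (g - h) x * \<phi> x) = (LINT x|lebesgue. rep_l2 g x * \<phi> x - rep_l2 h x * \<phi> x)"
  proof (rule integral_cong_AE)
    show "AE x in lebesgue. rep_l2 (g - h) x * \<phi> x = rep_l2 g x * \<phi> x - rep_l2 h x * \<phi> x"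
      using rep_l2_diff_AE[of g h] by eventually_elim (simp add: left_diff_distrib)
  qed (use \<phi>s in \<open>auto simp: square_integrable_def\<close>)
  also have "\<dots> = (LINT x|lebesgue. rep_l2 g x * \<phi> x) - (LINT x|lebesgue. rep_l2 h x * \<phi> x)"
    using \<phi>s by (intro Bochner_Integration.integral_diff square_integrable_mult) auto
  finally show ?thesis by (simp add: test_function_integral[OF \<phi> s])
qed

lemma l2_on_eqI:
  fixes g h :: "'a::euclidean_space l2"
  assumes \<Omega>: "open \<Omega>" and gh: "g \<in> l2_on \<Omega>" "h \<in> l2_on \<Omega>"
    and eq: "\<And>\<phi>. \<phi> \<in> test_functions \<Omega> \<Longrightarrow> (LINT x|lebesgue_on \<Omega>. rep_l2 g x * \<phi> x) = (LINT x|lebesgue_on \<Omega>. rep_l2 h x * \<phi> x)"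
  shows "g = h"
proof -
  have "AE x in lebesgue. x \<in> \<Omega> \<longrightarrow> rep_l2 (g - h) x = 0"
    by (rule fundamental_lemma_calculus_of_variations[OF \<Omega>]) (simp_all add: test_function_integral_diff \<Omega> eq)
  moreover have "AE x in lebesgue. x \<notin> \<Omega> \<longrightarrow> rep_l2 (g - h) x = 0"
    using l2_on_diff[OF gh] by (simp add: l2_on_def)
  ultimately have "AE x in lebesgue. rep_l2 (g - h) x = 0" by eventually_elim blast
  then show ?thesis using l2_eq_0_iff[of "g - h"] by simp
qed

lemma has_weak_partial_unique:
  assumes "open \<Omega>" "has_weak_partial \<Omega> i v g" "has_weak_partial \<Omega> i v h"
  shows "g = h"
  using assms by (intro l2_on_eqI[of \<Omega>]) (auto simp: has_weak_partial_def)

text \<open>Uniqueness turns the definite description in \<open>weak_partial\<close> into the expected value.\<close>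
lemma weak_partial_eq:
  assumes "open \<Omega>" "has_weak_partial \<Omega> i v g"
  shows "weak_partial \<Omega> i v = g"
  unfolding weak_partial_def using assms has_weak_partial_unique by blast

lemma has_weak_partial_diff:
  assumes "open \<Omega>" "i \<in> Basis" "has_weak_partial \<Omega> i v g" "has_weak_partial \<Omega> i w h"
  shows "has_weak_partial \<Omega> i (v - w) (g - h)"
  using assms unfolding has_weak_partial_def
  by (auto simp: test_function_integral_diff partial_deriv_test_function intro: l2_on_diff)

lemma H1_has_weak_partial:
  assumes "open \<Omega>" "v \<in> H1 \<Omega>" "i \<in> Basis"
  shows "has_weak_partial \<Omega> i v (weak_partial \<Omega> i v)"
  using assms weak_partial_eq[OF assms(1)] unfolding H1_def by blast

lemma weak_partial_diff:
  assumes "open \<Omega>" "v \<in> H1 \<Omega>" "w \<in> H1 \<Omega>" "i \<in> Basis"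
  shows "weak_partial \<Omega> i (v - w) = weak_partial \<Omega> i v - weak_partial \<Omega> i w"
  by (intro weak_partial_eq has_weak_partial_diff H1_has_weak_partial assms)

text \<open>The definition of \<open>H10\<close> in sequential form.\<close>
lemma H10_approximation:
  assumes "v \<in> H10 \<Omega>"
  obtains \<phi> where "\<And>n. \<phi> n \<in> test_functions \<Omega>" "(\<lambda>n. abs_l2 (\<phi> n)) \<longlonglongrightarrow> v"
    "\<And>i. i \<in> Basis \<Longrightarrow> (\<lambda>n. abs_l2 (partial_deriv i (\<phi> n))) \<longlonglongrightarrow> weak_partial \<Omega> i v"
proof -
  let ?d = "\<lambda>\<phi>. (norm (v - abs_l2 \<phi>))\<^sup>2 + (\<Sum>i\<in>Basis. (norm (weak_partial \<Omega> i v - abs_l2 (partial_deriv i \<phi>)))\<^sup>2)"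
  have "\<exists>\<phi>\<in>test_functions \<Omega>. ?d \<phi> < (1 / real (Suc n))\<^sup>2" for n
    using assms unfolding H10_def by (auto simp del: of_nat_Suc)
  then obtain \<phi> where "\<forall>n. \<phi> n \<in> test_functions \<Omega> \<and> ?d (\<phi> n) < (1 / real (Suc n))\<^sup>2"
    unfolding Bex_def by (rule choice[OF allI, THEN exE])
  then have \<phi>: "\<And>n. \<phi> n \<in> test_functions \<Omega>" "\<And>n. ?d (\<phi> n) < (1 / real (Suc n))\<^sup>2"
    by blast+
  have lim: "X \<longlonglongrightarrow> L" if le: "\<And>n. (norm (L - X n))\<^sup>2 \<le> ?d (\<phi> n)" for X and L :: "'a l2"
  proof -
    have "norm (X n - L) \<le> 1 / real (Suc n)" for n
    proof -
      have "(norm (L - X n))\<^sup>2 \<le> (1 / real (Suc n))\<^sup>2" using le[of n] \<phi>(2)[of n] by linarith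
      then have "norm (L - X n) \<le> 1 / real (Suc n)" by (rule power2_le_imp_le) simp
      then show ?thesis by (subst norm_minus_commute)
    qed
    then have "\<forall>\<^sub>F n in sequentially. norm (X n - L) \<le> 1 / real (Suc n)" by simp
    then have "(\<lambda>n. X n - L) \<longlonglongrightarrow> 0"
      by (rule Lim_null_comparison) (rule LIMSEQ_Suc[OF lim_1_over_n])
    then show ?thesis by (rule LIM_zero_cancel)
  qed
  show thesis
  proof
    show "\<phi> n \<in> test_functions \<Omega>" for n by (rule \<phi>)
    show "(\<lambda>n. abs_l2 (\<phi> n)) \<longlonglongrightarrow> v" by (rule lim) (simp add: sum_nonneg)
    fix i :: 'a assume i: "i \<in> Basis"
    show "(\<lambda>n. abs_l2 (partial_deriv i (\<phi> n))) \<longlonglongrightarrow> weak_partial \<Omega> i v"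
    proof (rule lim)
      fix n
      have "(norm (weak_partial \<Omega> i v - abs_l2 (partial_deriv i (\<phi> n))))\<^sup>2 \<le>
        (\<Sum>i\<in>Basis. (norm (weak_partial \<Omega> i v - abs_l2 (partial_deriv i (\<phi> n))))\<^sup>2)"
        using i by (intro member_le_sum) auto
      then show "(norm (weak_partial \<Omega> i v - abs_l2 (partial_deriv i (\<phi> n))))\<^sup>2 \<le> ?d (\<phi> n)"
        by (simp add: add_increasing)
    qed
  qed
qed

lemma H10_diff:
  assumes \<Omega>: "open \<Omega>" and v: "v \<in> H10 \<Omega>" and w: "w \<in> H10 \<Omega>"
  shows "v - w \<in> H10 \<Omega>"
proof -
  have vw: "v \<in> H1 \<Omega>" "w \<in> H1 \<Omega>" using v w by (auto simp: H10_def)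
  obtain \<phi> where \<phi>: "\<And>n. \<phi> n \<in> test_functions \<Omega>" "(\<lambda>n. abs_l2 (\<phi> n)) \<longlonglongrightarrow> v"
    "\<And>i. i \<in> Basis \<Longrightarrow> (\<lambda>n. abs_l2 (partial_deriv i (\<phi> n))) \<longlonglongrightarrow> weak_partial \<Omega> i v"
    using H10_approximation[OF v] by metis
  obtain \<theta> where \<theta>: "\<And>n. \<theta> n \<in> test_functions \<Omega>" "(\<lambda>n. abs_l2 (\<theta> n)) \<longlonglongrightarrow> w"
    "\<And>i. i \<in> Basis \<Longrightarrow> (\<lambda>n. abs_l2 (partial_deriv i (\<theta> n))) \<longlonglongrightarrow> weak_partial \<Omega> i w"
    using H10_approximation[OF w] by metis
  define \<eta> where "\<eta> n x = \<phi> n x - \<theta> n x" for n x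
  have \<eta>: "\<eta> n \<in> test_functions \<Omega>" for n
    unfolding \<eta>_def using \<phi>(1) \<theta>(1) by (intro test_functions_diff)
  have a: "abs_l2 (\<eta> n) = abs_l2 (\<phi> n) - abs_l2 (\<theta> n)" for n
    unfolding \<eta>_def using test_function_square_integrable[OF \<phi>(1)] test_function_square_integrable[OF \<theta>(1)]
    by (simp add: abs_l2_diff)
  have pd: "abs_l2 (partial_deriv i (\<eta> n)) = abs_l2 (partial_deriv i (\<phi> n)) - abs_l2 (partial_deriv i (\<theta> n))"
    if i: "i \<in> Basis" for i n
  proof -
    have diffble: "f differentiable at x" if "f \<in> test_functions \<Omega>" for f :: "'a \<Rightarrow> real" and x
    proof -
      have "C_k (Suc 0) f" using that unfolding test_functions_def by blast
      then show ?thesis by (rule C_k_differentiable)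
    qed
    have "\<phi> n differentiable at x" "\<theta> n differentiable at x" for x
      using \<phi>(1) \<theta>(1) by (auto intro: diffble)
    then have "partial_deriv i (\<eta> n) = (\<lambda>x. partial_deriv i (\<phi> n) x - partial_deriv i (\<theta> n) x)"
      unfolding \<eta>_def by (intro ext partial_deriv_eq has_derivative_diff differentiable_has_partial_deriv)
    then show ?thesis
      using test_function_square_integrable[OF partial_deriv_test_function[OF \<phi>(1) i]]
        test_function_square_integrable[OF partial_deriv_test_function[OF \<theta>(1) i]]
      by (simp add: abs_l2_diff)
  qed
  have lim: "(\<lambda>n. (norm ((v - w) - abs_l2 (\<eta> n)))\<^sup>2 +
      (\<Sum>i\<in>Basis. (norm (weak_partial \<Omega> i (v - w) - abs_l2 (partial_deriv i (\<eta> n))))\<^sup>2)) \<longlonglongrightarrow>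
      (norm ((v - w) - (v - w)))\<^sup>2 + (\<Sum>i\<in>(Basis::'a set). (norm ((weak_partial \<Omega> i v - weak_partial \<Omega> i w) - (weak_partial \<Omega> i v - weak_partial \<Omega> i w)))\<^sup>2)"
  proof (intro tendsto_add tendsto_power tendsto_norm tendsto_diff tendsto_const tendsto_sum)
    show "(\<lambda>n. abs_l2 (\<eta> n)) \<longlonglongrightarrow> v - w" unfolding a by (intro tendsto_diff \<phi> \<theta>)
    fix i :: 'a assume i: "i \<in> Basis"
    show "(\<lambda>n. abs_l2 (partial_deriv i (\<eta> n))) \<longlonglongrightarrow> weak_partial \<Omega> i v - weak_partial \<Omega> i w"
      unfolding pd[OF i] by (intro tendsto_diff \<phi> \<theta> i)
    show "(\<lambda>n. weak_partial \<Omega> i (v - w)) \<longlonglongrightarrow> weak_partial \<Omega> i v - weak_partial \<Omega> i w"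
      by (simp add: weak_partial_diff \<Omega> vw i)
  qed
  have "\<exists>\<eta>\<in>test_functions \<Omega>. (norm ((v - w) - abs_l2 \<eta>))\<^sup>2 +
     (\<Sum>i\<in>Basis. (norm (weak_partial \<Omega> i (v - w) - abs_l2 (partial_deriv i \<eta>)))\<^sup>2) < \<epsilon>\<^sup>2" if "\<epsilon> > 0" for \<epsilon>
  proof -
    have "\<epsilon>\<^sup>2 > 0" using that by simp
    from order_tendstoD(2)[OF lim, of "\<epsilon>\<^sup>2"] this obtain n where "(norm ((v - w) - abs_l2 (\<eta> n)))\<^sup>2 +
      (\<Sum>i\<in>Basis. (norm (weak_partial \<Omega> i (v - w) - abs_l2 (partial_deriv i (\<eta> n))))\<^sup>2) < \<epsilon>\<^sup>2"
      by (auto simp: eventually_sequentially)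
    then show ?thesis using \<eta> by blast
  qed
  moreover have "v - w \<in> H1 \<Omega>"
  proof -
    have "has_weak_partial \<Omega> i (v - w) (weak_partial \<Omega> i v - weak_partial \<Omega> i w)" if "i \<in> Basis" for i
      using that by (intro has_weak_partial_diff H1_has_weak_partial \<Omega> vw)
    then show ?thesis using vw l2_on_diff unfolding H1_def by blast
  qed
  ultimately show ?thesis by (simp add: H10_def)
qed

section \<open>The energy identity\<close>

lemma inner_abs_l2:
  assumes "square_integrable f" "square_integrable g"
  shows "abs_l2 f \<bullet> abs_l2 g = (LINT x|lebesgue. f x * g x)"
  using assms by (simp add: inner_l2.abs_eq)

text \<open>Multiplication by a coefficient as a map of \<open>L2\<close>. It turns each term of the elliptic form into an inner
product, so that passing to the limit in the second argument needs only continuity of the inner product.\<close>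
definition coeff_mult :: "'a::euclidean_space set \<Rightarrow> ('a \<Rightarrow> real) \<Rightarrow> 'a l2 \<Rightarrow> 'a l2" where
  "coeff_mult \<Omega> g p = abs_l2 (\<lambda>x. indicator \<Omega> x * g x * rep_l2 p x)"

lemma bounded_coeff_extend:
  assumes "open \<Omega>" "bounded_coeff \<Omega> g"
  obtains M where "AE x in lebesgue. \<bar>indicator \<Omega> x * g x\<bar> \<le> M"
    "(\<lambda>x. indicator \<Omega> x * g x) \<in> borel_measurable lebesgue"
proof -
  obtain M where M: "AE x in lebesgue_on \<Omega>. \<bar>g x\<bar> \<le> M" and g: "g \<in> borel_measurable (lebesgue_on \<Omega>)"
    using assms(2) by (auto simp: bounded_coeff_def)
  have \<Omega>: "\<Omega> \<inter> space lebesgue \<in> sets lebesgue" using assms(1) by simp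
  have "AE x in lebesgue. x \<in> \<Omega> \<longrightarrow> \<bar>g x\<bar> \<le> M"
    using M AE_restrict_space_iff[OF \<Omega>, of "\<lambda>x. \<bar>g x\<bar> \<le> M"] by simp
  \<comment> \<open>The maximum matters for empty \<open>\<Omega>\<close>, when \<open>M\<close> may be negative.\<close>
  then have "AE x in lebesgue. \<bar>indicator \<Omega> x * g x\<bar> \<le> max 0 M"
    by eventually_elim (auto simp: indicator_def)
  moreover have "(\<lambda>x. indicator \<Omega> x * g x) \<in> borel_measurable lebesgue"
    using g borel_measurable_restrict_space_iff[OF \<Omega>, of g] by simp
  ultimately show thesis using that[of "max 0 M"] by simp
qed

lemma bounded_mult_square_integrable:
  assumes M: "AE x in lebesgue. \<bar>G x\<bar> \<le> M" and G: "G \<in> borel_measurable lebesgue"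
  shows "square_integrable (\<lambda>x. G x * rep_l2 p x)"
proof -
  have le: "AE x in lebesgue. (G x * rep_l2 p x)\<^sup>2 \<le> M\<^sup>2 * (rep_l2 p x)\<^sup>2"
    using M
  proof eventually_elim
    fix x assume "\<bar>G x\<bar> \<le> M"
    then have "(G x)\<^sup>2 \<le> M\<^sup>2" using power_mono[of "\<bar>G x\<bar>" M 2] by simp
    then show "(G x * rep_l2 p x)\<^sup>2 \<le> M\<^sup>2 * (rep_l2 p x)\<^sup>2"
      by (simp add: power_mult_distrib mult_right_mono)
  qed
  have "integrable lebesgue (\<lambda>x. M\<^sup>2 * (rep_l2 p x)\<^sup>2)"
    using square_integrable_rep_l2[of p] by (simp add: square_integrable_def)
  then have "integrable lebesgue (\<lambda>x. (G x * rep_l2 p x)\<^sup>2)"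
    by (rule Bochner_Integration.integrable_bound) (use G le in auto)
  then show ?thesis using G by (simp add: square_integrable_def)
qed

lemma coeff_mult_square_integrable:
  assumes "open \<Omega>" "bounded_coeff \<Omega> g"
  shows "square_integrable (\<lambda>x. indicator \<Omega> x * g x * rep_l2 p x)"
  using bounded_coeff_extend[OF assms] bounded_mult_square_integrable by metis

lemma coeff_mult_diff:
  assumes "open \<Omega>" "bounded_coeff \<Omega> g"
  shows "coeff_mult \<Omega> g (p - q) = coeff_mult \<Omega> g p - coeff_mult \<Omega> g q"
proof -
  note s = coeff_mult_square_integrable[OF assms]
  have "AE x in lebesgue. indicator \<Omega> x * g x * rep_l2 (p - q) x =
      indicator \<Omega> x * g x * rep_l2 p x - indicator \<Omega> x * g x * rep_l2 q x"
    using rep_l2_diff_AE[of p q] by eventually_elim (simp add: right_diff_distrib)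
  then show ?thesis
    unfolding coeff_mult_def using s by (simp add: abs_l2_diff abs_l2_eq_iff square_integrable_diff)
qed

lemma weighted_integral:
  assumes \<Omega>: "open \<Omega>" and g: "bounded_coeff \<Omega> g" and \<psi>: "square_integrable \<psi>"
  shows "integrable (lebesgue_on \<Omega>) (\<lambda>x. g x * rep_l2 p x * \<psi> x)"
    and "(LINT x|lebesgue_on \<Omega>. g x * rep_l2 p x * \<psi> x) = coeff_mult \<Omega> g p \<bullet> abs_l2 \<psi>"
proof -
  have m: "\<Omega> \<inter> space lebesgue \<in> sets lebesgue" using \<Omega> by simp
  have e: "(\<lambda>x. indicator \<Omega> x *\<^sub>R (g x * rep_l2 p x * \<psi> x)) = (\<lambda>x. (indicator \<Omega> x * g x * rep_l2 p x) * \<psi> x)"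
    by (simp add: mult.assoc)
  show "integrable (lebesgue_on \<Omega>) (\<lambda>x. g x * rep_l2 p x * \<psi> x)"
    unfolding integrable_restrict_space[OF m] e
    by (intro square_integrable_mult coeff_mult_square_integrable \<Omega> g \<psi>)
  show "(LINT x|lebesgue_on \<Omega>. g x * rep_l2 p x * \<psi> x) = coeff_mult \<Omega> g p \<bullet> abs_l2 \<psi>"
    unfolding integral_restrict_space[OF m] e coeff_mult_def
    by (rule inner_abs_l2[symmetric]) (intro coeff_mult_square_integrable \<Omega> g \<psi>)+
qed

text \<open>\<open>elliptic_form\<close> on classes instead of functions, with the derivatives as independent arguments.\<close>
definition l2_form :: "'a::euclidean_space set \<Rightarrow> ('a \<Rightarrow> 'a \<Rightarrow> 'a \<Rightarrow> real) \<Rightarrow> ('a \<Rightarrow> 'a \<Rightarrow> real) \<Rightarrow> ('a \<Rightarrow> real) \<Rightarrow>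
     'a l2 \<Rightarrow> ('a \<Rightarrow> 'a l2) \<Rightarrow> 'a l2 \<Rightarrow> ('a \<Rightarrow> 'a l2) \<Rightarrow> real" where
  "l2_form \<Omega> a b c v Dv w Dw =
     (\<Sum>i\<in>Basis. \<Sum>j\<in>Basis. coeff_mult \<Omega> (a i j) (Dv j) \<bullet> Dw i) +
     (\<Sum>j\<in>Basis. coeff_mult \<Omega> (b j) (Dv j) \<bullet> w) + coeff_mult \<Omega> c v \<bullet> w"

lemma elliptic_form_eq_l2_form:
  assumes \<Omega>: "open \<Omega>" and ell: "elliptic_coeffs \<Omega> a b c"
    and \<psi>: "square_integrable \<psi>" "\<And>i. i \<in> Basis \<Longrightarrow> square_integrable (D\<psi> i)"
  shows "elliptic_form \<Omega> a b c (rep_l2 v) (\<lambda>i. rep_l2 (Dv i)) \<psi> D\<psi> =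
         l2_form \<Omega> a b c v Dv (abs_l2 \<psi>) (\<lambda>i. abs_l2 (D\<psi> i))"
proof -
  have bc: "bounded_coeff \<Omega> (a i j)" "bounded_coeff \<Omega> (b j)" "bounded_coeff \<Omega> c" if "i \<in> Basis" "j \<in> Basis" for i j
    using ell that by (auto simp: elliptic_coeffs_def)
  have c: "bounded_coeff \<Omega> c" using ell by (auto simp: elliptic_coeffs_def)
  note wi = weighted_integral[OF \<Omega>]
  have ia: "integrable (lebesgue_on \<Omega>) (\<lambda>x. \<Sum>i\<in>Basis. \<Sum>j\<in>Basis. a i j x * rep_l2 (Dv j) x * D\<psi> i x)"
    by (intro Bochner_Integration.integrable_sum wi(1) bc \<psi>)
  have ib: "integrable (lebesgue_on \<Omega>) (\<lambda>x. \<Sum>j\<in>Basis. b j x * rep_l2 (Dv j) x * \<psi> x)"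
    by (intro Bochner_Integration.integrable_sum wi(1) bc \<psi>)
  have ic: "integrable (lebesgue_on \<Omega>) (\<lambda>x. c x * rep_l2 v x * \<psi> x)"
    by (intro wi(1) c \<psi>)
  have "elliptic_form \<Omega> a b c (rep_l2 v) (\<lambda>i. rep_l2 (Dv i)) \<psi> D\<psi> =
     (LINT x|lebesgue_on \<Omega>. (\<Sum>i\<in>Basis. \<Sum>j\<in>Basis. a i j x * rep_l2 (Dv j) x * D\<psi> i x) +
       (\<Sum>j\<in>Basis. b j x * rep_l2 (Dv j) x * \<psi> x) + c x * rep_l2 v x * \<psi> x)"
    unfolding elliptic_form_def by (simp add: sum_distrib_right)
  also have "\<dots> = (LINT x|lebesgue_on \<Omega>. (\<Sum>i\<in>Basis. \<Sum>j\<in>Basis. a i j x * rep_l2 (Dv j) x * D\<psi> i x)) +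
       (LINT x|lebesgue_on \<Omega>. (\<Sum>j\<in>Basis. b j x * rep_l2 (Dv j) x * \<psi> x)) +
       (LINT x|lebesgue_on \<Omega>. c x * rep_l2 v x * \<psi> x)"
    using ia ib ic by simp
  also have "(LINT x|lebesgue_on \<Omega>. (\<Sum>i\<in>Basis. \<Sum>j\<in>Basis. a i j x * rep_l2 (Dv j) x * D\<psi> i x)) =
      (\<Sum>i\<in>Basis. LINT x|lebesgue_on \<Omega>. (\<Sum>j\<in>Basis. a i j x * rep_l2 (Dv j) x * D\<psi> i x))"
    by (intro Bochner_Integration.integral_sum Bochner_Integration.integrable_sum wi(1) bc \<psi>)
  also have "\<dots> = (\<Sum>i\<in>Basis. \<Sum>j\<in>Basis. coeff_mult \<Omega> (a i j) (Dv j) \<bullet> abs_l2 (D\<psi> i))"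
  proof (intro sum.cong refl)
    fix i :: 'a assume i: "i \<in> Basis"
    have "(LINT x|lebesgue_on \<Omega>. (\<Sum>j\<in>Basis. a i j x * rep_l2 (Dv j) x * D\<psi> i x)) =
       (\<Sum>j\<in>Basis. LINT x|lebesgue_on \<Omega>. a i j x * rep_l2 (Dv j) x * D\<psi> i x)"
      using i by (intro Bochner_Integration.integral_sum wi(1) bc \<psi>)
    also have "\<dots> = (\<Sum>j\<in>Basis. coeff_mult \<Omega> (a i j) (Dv j) \<bullet> abs_l2 (D\<psi> i))"
      using i by (intro sum.cong refl wi(2) bc \<psi>)
    finally show "(LINT x|lebesgue_on \<Omega>. (\<Sum>j\<in>Basis. a i j x * rep_l2 (Dv j) x * D\<psi> i x)) =
      (\<Sum>j\<in>Basis. coeff_mult \<Omega> (a i j) (Dv j) \<bullet> abs_l2 (D\<psi> i))" .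
  qed
  also have "(LINT x|lebesgue_on \<Omega>. (\<Sum>j\<in>Basis. b j x * rep_l2 (Dv j) x * \<psi> x)) =
      (\<Sum>j\<in>Basis. LINT x|lebesgue_on \<Omega>. b j x * rep_l2 (Dv j) x * \<psi> x)"
    by (intro Bochner_Integration.integral_sum wi(1) bc \<psi>)
  also have "\<dots> = (\<Sum>j\<in>Basis. coeff_mult \<Omega> (b j) (Dv j) \<bullet> abs_l2 \<psi>)"
    by (intro sum.cong refl wi(2) bc \<psi>)
  also have "(LINT x|lebesgue_on \<Omega>. c x * rep_l2 v x * \<psi> x) = coeff_mult \<Omega> c v \<bullet> abs_l2 \<psi>"
    by (intro wi(2) c \<psi>)
  finally show ?thesis by (simp add: l2_form_def)
qed

lemma l2_form_diff_left:
  assumes \<Omega>: "open \<Omega>" and ell: "elliptic_coeffs \<Omega> a b c"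
    and D: "\<And>i. i \<in> Basis \<Longrightarrow> Dz i = Dv i - Dw i"
  shows "l2_form \<Omega> a b c (v - w) Dz y Dy = l2_form \<Omega> a b c v Dv y Dy - l2_form \<Omega> a b c w Dw y Dy"
proof -
  have bc: "bounded_coeff \<Omega> (a i j)" "bounded_coeff \<Omega> (b j)" if "i \<in> Basis" "j \<in> Basis" for i j
    using ell that by (auto simp: elliptic_coeffs_def)
  have c: "bounded_coeff \<Omega> c" using ell by (auto simp: elliptic_coeffs_def)
  show ?thesis
    unfolding l2_form_def using bc c
    by (simp add: D coeff_mult_diff[OF \<Omega>] inner_diff_left sum_subtractf)
qed

text \<open>Tested with a test function instead of \<open>v - w\<close>, this is the hypothesis. Both sides depend continuously
on the test function and its first derivatives in \<open>L2\<close>, and test functions approximate \<open>v - w\<close> in this sense.\<close>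
lemma energy_identity:
  fixes v w z r :: "'a::euclidean_space l2"
  assumes \<Omega>: "open \<Omega>" and ell: "elliptic_coeffs \<Omega> a b c"
    and vw: "v \<in> H10 \<Omega>" "w \<in> H10 \<Omega>"
    and eq: "\<And>\<phi>. \<phi> \<in> test_functions \<Omega> \<Longrightarrow>
      (LINT x|lebesgue_on \<Omega>. rep_l2 z x * \<phi> x) + elliptic_op \<Omega> a b c v \<phi> - elliptic_op \<Omega> a b c w \<phi> =
      (LINT x|lebesgue_on \<Omega>. rep_l2 r x * \<phi> x)"
  shows "z \<bullet> (v - w) + elliptic_pairing \<Omega> a b c (v - w) (v - w) = r \<bullet> (v - w)"
proof -
  define e where "e = v - w"
  define De where "De i = weak_partial \<Omega> i e" for i
  have H1: "v \<in> H1 \<Omega>" "w \<in> H1 \<Omega>" using vw by (auto simp: H10_def)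
  have e: "e \<in> H10 \<Omega>" unfolding e_def by (rule H10_diff[OF \<Omega> vw])
  obtain \<phi> where \<phi>: "\<And>n. \<phi> n \<in> test_functions \<Omega>" "(\<lambda>n. abs_l2 (\<phi> n)) \<longlonglongrightarrow> e"
    "\<And>i. i \<in> Basis \<Longrightarrow> (\<lambda>n. abs_l2 (partial_deriv i (\<phi> n))) \<longlonglongrightarrow> De i"
    unfolding De_def using H10_approximation[OF e] by metis
  have test: "(LINT x|lebesgue_on \<Omega>. rep_l2 y x * \<psi> x) = y \<bullet> abs_l2 \<psi>" if "\<psi> \<in> test_functions \<Omega>" for y \<psi>
  proof -
    have "\<Omega> \<in> sets lebesgue" using \<Omega> by simp
    then have "(LINT x|lebesgue_on \<Omega>. rep_l2 y x * \<psi> x) = (LINT x|lebesgue. rep_l2 y x * \<psi> x)"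
      by (rule test_function_integral[OF that])
    also have "\<dots> = abs_l2 (rep_l2 y) \<bullet> abs_l2 \<psi>"
      by (rule inner_abs_l2[symmetric]) (use test_function_square_integrable[OF that] in auto)
    finally show ?thesis by simp
  qed
  have op: "elliptic_op \<Omega> a b c y \<psi> = l2_form \<Omega> a b c y (\<lambda>i. weak_partial \<Omega> i y) (abs_l2 \<psi>) (\<lambda>i. abs_l2 (partial_deriv i \<psi>))"
    if "\<psi> \<in> test_functions \<Omega>" for y \<psi>
    unfolding elliptic_op_def
    by (intro elliptic_form_eq_l2_form[OF \<Omega> ell] test_function_square_integrable[of _ \<Omega>] partial_deriv_test_function that)
  have "z \<bullet> abs_l2 (\<phi> n) + l2_form \<Omega> a b c e De (abs_l2 (\<phi> n)) (\<lambda>i. abs_l2 (partial_deriv i (\<phi> n))) = r \<bullet> abs_l2 (\<phi> n)" for n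
  proof -
    have "l2_form \<Omega> a b c e De (abs_l2 (\<phi> n)) (\<lambda>i. abs_l2 (partial_deriv i (\<phi> n))) =
      elliptic_op \<Omega> a b c v (\<phi> n) - elliptic_op \<Omega> a b c w (\<phi> n)"
      unfolding op[OF \<phi>(1)] e_def
      by (rule l2_form_diff_left[OF \<Omega> ell]) (simp add: De_def e_def weak_partial_diff[OF \<Omega> H1])
    then show ?thesis using eq[OF \<phi>(1)[of n]] by (simp add: test[OF \<phi>(1)])
  qed
  moreover have "(\<lambda>n. z \<bullet> abs_l2 (\<phi> n) + l2_form \<Omega> a b c e De (abs_l2 (\<phi> n)) (\<lambda>i. abs_l2 (partial_deriv i (\<phi> n))))
     \<longlonglongrightarrow> z \<bullet> e + l2_form \<Omega> a b c e De e De"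
    unfolding l2_form_def by (intro tendsto_add tendsto_sum tendsto_inner tendsto_const \<phi>)
  moreover have "(\<lambda>n. r \<bullet> abs_l2 (\<phi> n)) \<longlonglongrightarrow> r \<bullet> e"
    by (intro tendsto_inner tendsto_const \<phi>)
  ultimately have "z \<bullet> e + l2_form \<Omega> a b c e De e De = r \<bullet> e"
    using LIMSEQ_unique by simp
  moreover have "elliptic_pairing \<Omega> a b c e e = l2_form \<Omega> a b c e De e De"
    unfolding elliptic_pairing_def using elliptic_form_eq_l2_form[OF \<Omega> ell, of "rep_l2 e" "\<lambda>i. rep_l2 (De i)" e De]
    by (simp add: De_def[abs_def])
  ultimately show ?thesis by (simp add: e_def)
qed

section \<open>Lipschitz continuity in time\<close>

text \<open>Testing the weak derivative \<open>g\<close> with a smooth approximation \<open>\<phi>\<close> of the indicator of \<open>{s..t}\<close>, built as the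
difference of two steep steps, bounds the integral of \<open>\<phi> * g\<close> by \<open>M * (t - s)\<close> up to a small error, while \<open>deriv \<phi>\<close> is a difference of
mollifiers concentrating at \<open>s\<close> and \<open>t\<close>, which recover \<open>y s - y t\<close> by continuity.\<close>
lemma W1_infty_imp_lipschitz:
  fixes y :: "real \<Rightarrow> 'b::{banach, second_countable_topology}"
  assumes ab: "a < b" and cont: "continuous_on {a..b} y" and W: "W1_infty a b X y"
  obtains M where "M-lipschitz_on {a..b} y"
proof -
  define L where "L = lebesgue_on {a<..<b}"
  interpret L: finite_measure L
    unfolding L_def by (rule finite_measure_lebesgue_on) simp
  obtain g M0 where ym: "y \<in> borel_measurable L" and gm: "g \<in> borel_measurable L"
    and M0: "AE t in L. norm (g t) \<le> M0"
    and weak: "\<And>\<phi>. \<phi> \<in> test_functions {a<..<b} \<Longrightarrow> (LINT t|L. deriv \<phi> t *\<^sub>R y t) = - (LINT t|L. \<phi> t *\<^sub>R g t)"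
    using W unfolding W1_infty_def L_infty_def L_def by auto
  define M where "M = max 0 M0"
  have M: "0 \<le> M" "AE t in L. norm (g t) \<le> M"
    using M0 by (auto simp: M_def)
  have "bounded (y ` {a..b})"
    using cont by (intro compact_imp_bounded compact_continuous_image) auto
  then obtain Y where Y: "\<And>x. x \<in> {a..b} \<Longrightarrow> norm (y x) \<le> Y" unfolding bounded_iff by blast
  have spL: "space L = {a<..<b}" by (simp add: L_def)
  have contL: "f \<in> borel_measurable L" if "continuous_on UNIV f" for f :: "real \<Rightarrow> real"
    unfolding L_def using that by (auto intro!: measurable_restrict_space1 measurable_completion borel_measurable_continuous_onI)
  obtain \<psi> \<psi>' :: "real \<Rightarrow> real" where \<psi>: "\<And>k. C_k k \<psi>" "\<And>x. x \<le> 0 \<Longrightarrow> \<psi> x = 0" "\<And>x. x \<ge> 1 \<Longrightarrow> \<psi> x = 1" "mono \<psi>"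
    "\<And>x. (\<psi> has_real_derivative \<psi>' x) (at x)" "continuous_on UNIV \<psi>'" "\<And>x. 0 \<le> \<psi>' x"
    "\<And>x. x \<le> 0 \<or> x \<ge> 1 \<Longrightarrow> \<psi>' x = 0"
    using smooth_step_exists by metis
  have \<psi>01: "0 \<le> \<psi> x" "\<psi> x \<le> 1" for x
    using \<psi>(2)[of x] \<psi>(3)[of x] monoD[OF \<psi>(4), of 0 x] monoD[OF \<psi>(4), of x 1] \<psi>(2)[of 0] \<psi>(3)[of 1] by linarith+
  have "bounded (\<psi>' ` {0..1})"
    using \<psi>(6) by (intro compact_imp_bounded compact_continuous_image) (auto intro: continuous_on_subset)
  then obtain P0 where P0: "\<And>x. x \<in> {0..1} \<Longrightarrow> \<bar>\<psi>' x\<bar> \<le> P0" unfolding bounded_iff real_norm_def by blast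
  define P where "P = max 0 P0"
  have P: "\<bar>\<psi>' x\<bar> \<le> P" for x
    using P0[of x] \<psi>(8)[of x] by (cases "x \<in> {0..1}") (auto simp: P_def)
  have d: "((\<lambda>x. \<psi> (k * (x - z))) has_real_derivative k * \<psi>' (k * (x - z))) (at x)" for k z x
  proof -
    have "((\<lambda>x. k * (x - z)) has_real_derivative k) (at x)" by (auto intro!: derivative_eq_intros)
    from DERIV_chain2[OF \<psi>(5) this] show ?thesis by (simp add: mult.commute)
  qed
  have hm: "(\<lambda>x. k * \<psi>' (k * (x - z))) \<in> borel_measurable L" for k z
    by (intro contL continuous_intros continuous_on_compose2[OF \<psi>(6)]) auto
  have hb: "\<bar>k * \<psi>' (k * (x - z))\<bar> \<le> \<bar>k\<bar> * P" for k z x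
    using P by (simp add: abs_mult mult_left_mono)
  have hint: "integrable L (\<lambda>x. k * \<psi>' (k * (x - z)))" for k z
    by (rule L.integrable_const_bound[where B = "\<bar>k\<bar> * P"]) (use hb hm in auto)
  have hyint: "integrable L (\<lambda>x. (k * \<psi>' (k * (x - z))) *\<^sub>R y x)" for k z
  proof (rule L.integrable_const_bound[where B = "(\<bar>k\<bar> * P) * Y"])
    show "(\<lambda>x. (k * \<psi>' (k * (x - z))) *\<^sub>R y x) \<in> borel_measurable L"
      by (intro borel_measurable_scaleR hm ym)
    show "AE x in L. norm ((k * \<psi>' (k * (x - z))) *\<^sub>R y x) \<le> (\<bar>k\<bar> * P) * Y"
    proof (intro AE_I2)
      fix x assume "x \<in> space L"
      then have "norm (y x) \<le> Y" using Y spL by auto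
      with hb[of k x z] show "norm ((k * \<psi>' (k * (x - z))) *\<^sub>R y x) \<le> (\<bar>k\<bar> * P) * Y"
        unfolding norm_scaleR by (intro mult_mono) (auto simp: P_def)
    qed
  qed
  \<comment> \<open>The derivative of a step of width \<open>1 / k\<close> is nonnegative with integral \<open>1\<close>, hence averages \<open>y\<close> over \<open>{z..z + 1 / k}\<close>.\<close>
  have mollify: "norm ((LINT x|L. (k * \<psi>' (k * (x - z))) *\<^sub>R y x) - y z) \<le> \<epsilon>"
    if z: "a < z" "z + 1 / k < b" "k > 0" and \<epsilon>: "\<And>x. z \<le> x \<Longrightarrow> x \<le> z + 1 / k \<Longrightarrow> norm (y x - y z) \<le> \<epsilon>" for k z \<epsilon>
  proof -
    let ?h = "\<lambda>x. k * \<psi>' (k * (x - z))"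
    have h0: "0 \<le> ?h x" for x using z \<psi>(7) by simp
    have hz: "?h x = 0" if "x \<notin> {z..z + 1 / k}" for x
    proof -
      have "k * (x - z) \<le> 0 \<or> k * (x - z) \<ge> 1"
        using that z by (auto simp: field_simps mult_le_0_iff)
      then show ?thesis using \<psi>(8) by auto
    qed
    have one: "(LINT x|L. ?h x) = 1"
    proof -
      have "(LINT x|L. ?h x) = (LINT x|lebesgue. indicator {a<..<b} x *\<^sub>R ?h x)"
        unfolding L_def by (intro integral_restrict_space) simp
      also have "(\<lambda>x. indicator {a<..<b} x *\<^sub>R ?h x) = (\<lambda>x. ?h x * indicator {z..z + 1 / k} x)"
      proof
        fix x show "indicator {a<..<b} x *\<^sub>R ?h x = ?h x * indicator {z..z + 1 / k} x"
          using hz[of x] z by (cases "x \<in> {z..z + 1 / k}") (auto simp: indicator_def)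
      qed
      also have "(LINT x|lebesgue. ?h x * indicator {z..z + 1 / k} x) = (LINT x|lborel. ?h x * indicator {z..z + 1 / k} x)"
      proof (rule integral_completion)
        have "?h \<in> borel_measurable borel"
          by (intro borel_measurable_continuous_onI continuous_intros continuous_on_compose2[OF \<psi>(6)]) auto
        then show "(\<lambda>x. ?h x * indicator {z..z + 1 / k} x) \<in> borel_measurable lborel" by simp
      qed
      also have "\<dots> = \<psi> (k * (z + 1 / k - z)) - \<psi> (k * (z - z))"
      proof (rule integral_FTC_Icc_real)
        show "z \<le> z + 1 / k" using z by simp
        fix x
        show "((\<lambda>x. \<psi> (k * (x - z))) has_real_derivative ?h x) (at x)" by (rule d)
        have "continuous_on UNIV ?h"
          by (intro continuous_intros continuous_on_compose2[OF \<psi>(6)]) auto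
        then show "isCont ?h x" by (simp add: continuous_on_eq_continuous_at)
      qed
      also have "\<dots> = 1" using z \<psi>(2)[of 0] \<psi>(3)[of 1] by simp
      finally show ?thesis .
    qed
    have "(LINT x|L. ?h x *\<^sub>R y x) - y z = (LINT x|L. ?h x *\<^sub>R (y x - y z))"
      using one hint[of k z] hyint[of k z] by (simp add: scaleR_diff_right)
    moreover have "norm (LINT x|L. ?h x *\<^sub>R (y x - y z)) \<le> (LINT x|L. ?h x * \<epsilon>)"
    proof (rule Bochner_Integration.integral_norm_bound_integral)
      show "integrable L (\<lambda>x. ?h x *\<^sub>R (y x - y z))"
        unfolding scaleR_diff_right using hint[of k z] hyint[of k z] by simp
      show "integrable L (\<lambda>x. ?h x * \<epsilon>)" using hint[of k z] by simp
      fix x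
      show "norm (?h x *\<^sub>R (y x - y z)) \<le> ?h x * \<epsilon>"
        using h0[of x] hz[of x] \<epsilon>[of x] by (cases "x \<in> {z..z + 1 / k}") (auto intro: mult_left_mono)
    qed
    ultimately show ?thesis using one by simp
  qed
  have main: "norm (y s - y t) \<le> M * (t - s + \<epsilon>) + 2 * \<epsilon>"
    if st: "a < s" "s < t" "t < b" and \<epsilon>: "\<epsilon> > 0" for s t \<epsilon>
  proof -
    have near: "\<exists>\<delta>>0. \<forall>x\<in>{a..b}. dist x z < \<delta> \<longrightarrow> norm (y x - y z) \<le> \<epsilon>" if "z \<in> {a..b}" for z
      using cont that \<epsilon> unfolding continuous_on_iff dist_norm by (meson less_imp_le)
    obtain \<delta>s where \<delta>s: "\<delta>s > 0" "\<And>x. x \<in> {a..b} \<Longrightarrow> dist x s < \<delta>s \<Longrightarrow> norm (y x - y s) \<le> \<epsilon>"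
      using near[of s] st by auto
    obtain \<delta>t where \<delta>t: "\<delta>t > 0" "\<And>x. x \<in> {a..b} \<Longrightarrow> dist x t < \<delta>t \<Longrightarrow> norm (y x - y t) \<le> \<epsilon>"
      using near[of t] st by auto
    obtain \<eta> where "0 < \<eta>" "\<eta> < min \<epsilon> (min (b - t) (min \<delta>s \<delta>t))"
      using dense[of 0 "min \<epsilon> (min (b - t) (min \<delta>s \<delta>t))"] st \<epsilon> \<delta>s(1) \<delta>t(1) by auto
    then have \<eta>: "\<eta> > 0" "\<eta> < \<epsilon>" "t + \<eta> < b" "\<eta> < \<delta>s" "\<eta> < \<delta>t"
      by auto
    define k where "k = 1 / \<eta>"
    have k: "k > 0" "1 / k = \<eta>" using \<eta> by (auto simp: k_def)
    define \<phi> where "\<phi> x = \<psi> (k * (x - s)) - \<psi> (k * (x - t))" for x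
    have \<phi>z: "\<phi> x = 0" if "x \<notin> {s..t + \<eta>}" for x
    proof (cases "x < s")
      case True
      then have "k * (x - s) \<le> 0" "k * (x - t) \<le> 0" using k st by (auto simp: mult_le_0_iff)
      then show ?thesis using \<psi>(2) by (simp add: \<phi>_def)
    next
      case False
      then have "k * (x - t) \<ge> k * \<eta>" "k * (x - s) \<ge> k * \<eta>" using that k st \<eta> by auto
      moreover have "k * \<eta> = 1" using \<eta> by (simp add: k_def)
      ultimately show ?thesis using \<psi>(3) by (simp add: \<phi>_def)
    qed
    have \<phi>01: "0 \<le> \<phi> x" "\<phi> x \<le> 1" for x
    proof -
      have "\<psi> (k * (x - t)) \<le> \<psi> (k * (x - s))"
        using st k by (intro monoD[OF \<psi>(4)] mult_left_mono) auto
      then show "0 \<le> \<phi> x" "\<phi> x \<le> 1"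
        using \<psi>01[of "k * (x - s)"] \<psi>01[of "k * (x - t)"] by (auto simp: \<phi>_def)
    qed
    have C: "C_k n (\<lambda>x. \<psi> (k * (x - z)))" for n z
      using C_k_compose_affine[OF \<psi>(1)[of n], of k "1::real" "- (k * z)"] by (simp add: right_diff_distrib)
    have test: "\<phi> \<in> test_functions {a<..<b}"
    proof -
      have "compact {s..t + \<eta>} \<and> {s..t + \<eta>} \<subseteq> {a<..<b} \<and> (\<forall>x. x \<notin> {s..t + \<eta>} \<longrightarrow> \<phi> x = 0)"
        using st \<eta> \<phi>z by auto
      moreover have "C_k n \<phi>" for n unfolding \<phi>_def by (intro C_k_diff C)
      ultimately show ?thesis unfolding test_functions_def by blast
    qed
    have "deriv \<phi> x = k * \<psi>' (k * (x - s)) - k * \<psi>' (k * (x - t))" for x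
      unfolding \<phi>_def by (intro DERIV_imp_deriv DERIV_diff d)
    then have "(LINT x|L. deriv \<phi> x *\<^sub>R y x) =
        (LINT x|L. (k * \<psi>' (k * (x - s))) *\<^sub>R y x) - (LINT x|L. (k * \<psi>' (k * (x - t))) *\<^sub>R y x)"
      using hyint[of k s] hyint[of k t] by (simp add: scaleR_diff_left)
    with weak[OF test] have eq: "(LINT x|L. (k * \<psi>' (k * (x - s))) *\<^sub>R y x) - (LINT x|L. (k * \<psi>' (k * (x - t))) *\<^sub>R y x) =
       - (LINT x|L. \<phi> x *\<^sub>R g x)" by simp
    have s1: "norm ((LINT x|L. (k * \<psi>' (k * (x - s))) *\<^sub>R y x) - y s) \<le> \<epsilon>"
      by (rule mollify) (use st \<eta> k \<delta>s(2) in \<open>auto simp: dist_real_def\<close>)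
    have t1: "norm ((LINT x|L. (k * \<psi>' (k * (x - t))) *\<^sub>R y x) - y t) \<le> \<epsilon>"
      by (rule mollify) (use st \<eta> k \<delta>t(2) in \<open>auto simp: dist_real_def\<close>)
    have \<phi>m: "\<phi> \<in> borel_measurable L"
      using test by (intro contL C_k_continuous[of 0]) (auto simp: test_functions_def)
    have "integrable L (\<lambda>x. \<phi> x *\<^sub>R g x)"
    proof (rule L.integrable_const_bound[where B = M])
      show "AE x in L. norm (\<phi> x *\<^sub>R g x) \<le> M"
        using M(2)
      proof eventually_elim
        fix x assume "norm (g x) \<le> M"
        then have "\<bar>\<phi> x\<bar> * norm (g x) \<le> 1 * M" using \<phi>01[of x] by (intro mult_mono) auto
        then show "norm (\<phi> x *\<^sub>R g x) \<le> M" by simp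
      qed
    qed (use \<phi>m gm in simp)
    then have ni: "integrable L (\<lambda>x. norm (\<phi> x *\<^sub>R g x))" by (rule integrable_norm)
    have "norm (LINT x|L. \<phi> x *\<^sub>R g x) \<le> (LINT x|L. norm (\<phi> x *\<^sub>R g x))"
      by (rule integral_norm_bound)
    also have "\<dots> \<le> (LINT x|L. M * indicator {s..t + \<eta>} x)"
    proof (rule integral_mono_AE[OF ni])
      show "integrable L (\<lambda>x. M * indicator {s..t + \<eta>} x)"
      proof (rule L.integrable_const_bound[where B = M])
        show "AE x in L. norm (M * indicator {s..t + \<eta>} x) \<le> M"
          using M(1) by (auto simp: indicator_def)
        show "(\<lambda>x. M * indicator {s..t + \<eta>} x) \<in> borel_measurable L"
          unfolding L_def by (intro measurable_restrict_space1 borel_measurable_times borel_measurable_const borel_measurable_indicator) simp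
      qed
      show "AE x in L. norm (\<phi> x *\<^sub>R g x) \<le> M * indicator {s..t + \<eta>} x"
        using M(2)
      proof eventually_elim
        fix x assume gM: "norm (g x) \<le> M"
        show "norm (\<phi> x *\<^sub>R g x) \<le> M * indicator {s..t + \<eta>} x"
        proof (cases "x \<in> {s..t + \<eta>}")
          case True
          have "\<bar>\<phi> x\<bar> * norm (g x) \<le> 1 * M" using \<phi>01[of x] gM by (intro mult_mono) auto
          then show ?thesis using True by simp
        qed (use \<phi>z in simp)
      qed
    qed
    also have "(LINT x|L. M * indicator {s..t + \<eta>} x) = M * (t + \<eta> - s)"
    proof -
      have "(LINT x|L. M * indicator {s..t + \<eta>} x) = (LINT x|lebesgue. indicator {a<..<b} x *\<^sub>R (M * indicator {s..t + \<eta>} x))"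
        unfolding L_def by (intro integral_restrict_space) simp
      also have "(\<lambda>x. indicator {a<..<b} x *\<^sub>R (M * indicator {s..t + \<eta>} x)) = (\<lambda>x. M * indicator {s..t + \<eta>} x)"
        using st \<eta> by (auto simp: indicator_def)
      also have "(LINT x|lebesgue. M * indicator {s..t + \<eta>} x) = M * (t + \<eta> - s)"
        using st \<eta> by simp
      finally show ?thesis .
    qed
    also have "\<dots> \<le> M * (t - s + \<epsilon>)"
      using M(1) \<eta> by (intro mult_left_mono) auto
    finally have phi: "norm (LINT x|L. \<phi> x *\<^sub>R g x) \<le> M * (t - s + \<epsilon>)" .
    define Is It where "Is = (LINT x|L. (k * \<psi>' (k * (x - s))) *\<^sub>R y x)" and "It = (LINT x|L. (k * \<psi>' (k * (x - t))) *\<^sub>R y x)"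
    have "norm (Is - It) \<le> M * (t - s + \<epsilon>)" using phi eq by (simp add: Is_def It_def)
    moreover have "norm (y s - Is) \<le> \<epsilon>" using s1 by (simp add: Is_def norm_minus_commute)
    moreover have "norm (It - y t) \<le> \<epsilon>" using t1 by (simp add: It_def)
    moreover have "norm (y s - y t) \<le> norm (y s - Is) + norm (Is - It) + norm (It - y t)"
      using norm_triangle_ineq[of "y s - Is + (Is - It)" "It - y t"] norm_triangle_ineq[of "y s - Is" "Is - It"] by simp
    ultimately show ?thesis by linarith
  qed
  have le: "norm (y s - y t) \<le> M * (t - s)" if st: "a < s" "s < t" "t < b" for s t
  proof (rule tendsto_lowerbound[where F = "at_right 0"])
    have "((\<lambda>\<epsilon>. M * (t - s + \<epsilon>) + 2 * \<epsilon>) \<longlongrightarrow> M * (t - s + 0) + 2 * 0) (at_right 0)"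
      by (intro tendsto_intros)
    then show "((\<lambda>\<epsilon>. M * (t - s + \<epsilon>) + 2 * \<epsilon>) \<longlongrightarrow> M * (t - s)) (at_right 0)" by simp
    show "\<forall>\<^sub>F \<epsilon> in at_right 0. norm (y s - y t) \<le> M * (t - s + \<epsilon>) + 2 * \<epsilon>"
      using main[OF st] by (auto simp: eventually_at_filter)
  qed simp
  have "M-lipschitz_on {a<..<b} y"
  proof (rule lipschitz_onI[OF _ M(1)])
    fix s t assume "s \<in> {a<..<b}" "t \<in> {a<..<b}"
    then show "dist (y s) (y t) \<le> M * dist s t"
      using le[of s t] le[of t s] by (cases s t rule: linorder_cases) (auto simp: dist_norm norm_minus_commute)
  qed
  then have "M-lipschitz_on (closure {a<..<b}) y"
    using ab cont by (intro lipschitz_on_closure) (auto simp: closure_greaterThanLessThan)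
  then show thesis using ab that by (simp add: closure_greaterThanLessThan)
qed

section \<open>Comparison with the barrier\<close>

lemma powr_kernel_integrable:
  fixes a t :: real
  assumes "a < 1" "0 < t"
  shows "set_integrable lborel {0<..<t} (\<lambda>s. (t - s) powr (- a))"
proof -
  have d: "((\<lambda>s. - (1 / (1 - a)) * (t - s) powr (1 - a)) has_real_derivative (t - s) powr (- a)) (at s)" if "s < t" for s
  proof -
    have "((\<lambda>s. - (1 / (1 - a)) * (t - s) powr (1 - a)) has_real_derivative
        - (1 / (1 - a)) * ((1 - a) * (t - s) powr (1 - a - of_nat 1) * - 1)) (at s)"
      by (intro DERIV_cmult DERIV_fun_powr) (use that in \<open>auto intro!: derivative_eq_intros\<close>)
    then show ?thesis using assms by simp
  qed
  show ?thesis
  proof (rule set_integral_FTC_nonneg(1)[OF \<open>0 < t\<close> d])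
    show "((\<lambda>s. - (1 / (1 - a)) * (t - s) powr (1 - a)) \<longlongrightarrow> - (1 / (1 - a)) * (t - 0) powr (1 - a)) (at_right 0)"
      using DERIV_isCont[OF d[of 0]] assms(2) by (meson continuous_within continuous_at_imp_continuous_at_within)
    have "((\<lambda>s. t - s) \<longlongrightarrow> t - t) (at_left t)" by (intro tendsto_intros)
    then have "((\<lambda>s. (t - s) powr (1 - a)) \<longlongrightarrow> 0) (at_left t)"
      by (intro tendsto_zero_powrI[OF _ tendsto_const]) (use assms in \<open>auto simp: eventually_at_filter\<close>)
    then show "((\<lambda>s. - (1 / (1 - a)) * (t - s) powr (1 - a)) \<longlongrightarrow> - (1 / (1 - a)) * 0) (at_left t)"
      by (intro tendsto_mult tendsto_const)
  qed (use assms in \<open>auto intro!: continuous_intros\<close>)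
qed

text \<open>Away from \<open>s = t\<close> the kernel and \<open>y\<close> are bounded. Near \<open>s = t\<close> the Lipschitz bound lowers the order of
the singularity from \<open>a + 1\<close> to \<open>a < 1\<close>.\<close>
lemma caputo_integrable:
  fixes y :: "real \<Rightarrow> 'b::{banach, second_countable_topology}"
  assumes a: "0 < a" "a < 1" and t: "0 < t" "t \<le> T"
    and cont: "continuous_on {0..T} y"
    and lip: "\<And>\<epsilon>. 0 < \<epsilon> \<Longrightarrow> \<epsilon> \<le> T \<Longrightarrow> \<exists>M. M-lipschitz_on {\<epsilon>..T} y"
  shows "set_integrable lborel {0<..<t} (\<lambda>s. (a * (t - s) powr (- a - 1)) *\<^sub>R (y t - y s))"
proof -
  obtain M where M: "M-lipschitz_on {t/2..T} y" using lip[of "t/2"] t by auto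
  have M0: "0 \<le> M" using lipschitz_on_nonneg[OF M] .
  have "bounded (y ` {0..T})"
    using cont by (intro compact_imp_bounded compact_continuous_image) auto
  then obtain Y where Y: "\<And>x. x \<in> {0..T} \<Longrightarrow> norm (y x) \<le> Y" unfolding bounded_iff by blast
  have "norm (y t) \<le> Y" using Y t by simp
  then have Y0: "0 \<le> Y" using norm_ge_zero[of "y t"] by linarith
  \<comment> \<open>Bounds the integrand on \<open>{0<..t/2}\<close>.\<close>
  define C where "C = a * (t/2) powr (- a - 1) * (2 * Y)"
  have C0: "0 \<le> C" using a Y0 by (simp add: C_def)
  have bd: "norm ((a * (t - s) powr (- a - 1)) *\<^sub>R (y t - y s)) \<le> C + a * M * (t - s) powr (- a)"
    if s: "s \<in> {0<..<t}" for s
  proof (cases "s \<le> t/2")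
    case True
    have "(t - s) powr (- a - 1) \<le> (t/2) powr (- a - 1)"
      using True t a by (intro powr_mono2') auto
    moreover have "norm (y t - y s) \<le> 2 * Y"
      using norm_triangle_ineq4[of "y t" "y s"] Y[of t] Y[of s] s t by auto
    ultimately have "(a * (t - s) powr (- a - 1)) * norm (y t - y s) \<le> (a * (t/2) powr (- a - 1)) * (2 * Y)"
      using a Y0 by (intro mult_mono) auto
    then show ?thesis using a M0 by (simp add: C_def add_increasing2 abs_mult)
  next
    case False
    then have "norm (y t - y s) \<le> M * (t - s)"
      using lipschitz_onD[OF M, of t s] s t by (auto simp: dist_norm)
    then have "(a * (t - s) powr (- a - 1)) * norm (y t - y s) \<le> (a * (t - s) powr (- a - 1)) * (M * (t - s))"
      using a by (intro mult_left_mono) auto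
    also have "\<dots> = a * M * (t - s) powr (- a)"
      using s by (simp add: powr_diff)
    finally have "(a * (t - s) powr (- a - 1)) * norm (y t - y s) \<le> a * M * (t - s) powr (- a)" .
    moreover have "norm ((a * (t - s) powr (- a - 1)) *\<^sub>R (y t - y s)) = (a * (t - s) powr (- a - 1)) * norm (y t - y s)"
      using a by (simp add: abs_mult)
    ultimately show ?thesis using C0 by linarith
  qed
  have wi: "set_integrable lborel {0<..<t} (\<lambda>s. C + a * M * (t - s) powr (- a))"
  proof (rule set_integral_add(1))
    show "set_integrable lborel {0<..<t} (\<lambda>s. C)"
      by (rule set_integrable_subset[OF borel_integrable_atLeastAtMost'[of 0 t]]) auto
    show "set_integrable lborel {0<..<t} (\<lambda>s. a * M * (t - s) powr (- a))"
      using powr_kernel_integrable[of a t] a t by (intro set_integrable_mult_right) auto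
  qed
  have c: "continuous_on {0<..<t} (\<lambda>s. (a * (t - s) powr (- a - 1)) *\<^sub>R (y t - y s))"
    by (intro continuous_intros continuous_on_subset[OF cont]) (use t in auto)
  have m: "(\<lambda>s. indicator {0<..<t} s *\<^sub>R ((a * (t - s) powr (- a - 1)) *\<^sub>R (y t - y s))) \<in> borel_measurable lborel"
    using borel_measurable_continuous_on_indicator[OF _ c] by simp
  show ?thesis
    unfolding set_integrable_def
  proof (rule Bochner_Integration.integrable_bound[OF wi[unfolded set_integrable_def] m])
    have "norm (indicat_real {0<..<t} s *\<^sub>R ((a * (t - s) powr (- a - 1)) *\<^sub>R (y t - y s)))
        \<le> norm (indicat_real {0<..<t} s *\<^sub>R (C + a * M * (t - s) powr (- a)))" for s
      using bd[of s] by (cases "s \<in> {0<..<t}") auto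
    then show "AE s in lborel. norm (indicat_real {0<..<t} s *\<^sub>R ((a * (t - s) powr (- a - 1)) *\<^sub>R (y t - y s)))
        \<le> norm (indicat_real {0<..<t} s *\<^sub>R (C + a * M * (t - s) powr (- a)))" by simp
  qed
qed

lemma set_integral_inner_left:
  fixes f :: "real \<Rightarrow> 'b::{real_inner, banach, second_countable_topology}"
  assumes "set_integrable M A f"
  shows "set_integrable M A (\<lambda>s. f s \<bullet> x)" "(LINT s:A|M. f s \<bullet> x) = (LINT s:A|M. f s) \<bullet> x"
  using assms integrable_inner_left[of x M "\<lambda>s. indicator A s *\<^sub>R f s"]
    integral_inner_left[of x M "\<lambda>s. indicator A s *\<^sub>R f s"]
  by (auto simp: set_integrable_def set_lebesgue_integral_def)

lemma lipschitz_on_norm_compose: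
  fixes e :: "real \<Rightarrow> 'b::real_normed_vector"
  assumes M: "M-lipschitz_on S e"
  shows "M-lipschitz_on S (\<lambda>s. norm (e s))"
proof (rule lipschitz_onI)
  fix x y assume "x \<in> S" "y \<in> S"
  then have "dist (e x) (e y) \<le> M * dist x y" using lipschitz_onD[OF M] by blast
  then show "dist (norm (e x)) (norm (e y)) \<le> M * dist x y"
    using norm_triangle_ineq3[of "e x" "e y"] by (simp add: dist_norm)
qed (rule lipschitz_on_nonneg[OF M])

text \<open>Since \<open>e 0 = 0\<close>, both sides have the same boundary term, and under the integral
\<open>(e t - e s) \<bullet> e t \<ge> norm (e t) * (norm (e t) - norm (e s))\<close>.\<close>
lemma frac_deriv_norm_le:
  fixes e :: "real \<Rightarrow> 'b::{real_inner, banach, second_countable_topology}"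
  assumes a: "0 < a" "a < 1" and t: "0 < t" "t \<le> T"
    and cont: "continuous_on {0..T} e" and e0: "e 0 = 0"
    and lip: "\<And>\<epsilon>. 0 < \<epsilon> \<Longrightarrow> \<epsilon> \<le> T \<Longrightarrow> \<exists>M. M-lipschitz_on {\<epsilon>..T} e"
  shows "norm (e t) * frac_deriv a (\<lambda>s. norm (e s)) t \<le> frac_deriv a e t \<bullet> e t"
proof -
  define k where "k s = a * (t - s) powr (- a - 1)" for s
  have k0: "0 \<le> k s" for s using a by (simp add: k_def)
  have I: "set_integrable lborel {0<..<t} (\<lambda>s. k s *\<^sub>R (e t - e s))"
    unfolding k_def by (rule caputo_integrable[OF a t cont lip])
  have J: "set_integrable lborel {0<..<t} (\<lambda>s. k s *\<^sub>R (norm (e t) - norm (e s)))"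
    unfolding k_def
  proof (rule caputo_integrable[OF a t])
    show "continuous_on {0..T} (\<lambda>s. norm (e s))" using cont by (intro continuous_intros)
    show "\<exists>M. M-lipschitz_on {\<epsilon>..T} (\<lambda>s. norm (e s))" if "0 < \<epsilon>" "\<epsilon> \<le> T" for \<epsilon>
      using lip[OF that] lipschitz_on_norm_compose by blast
  qed
  have "norm (e t) * (LBINT s:{0<..<t}. k s *\<^sub>R (norm (e t) - norm (e s))) =
      (LBINT s:{0<..<t}. norm (e t) * (k s *\<^sub>R (norm (e t) - norm (e s))))"
    by simp
  also have "\<dots> \<le> (LBINT s:{0<..<t}. (k s *\<^sub>R (e t - e s)) \<bullet> e t)"
  proof (rule set_integral_mono)
    show "set_integrable lborel {0<..<t} (\<lambda>s. norm (e t) * (k s *\<^sub>R (norm (e t) - norm (e s))))"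
      using J by (rule set_integrable_mult_right)
    show "set_integrable lborel {0<..<t} (\<lambda>s. (k s *\<^sub>R (e t - e s)) \<bullet> e t)"
      by (rule set_integral_inner_left[OF I])
    fix s assume "s \<in> {0<..<t}"
    have "norm (e t) * (norm (e t) - norm (e s)) \<le> (e t - e s) \<bullet> e t"
      using norm_cauchy_schwarz[of "e s" "e t"]
      by (simp add: inner_diff_left right_diff_distrib mult.commute power2_norm_eq_inner[symmetric] power2_eq_square)
    from mult_left_mono[OF this k0[of s]]
    show "norm (e t) * (k s *\<^sub>R (norm (e t) - norm (e s))) \<le> (k s *\<^sub>R (e t - e s)) \<bullet> e t"
      by (simp add: mult.left_commute)
  qed
  also have "\<dots> = (LBINT s:{0<..<t}. k s *\<^sub>R (e t - e s)) \<bullet> e t"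
    by (rule set_integral_inner_left[OF I])
  finally have le: "norm (e t) * (LBINT s:{0<..<t}. k s *\<^sub>R (norm (e t) - norm (e s))) \<le>
      (LBINT s:{0<..<t}. k s *\<^sub>R (e t - e s)) \<bullet> e t" .
  have "(1 / Gamma (1 - a)) * (norm (e t) * (t powr (- a) * norm (e t) + (LBINT s:{0<..<t}. k s *\<^sub>R (norm (e t) - norm (e s)))))
     \<le> (1 / Gamma (1 - a)) * ((t powr (- a) *\<^sub>R e t + (LBINT s:{0<..<t}. k s *\<^sub>R (e t - e s))) \<bullet> e t)"
  proof (rule mult_left_mono)
    show "0 \<le> 1 / Gamma (1 - a)" using a Gamma_real_pos[of "1 - a"] by simp
    show "norm (e t) * (t powr (- a) * norm (e t) + (LBINT s:{0<..<t}. k s *\<^sub>R (norm (e t) - norm (e s))))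
     \<le> (t powr (- a) *\<^sub>R e t + (LBINT s:{0<..<t}. k s *\<^sub>R (e t - e s))) \<bullet> e t"
      using le by (simp add: inner_add_left distrib_left power2_norm_eq_inner[symmetric] power2_eq_square mult.left_commute)
  qed
  then show ?thesis
    by (simp add: frac_deriv_def e0 k_def mult.left_commute)
qed

lemma rho_eq_barrier_defect: "rho \<alpha> i s = barrier_defect (\<alpha> i) (1 - \<alpha> 1) s"
  by (simp add: rho_def barrier_defect_def F21_def gauss_const_def)

lemma E1_eq_barrier: "E1 \<alpha> \<tau> s = barrier (1 - \<alpha> 1) \<tau> s"
  by (simp add: E1_def barrier_def)

text \<open>Summed over the orders, with the weights \<open>q i\<close> and the term \<open>lam * E1\<close>, this says that the residual of the
barrier is \<open>R1\<close>.\<close>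
lemma frac_deriv_barrier:
  assumes "0 < a" "a < 1" "0 < b" "b < 1" "0 < \<tau>" "0 < t"
  shows "frac_deriv a (barrier b \<tau>) t = \<tau> powr (- b) * (t powr (- a) / Gamma (1 - a) * (1 - barrier_defect a b (\<tau> / t)))"
proof -
  have "barrier b \<tau> 0 = 0" by (simp add: barrier_def)
  then show ?thesis
    using barrier_kernel_integral(2)[OF assms] by (simp add: frac_deriv_def)
qed

lemma frac_deriv_at_max:
  fixes v :: "real \<Rightarrow> real"
  assumes a: "0 < a" "a < 1" and v0: "v 0 = 0"
    and max: "\<And>s. 0 < s \<Longrightarrow> s < t \<Longrightarrow> v s \<le> v t"
  shows "t powr (- a) / Gamma (1 - a) * v t \<le> frac_deriv a v t"
proof -
  have "0 \<le> (LBINT s:{0<..<t}. (a * (t - s) powr (- a - 1)) *\<^sub>R (v t - v s))"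
    unfolding set_lebesgue_integral_def
    using a max by (intro Bochner_Integration.integral_nonneg) (auto simp: indicator_def)
  moreover have "0 \<le> 1 / Gamma (1 - a)" using a Gamma_real_pos[of "1 - a"] by simp
  ultimately have "0 \<le> 1 / Gamma (1 - a) * (LBINT s:{0<..<t}. (a * (t - s) powr (- a - 1)) *\<^sub>R (v t - v s))"
    by (intro mult_nonneg_nonneg)
  then show ?thesis by (simp add: frac_deriv_def v0 distrib_left)
qed

text \<open>The maximum principle. If \<open>v = norm e - C * E1\<close> is positive at \<open>t\<close>, take its maximum \<open>s0\<close> over \<open>(0,t]\<close>.
There every Caputo derivative of \<open>v\<close> is positive by \<open>frac_deriv_at_max\<close>, and some weight \<open>q j\<close> is positive, so
the multiterm operator applied to \<open>v\<close>, increased by \<open>lam * v\<close>, is positive at \<open>s0\<close>. But it is at most \<open>C * R1 - C * R1 = 0\<close> by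
the inequality for \<open>e\<close> and by \<open>frac_deriv_barrier\<close>.\<close>
lemma barrier_comparison:
  fixes e :: "real \<Rightarrow> 'b::{real_inner, banach, second_countable_topology}"
  assumes \<alpha>: "\<And>i. i \<in> {1..l} \<Longrightarrow> 0 < \<alpha> i" "\<And>i. i \<in> {1..l} \<Longrightarrow> \<alpha> i < 1" "0 < \<alpha> 1" "\<alpha> 1 < 1"
    and q: "\<And>i s. i \<in> {1..l} \<Longrightarrow> s \<in> {0..T} \<Longrightarrow> 0 \<le> q i s" "\<And>s. s \<in> {0..T} \<Longrightarrow> 0 < (\<Sum>i=1..l. q i s)"
    and lam: "0 \<le> lam" and \<tau>: "0 < \<tau>" and C: "0 \<le> C"
    and cont: "continuous_on {0..T} e" and e0: "e 0 = 0"
    and lip: "\<And>\<epsilon>. 0 < \<epsilon> \<Longrightarrow> \<epsilon> \<le> T \<Longrightarrow> \<exists>M. M-lipschitz_on {\<epsilon>..T} e"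
    and t: "0 < t" "t \<le> T"
    and ineq: "\<And>s. 0 < s \<Longrightarrow> s \<le> t \<Longrightarrow>
      multiterm_deriv l \<alpha> q e s \<bullet> e s + lam * (norm (e s))\<^sup>2 \<le> C * R1 l \<alpha> q lam \<tau> s * norm (e s)"
  shows "norm (e t) \<le> C * E1 \<alpha> \<tau> t"
proof (rule ccontr)
  define b where "b = 1 - \<alpha> 1"
  have b: "0 < b" "b < 1" using \<alpha> by (auto simp: b_def)
  define E where "E = barrier b \<tau>"
  \<comment> \<open>Agrees with \<open>v\<close> except at \<open>0\<close>, where it is continuous, so that it attains its maximum on \<open>{0..t}\<close>.\<close>
  define w where "w s = norm (e s) - C * max \<tau> s powr (- b)" for s
  define v where "v s = norm (e s) - C * E s" for s
  have vw: "v s = w s" if "s > 0" for s using that by (simp add: v_def w_def E_def barrier_def)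
  have v0: "v 0 = 0" by (simp add: v_def E_def barrier_def e0)
  assume "\<not> ?thesis"
  then have vt: "v t > 0" by (simp add: v_def E_def b_def E1_eq_barrier)
  have "continuous_on {0..t} w"
    unfolding w_def by (intro continuous_intros continuous_on_subset[OF cont]) (use t \<tau> in auto)
  then obtain s0 where s0: "s0 \<in> {0..t}" "\<And>s. s \<in> {0..t} \<Longrightarrow> w s \<le> w s0"
    using continuous_attains_sup[of "{0..t}" w] t by auto
  have ws0: "w s0 > 0" using s0(2)[of t] vt vw[of t] t by auto
  moreover have "w 0 \<le> 0" using C by (simp add: w_def e0)
  ultimately have s0p: "0 < s0" "s0 \<le> t" using s0(1) by (cases "s0 = 0"; auto)+
  have vs0: "v s0 > 0" using ws0 vw s0p by simp
  have E0: "0 \<le> E s" for s by (simp add: E_def barrier_def)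
  have "0 \<le> C * E s0" using C E0 by simp
  then have es0: "norm (e s0) > 0" using vs0 unfolding v_def by linarith
  have fd: "s0 powr (- \<alpha> i) / Gamma (1 - \<alpha> i) * v s0 \<le>
      frac_deriv (\<alpha> i) (\<lambda>s. norm (e s)) s0 - C * frac_deriv (\<alpha> i) E s0" if i: "i \<in> {1..l}" for i
  proof -
    let ?a = "\<alpha> i"
    define k where "k s = ?a * (s0 - s) powr (- ?a - 1)" for s
    have J: "set_integrable lborel {0<..<s0} (\<lambda>s. k s *\<^sub>R (norm (e s0) - norm (e s)))"
      unfolding k_def
    proof (rule caputo_integrable[of ?a s0 T])
      show "continuous_on {0..T} (\<lambda>s. norm (e s))" using cont by (intro continuous_intros)
      show "\<exists>M. M-lipschitz_on {\<epsilon>..T} (\<lambda>s. norm (e s))" if "0 < \<epsilon>" "\<epsilon> \<le> T" for \<epsilon>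
        using lip[OF that] lipschitz_on_norm_compose by blast
    qed (use \<alpha> i s0p t in auto)
    have B: "set_integrable lborel {0<..<s0} (\<lambda>s. k s *\<^sub>R (E s0 - E s))"
      using barrier_kernel_integral(1)[of ?a b \<tau> s0] \<alpha> i b \<tau> s0p by (simp add: k_def E_def)
    have "(LBINT s:{0<..<s0}. k s *\<^sub>R (v s0 - v s)) =
       (LBINT s:{0<..<s0}. k s *\<^sub>R (norm (e s0) - norm (e s)) - C * (k s *\<^sub>R (E s0 - E s)))"
      by (intro arg_cong[where f = "set_lebesgue_integral lborel {0<..<s0}"] ext) (simp add: v_def algebra_simps)
    also have "\<dots> = (LBINT s:{0<..<s0}. k s *\<^sub>R (norm (e s0) - norm (e s))) - (LBINT s:{0<..<s0}. C * (k s *\<^sub>R (E s0 - E s)))"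
      by (intro set_integral_diff(2) J set_integrable_mult_right) (use B in blast)
    finally have int: "(LBINT s:{0<..<s0}. k s *\<^sub>R (v s0 - v s)) =
       (LBINT s:{0<..<s0}. k s *\<^sub>R (norm (e s0) - norm (e s))) - C * (LBINT s:{0<..<s0}. k s *\<^sub>R (E s0 - E s))"
      by simp
    have "frac_deriv ?a v s0 = frac_deriv ?a (\<lambda>s. norm (e s)) s0 - C * frac_deriv ?a E s0"
      unfolding frac_deriv_def k_def[symmetric] int
      by (simp add: v_def e0 E_def barrier_def algebra_simps)
    moreover have "s0 powr (- ?a) / Gamma (1 - ?a) * v s0 \<le> frac_deriv ?a v s0"
      using \<alpha> i s0p s0(2) by (intro frac_deriv_at_max v0) (auto simp: vw)
    ultimately show ?thesis by simp
  qed
  have s0T: "s0 \<in> {0..T}" using s0p t by auto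
  obtain j where j: "j \<in> {1..l}" "q j s0 > 0"
    using q(2)[OF s0T] sum_nonpos[of "{1..l}" "\<lambda>i. q i s0"] by (metis linorder_not_less)
  have R1: "R1 l \<alpha> q lam \<tau> s0 = lam * E s0 + (\<Sum>i=1..l. q i s0 * frac_deriv (\<alpha> i) E s0)"
  proof -
    have "(\<Sum>i=1..l. q i s0 * frac_deriv (\<alpha> i) E s0) =
       (\<Sum>i=1..l. \<tau> powr (- b) * (q i s0 * s0 powr (- \<alpha> i) / Gamma (1 - \<alpha> i) * (1 - rho \<alpha> i (\<tau> / s0))))"
    proof (rule sum.cong[OF refl])
      fix i assume i: "i \<in> {1..l}"
      show "q i s0 * frac_deriv (\<alpha> i) E s0 = \<tau> powr (- b) * (q i s0 * s0 powr (- \<alpha> i) / Gamma (1 - \<alpha> i) * (1 - rho \<alpha> i (\<tau> / s0)))"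
        unfolding E_def rho_eq_barrier_defect b_def[symmetric]
        using \<alpha> i b \<tau> s0p by (subst frac_deriv_barrier) auto
    qed
    then show ?thesis
      by (simp add: R1_def Let_def E_def E1_eq_barrier b_def sum_distrib_left)
  qed
  have "0 < (\<Sum>i=1..l. q i s0 * (s0 powr (- \<alpha> i) / Gamma (1 - \<alpha> i) * v s0))"
  proof (rule sum_pos2[OF _ j(1)])
    have p: "0 < s0 powr (- \<alpha> i) / Gamma (1 - \<alpha> i) * v s0" if "i \<in> {1..l}" for i
      using \<alpha> that vs0 s0p Gamma_real_pos[of "1 - \<alpha> i"] by simp
    then show "0 < q j s0 * (s0 powr (- \<alpha> j) / Gamma (1 - \<alpha> j) * v s0)"
      using mult_pos_pos[OF j(2) p[OF j(1)]] by blast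
    fix i assume i: "i \<in> {1..l}"
    show "0 \<le> q i s0 * (s0 powr (- \<alpha> i) / Gamma (1 - \<alpha> i) * v s0)"
      using mult_nonneg_nonneg[OF q(1)[OF i s0T] less_imp_le[OF p[OF i]]] by blast
  qed simp
  also have "\<dots> \<le> (\<Sum>i=1..l. q i s0 * (frac_deriv (\<alpha> i) (\<lambda>s. norm (e s)) s0 - C * frac_deriv (\<alpha> i) E s0))"
    using fd q(1)[OF _ s0T] by (intro sum_mono mult_left_mono) auto
  also have "\<dots> = (\<Sum>i=1..l. q i s0 * frac_deriv (\<alpha> i) (\<lambda>s. norm (e s)) s0) - C * (\<Sum>i=1..l. q i s0 * frac_deriv (\<alpha> i) E s0)"
    by (simp add: sum_subtractf sum_distrib_left algebra_simps)
  finally have 1: "0 < (\<Sum>i=1..l. q i s0 * frac_deriv (\<alpha> i) (\<lambda>s. norm (e s)) s0) - C * (\<Sum>i=1..l. q i s0 * frac_deriv (\<alpha> i) E s0)" .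
  have 2: "0 \<le> lam * norm (e s0) - C * (lam * E s0)"
    using mult_nonneg_nonneg[OF lam less_imp_le[OF vs0]] by (simp add: v_def algebra_simps)
  define D where "D = (\<Sum>i=1..l. q i s0 * frac_deriv (\<alpha> i) (\<lambda>s. norm (e s)) s0) + lam * norm (e s0)"
  have "norm (e s0) * D \<le> multiterm_deriv l \<alpha> q e s0 \<bullet> e s0 + lam * (norm (e s0))\<^sup>2"
  proof -
    have "norm (e s0) * (\<Sum>i=1..l. q i s0 * frac_deriv (\<alpha> i) (\<lambda>s. norm (e s)) s0) \<le> (\<Sum>i=1..l. q i s0 * (frac_deriv (\<alpha> i) e s0 \<bullet> e s0))"
      unfolding sum_distrib_left
    proof (rule sum_mono)
      fix i assume i: "i \<in> {1..l}"
      have "norm (e s0) * frac_deriv (\<alpha> i) (\<lambda>s. norm (e s)) s0 \<le> frac_deriv (\<alpha> i) e s0 \<bullet> e s0"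
        by (rule frac_deriv_norm_le[of _ _ T]) (use \<alpha> i s0p t cont e0 lip in auto)
      from mult_left_mono[OF this q(1)[OF i s0T]]
      show "norm (e s0) * (q i s0 * frac_deriv (\<alpha> i) (\<lambda>s. norm (e s)) s0) \<le> q i s0 * (frac_deriv (\<alpha> i) e s0 \<bullet> e s0)"
        by (simp add: mult.left_commute)
    qed
    then show ?thesis
      by (simp add: D_def multiterm_deriv_def inner_sum_left distrib_left power2_eq_square mult.left_commute)
  qed
  also have "\<dots> \<le> C * R1 l \<alpha> q lam \<tau> s0 * norm (e s0)" by (rule ineq[OF s0p])
  finally have "D \<le> C * R1 l \<alpha> q lam \<tau> s0" using es0 by (simp add: mult.commute)
  then show False using 1 2 by (simp add: D_def R1 distrib_left)
qed

section \<open>The error bound\<close>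

lemma regular_locally_lipschitz:
  assumes y: "regular \<Omega> T y" and \<epsilon>: "0 < \<epsilon>" "\<epsilon> \<le> T"
  shows "\<exists>M. M-lipschitz_on {\<epsilon>..T} y"
proof (cases "\<epsilon> = T")
  case True
  then show ?thesis by (intro exI[of _ 0]) (auto intro: lipschitz_onI)
next
  case False
  have "continuous_on {\<epsilon>..T} y"
    using y \<epsilon> by (auto simp: regular_def intro: continuous_on_subset)
  moreover have "W1_infty \<epsilon> T (l2_on \<Omega>) y"
    using y \<epsilon> by (auto simp: regular_def)
  ultimately show ?thesis
    using W1_infty_imp_lipschitz[of \<epsilon> T y] False \<epsilon> by (metis order_le_less)
qed

lemma frac_deriv_diff:
  fixes v w :: "real \<Rightarrow> 'b::{banach, second_countable_topology}"
  assumes a: "0 < a" "a < 1" and t: "0 < t" "t \<le> T"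
    and v: "continuous_on {0..T} v" "\<And>\<epsilon>. 0 < \<epsilon> \<Longrightarrow> \<epsilon> \<le> T \<Longrightarrow> \<exists>M. M-lipschitz_on {\<epsilon>..T} v"
    and w: "continuous_on {0..T} w" "\<And>\<epsilon>. 0 < \<epsilon> \<Longrightarrow> \<epsilon> \<le> T \<Longrightarrow> \<exists>M. M-lipschitz_on {\<epsilon>..T} w"
  shows "frac_deriv a (\<lambda>s. v s - w s) t = frac_deriv a v t - frac_deriv a w t"
proof -
  have "(LBINT s:{0<..<t}. (a * (t - s) powr (- a - 1)) *\<^sub>R ((v t - w t) - (v s - w s))) =
      (LBINT s:{0<..<t}. (a * (t - s) powr (- a - 1)) *\<^sub>R (v t - v s) - (a * (t - s) powr (- a - 1)) *\<^sub>R (w t - w s))"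
    by (simp add: algebra_simps)
  also have "\<dots> = (LBINT s:{0<..<t}. (a * (t - s) powr (- a - 1)) *\<^sub>R (v t - v s)) -
      (LBINT s:{0<..<t}. (a * (t - s) powr (- a - 1)) *\<^sub>R (w t - w s))"
    using caputo_integrable[OF a t v] caputo_integrable[OF a t w] by (rule set_integral_diff(2))
  finally have int: "(LBINT s:{0<..<t}. (a * (t - s) powr (- a - 1)) *\<^sub>R ((v t - w t) - (v s - w s))) =
      (LBINT s:{0<..<t}. (a * (t - s) powr (- a - 1)) *\<^sub>R (v t - v s)) -
      (LBINT s:{0<..<t}. (a * (t - s) powr (- a - 1)) *\<^sub>R (w t - w s))" .
  show ?thesis
    unfolding frac_deriv_def int by (simp add: algebra_simps)
qed

lemma R1_pos:
  assumes \<alpha>: "\<And>i. i \<in> {1..l} \<Longrightarrow> \<alpha> i < 1"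
    and q: "\<And>i. i \<in> {1..l} \<Longrightarrow> 0 \<le> q i s" "0 < (\<Sum>i=1..l. q i s)"
    and rho: "\<And>i r. i \<in> {1..l} \<Longrightarrow> 0 < r \<Longrightarrow> r < 1 \<Longrightarrow> rho \<alpha> i r < 1"
    and lam: "0 \<le> lam" and \<tau>: "0 < \<tau>" and s: "0 < s"
  shows "0 < R1 l \<alpha> q lam \<tau> s"
proof -
  obtain j where j: "j \<in> {1..l}" "q j s > 0"
    using q(2) sum_nonpos[of "{1..l}" "\<lambda>i. q i s"] by (metis linorder_not_less)
  have p: "0 < s powr (- \<alpha> i) / Gamma (1 - \<alpha> i) * (1 - rho \<alpha> i (\<tau> / s))" if i: "i \<in> {1..l}" for i
  proof -
    have "rho \<alpha> i (\<tau> / s) < 1"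
      using rho[OF i, of "\<tau> / s"] \<tau> s by (cases "\<tau> / s < 1") (auto simp: rho_def)
    moreover have "Gamma (1 - \<alpha> i) > 0" using \<alpha>[OF i] by (intro Gamma_real_pos) simp
    ultimately show ?thesis using s by simp
  qed
  have "0 < (\<Sum>i=1..l. q i s * (s powr (- \<alpha> i) / Gamma (1 - \<alpha> i) * (1 - rho \<alpha> i (\<tau> / s))))"
  proof (rule sum_pos2[OF _ j(1)])
    show "0 < q j s * (s powr (- \<alpha> j) / Gamma (1 - \<alpha> j) * (1 - rho \<alpha> j (\<tau> / s)))"
      using mult_pos_pos[OF j(2) p[OF j(1)]] by blast
    fix i assume i: "i \<in> {1..l}"
    show "0 \<le> q i s * (s powr (- \<alpha> i) / Gamma (1 - \<alpha> i) * (1 - rho \<alpha> i (\<tau> / s)))"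
      using mult_nonneg_nonneg[OF q(1)[OF i] less_imp_le[OF p[OF i]]] by blast
  qed simp
  then have "0 < \<tau> powr (- (1 - \<alpha> 1)) * (\<Sum>i=1..l. q i s * s powr (- \<alpha> i) / Gamma (1 - \<alpha> i) * (1 - rho \<alpha> i (\<tau> / s)))"
    using \<tau> by (simp add: mult.assoc)
  moreover have "0 \<le> lam * E1 \<alpha> \<tau> s" using lam by (simp add: E1_def)
  ultimately show ?thesis unfolding R1_def Let_def by linarith
qed

text \<open>Every \<open>L2\<close> representative \<open>r\<close> of the residual gives, by the energy identity and coercivity, the
bound \<open>norm r * norm (v s - w s)\<close>; the infimum over the representatives is the norm of the residual. If there is none, that norm is infinite,
which the hypothesis on \<open>C\<close> excludes.\<close>
lemma residual_energy_bound:
  fixes \<Omega> :: "'a::euclidean_space set"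
  assumes \<Omega>: "open \<Omega>" and ell: "elliptic_coeffs \<Omega> a b c"
    and coercive: "\<And>r. r \<in> H10 \<Omega> \<Longrightarrow> elliptic_pairing \<Omega> a b c r r \<ge> lam * (norm r)\<^sup>2"
    and \<alpha>: "\<And>i. i \<in> {1..l} \<Longrightarrow> 0 < \<alpha> i" "\<And>i. i \<in> {1..l} \<Longrightarrow> \<alpha> i < 1"
    and v: "regular \<Omega> T v" and w: "regular \<Omega> T w" and s: "0 < s" "s \<le> T"
    and w0: "\<And>\<phi>. \<phi> \<in> test_functions \<Omega> \<Longrightarrow> residual \<Omega> l \<alpha> q (elliptic_op \<Omega> a b c) f w s \<phi> = 0"
    and C: "0 \<le> C" and N: "distr_l2_norm \<Omega> (residual \<Omega> l \<alpha> q (elliptic_op \<Omega> a b c) f v s) \<le> ennreal C"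
  shows "multiterm_deriv l \<alpha> q (\<lambda>s. v s - w s) s \<bullet> (v s - w s) + lam * (norm (v s - w s))\<^sup>2 \<le> C * norm (v s - w s)"
proof -
  define e where "e = v s - w s"
  define z where "z = multiterm_deriv l \<alpha> q v s - multiterm_deriv l \<alpha> q w s"
  have vwH: "v s \<in> H10 \<Omega>" "w s \<in> H10 \<Omega>" using v w s by (auto simp: regular_def)
  have z: "multiterm_deriv l \<alpha> q (\<lambda>s. v s - w s) s = z"
  proof -
    have "frac_deriv (\<alpha> i) (\<lambda>s. v s - w s) s = frac_deriv (\<alpha> i) v s - frac_deriv (\<alpha> i) w s" if i: "i \<in> {1..l}" for i
      by (rule frac_deriv_diff[OF \<alpha>(1)[OF i] \<alpha>(2)[OF i] s])
         (use v w regular_locally_lipschitz[OF v] regular_locally_lipschitz[OF w] in \<open>auto simp: regular_def\<close>)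
    then show ?thesis
      by (simp add: z_def multiterm_deriv_def scaleR_diff_right sum_subtractf)
  qed
  define X where "X = z \<bullet> e + lam * (norm e)\<^sup>2"
  have Xr: "X \<le> norm r * norm e"
    if r: "\<forall>\<phi>\<in>test_functions \<Omega>. residual \<Omega> l \<alpha> q (elliptic_op \<Omega> a b c) f v s \<phi> = (LINT x|lebesgue_on \<Omega>. rep_l2 r x * \<phi> x)" for r
  proof -
    have "z \<bullet> (v s - w s) + elliptic_pairing \<Omega> a b c (v s - w s) (v s - w s) = r \<bullet> (v s - w s)"
    proof (rule energy_identity[OF \<Omega> ell vwH])
      fix \<phi> assume \<phi>: "\<phi> \<in> test_functions \<Omega>"
      show "(LINT x|lebesgue_on \<Omega>. rep_l2 z x * \<phi> x) + elliptic_op \<Omega> a b c (v s) \<phi> - elliptic_op \<Omega> a b c (w s) \<phi> =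
        (LINT x|lebesgue_on \<Omega>. rep_l2 r x * \<phi> x)"
        using bspec[OF r \<phi>] w0[OF \<phi>] unfolding residual_def z_def test_function_integral_diff[OF \<phi> \<Omega>] by linarith
    qed
    moreover have "lam * (norm e)\<^sup>2 \<le> elliptic_pairing \<Omega> a b c e e"
      unfolding e_def by (intro coercive H10_diff \<Omega> vwH)
    moreover have "r \<bullet> e \<le> norm r * norm e" by (rule norm_cauchy_schwarz)
    ultimately show ?thesis by (simp add: X_def e_def)
  qed
  have "X \<le> C * norm e"
  proof (cases "e = 0")
    case True
    then show ?thesis by (simp add: X_def)
  next
    case False
    then have ne: "norm e > 0" by simp
    \<comment> \<open>If \<open>X\<close> is negative, the left-hand side is \<open>0\<close>.\<close>
    have "ennreal (X / norm e) \<le> distr_l2_norm \<Omega> (residual \<Omega> l \<alpha> q (elliptic_op \<Omega> a b c) f v s)"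
      unfolding distr_l2_norm_def
    proof (rule INF_greatest)
      fix r assume "r \<in> {r \<in> l2_on \<Omega>. \<forall>\<phi>\<in>test_functions \<Omega>. residual \<Omega> l \<alpha> q (elliptic_op \<Omega> a b c) f v s \<phi> = (LINT x|lebesgue_on \<Omega>. rep_l2 r x * \<phi> x)}"
      then have "X \<le> norm r * norm e" by (intro Xr) simp
      then show "ennreal (X / norm e) \<le> ennreal (norm r)"
        using ne by (intro ennreal_leI) (simp add: divide_le_eq)
    qed
    also note N
    finally have "X / norm e \<le> C" using C by (simp add: ennreal_le_iff)
    then show ?thesis using ne by (simp add: divide_le_eq)
  qed
  then show ?thesis by (simp add: X_def z e_def)
qed

lemma ennreal_divide_le_imp:
  fixes a S :: ennreal
  assumes "a / ennreal R \<le> ennreal C" "0 < R" "0 \<le> C"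
  shows "a \<le> ennreal (C * R)"
proof -
  have "a = a * ennreal R / ennreal R" using assms by (simp add: mult_divide_eq_ennreal)
  also have "\<dots> = ennreal R * (a / ennreal R)" by (simp add: ennreal_times_divide mult.commute)
  also have "\<dots> \<le> ennreal R * ennreal C" using assms(1) by (rule mult_left_mono) simp
  also have "\<dots> = ennreal (C * R)" using assms by (simp add: ennreal_mult mult.commute)
  finally show ?thesis .
qed

theorem corollary3p4:
  fixes \<Omega> :: "'a::euclidean_space set"
    and T lam \<tau> :: real
    and l :: nat
    and \<alpha> :: "nat \<Rightarrow> real"
    and q :: "nat \<Rightarrow> real \<Rightarrow> real"
    and a :: "'a \<Rightarrow> 'a \<Rightarrow> 'a \<Rightarrow> real" and b :: "'a \<Rightarrow> 'a \<Rightarrow> real" and c :: "'a \<Rightarrow> real"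
    and f :: "'a \<Rightarrow> real \<Rightarrow> real"
    and u0 :: "'a l2"
    and u u\<^sub>h :: "real \<Rightarrow> 'a l2"
  assumes dim: "DIM('a) \<in> {1, 2, 3}"
    and domain: "bounded \<Omega>" "lipschitz_domain \<Omega>"
    and T: "T > 0"
    and l: "l \<ge> 1"
    and \<alpha>_pos: "0 < \<alpha> l"
    and \<alpha>_decreasing: "\<And>i j. 1 \<le> i \<Longrightarrow> i < j \<Longrightarrow> j \<le> l \<Longrightarrow> \<alpha> j < \<alpha> i"
    and \<alpha>1: "\<alpha> 1 < 1"
    and q_cont: "\<And>i. i \<in> {1..l} \<Longrightarrow> continuous_on {0..T} (q i)"
    and q_nonneg: "\<And>i t. i \<in> {1..l} \<Longrightarrow> t \<in> {0..T} \<Longrightarrow> q i t \<ge> 0"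
    and q_sum_pos: "\<And>t. t \<in> {0..T} \<Longrightarrow> (\<Sum>i=1..l. q i t) > 0"
    and elliptic: "elliptic_coeffs \<Omega> a b c"
    and lam: "lam \<ge> 0"
    and coercive: "\<And>r. r \<in> H10 \<Omega> \<Longrightarrow> elliptic_pairing \<Omega> a b c r r \<ge> lam * (norm r)\<^sup>2"
    and f: "\<And>t. t \<in> {0<..T} \<Longrightarrow> locally_integrable \<Omega> (\<lambda>x. f x t)"
    and u_solution: "solution \<Omega> T l \<alpha> q (elliptic_op \<Omega> a b c) f u0 u"
    and u_unique: "\<And>v. solution \<Omega> T l \<alpha> q (elliptic_op \<Omega> a b c) f u0 v \<Longrightarrow> \<forall>t\<in>{0..T}. v t = u t"
    and uh_regular: "regular \<Omega> T u\<^sub>h"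
    and uh_initial: "u\<^sub>h 0 = u 0"
    and \<tau>: "\<tau> > 0"
  shows "(\<forall>i\<in>{1..l}. \<forall>s\<in>{0<..<1}.
            rho \<alpha> i s \<le> (1 - s) powr (1 - \<alpha> i) \<and> (1 - s) powr (1 - \<alpha> i) < 1) \<and>
         (\<forall>t\<in>{0<..T}.
            ennreal (norm (u\<^sub>h t - u t)) \<le>
              ennreal (t powr (\<alpha> 1 - 1)) *
              (SUP s\<in>{0<..t}. distr_l2_norm \<Omega> (residual \<Omega> l \<alpha> q (elliptic_op \<Omega> a b c) f u\<^sub>h s)
                              / ennreal (R1 l \<alpha> q lam \<tau> s))) \<and>
         (\<forall>t\<in>{0<..T}.
            ennreal (norm (u\<^sub>h t - u t)) \<le>
              ennreal (E1 \<alpha> \<tau> t) *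
              (SUP s\<in>{0<..t}. distr_l2_norm \<Omega> (residual \<Omega> l \<alpha> q (elliptic_op \<Omega> a b c) f u\<^sub>h s)
                              / ennreal (R1 l \<alpha> q lam \<tau> s)))"
proof -
  let ?N = "\<lambda>s. distr_l2_norm \<Omega> (residual \<Omega> l \<alpha> q (elliptic_op \<Omega> a b c) f u\<^sub>h s)"
  let ?S = "\<lambda>t. SUP s\<in>{0<..t}. ?N s / ennreal (R1 l \<alpha> q lam \<tau> s)"
  have \<Omega>: "open \<Omega>" using domain by (simp add: lipschitz_domain_def)
  have \<alpha>p: "0 < \<alpha> i" if "i \<in> {1..l}" for i
    using \<alpha>_pos \<alpha>_decreasing[of i l] that by (cases "i = l") auto
  have \<alpha>le: "\<alpha> i \<le> \<alpha> 1" if "i \<in> {1..l}" for i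
    using \<alpha>_decreasing[of 1 i] that by (cases "i = 1") auto
  have \<alpha>lt: "\<alpha> i < 1" if "i \<in> {1..l}" for i using \<alpha>le[OF that] \<alpha>1 by simp
  have \<alpha>1p: "0 < \<alpha> 1" using \<alpha>p[of 1] l by simp
  have rho1: "rho \<alpha> i s \<le> (1 - s) powr (1 - \<alpha> i) \<and> (1 - s) powr (1 - \<alpha> i) < 1"
    if i: "i \<in> {1..l}" and s: "0 < s" "s < 1" for i s
  proof
    have "F21 (\<alpha> i) (1 - \<alpha> 1) s - gauss_const (\<alpha> i) (1 - \<alpha> 1) * s powr (1 - \<alpha> 1) \<le> (1 - s) powr (1 - \<alpha> i)"
      by (rule F21_le) (use \<alpha>p[OF i] \<alpha>le[OF i] \<alpha>lt[OF i] \<alpha>1 \<alpha>1p s in auto)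
    then show "rho \<alpha> i s \<le> (1 - s) powr (1 - \<alpha> i)"
      using s by (simp add: rho_eq_barrier_defect barrier_defect_def)
    have "(1 - s) powr (1 - \<alpha> i) < 1 powr (1 - \<alpha> i)"
      using s \<alpha>lt[OF i] by (intro powr_less_mono2) auto
    then show "(1 - s) powr (1 - \<alpha> i) < 1" by simp
  qed
  have u: "regular \<Omega> T u" "\<And>s \<phi>. 0 < s \<Longrightarrow> s \<le> T \<Longrightarrow> \<phi> \<in> test_functions \<Omega> \<Longrightarrow>
      residual \<Omega> l \<alpha> q (elliptic_op \<Omega> a b c) f u s \<phi> = 0"
    using u_solution by (auto simp: solution_def)
  have R1p: "0 < R1 l \<alpha> q lam \<tau> s" if s: "0 < s" "s \<le> T" for s
  proof (rule R1_pos)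
    show "rho \<alpha> i r < 1" if "i \<in> {1..l}" "0 < r" "r < 1" for i r
      using rho1[OF that] by linarith
  qed (use \<alpha>lt q_nonneg q_sum_pos lam \<tau> s in auto)
  have bound: "ennreal (norm (u\<^sub>h t - u t)) \<le> ennreal (E1 \<alpha> \<tau> t) * ?S t" if t: "t \<in> {0<..T}" for t
  proof (cases "?S t = \<infinity>")
    case True
    have "E1 \<alpha> \<tau> t > 0" using t \<tau> by (simp add: E1_def)
    then show ?thesis unfolding True by (simp add: ennreal_mult_top)
  next
    case False
    then obtain C where C: "0 \<le> C" "?S t = ennreal C" by (cases "?S t") auto
    define e where "e s = u\<^sub>h s - u s" for s
    have "norm (e t) \<le> C * E1 \<alpha> \<tau> t"
    proof (rule barrier_comparison[of l \<alpha> T q lam \<tau> C e t])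
      show "continuous_on {0..T} e"
        unfolding e_def using u(1) uh_regular by (intro continuous_on_diff) (auto simp: regular_def)
      show "e 0 = 0" by (simp add: e_def uh_initial)
      show "\<exists>M. M-lipschitz_on {\<epsilon>..T} e" if \<epsilon>: "0 < \<epsilon>" "\<epsilon> \<le> T" for \<epsilon>
      proof -
        obtain M1 M2 where "M1-lipschitz_on {\<epsilon>..T} u\<^sub>h" "M2-lipschitz_on {\<epsilon>..T} u"
          using regular_locally_lipschitz[OF uh_regular \<epsilon>] regular_locally_lipschitz[OF u(1) \<epsilon>] by blast
        then have "(M1 + M2)-lipschitz_on {\<epsilon>..T} e"
          unfolding e_def by (rule lipschitz_on_diff)
        then show ?thesis by blast
      qed
      show "multiterm_deriv l \<alpha> q e s \<bullet> e s + lam * (norm (e s))\<^sup>2 \<le> C * R1 l \<alpha> q lam \<tau> s * norm (e s)"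
        if s: "0 < s" "s \<le> t" for s
        unfolding e_def
      proof (rule residual_energy_bound[OF \<Omega> elliptic coercive \<alpha>p \<alpha>lt uh_regular u(1)])
        have "?N s / ennreal (R1 l \<alpha> q lam \<tau> s) \<le> ?S t" using s by (intro SUP_upper) auto
        then show "?N s \<le> ennreal (C * R1 l \<alpha> q lam \<tau> s)"
          unfolding C(2) using R1p[of s] s t C(1) by (intro ennreal_divide_le_imp) auto
        show "0 \<le> C * R1 l \<alpha> q lam \<tau> s" using R1p[of s] s t C(1) by simp
      qed (use s t u(2) in auto)
    qed (use \<alpha>p \<alpha>lt \<alpha>1p \<alpha>1 q_nonneg q_sum_pos lam \<tau> C(1) t in auto)
    then have "ennreal (norm (e t)) \<le> ennreal (E1 \<alpha> \<tau> t * C)" by (intro ennreal_leI) (simp add: mult.commute)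
    then show ?thesis unfolding C(2) using C(1) by (simp add: e_def ennreal_mult E1_def)
  qed
  have E1le: "E1 \<alpha> \<tau> t \<le> t powr (\<alpha> 1 - 1)" if "t \<in> {0<..T}" for t
    using that \<alpha>1 by (auto simp: E1_def intro!: powr_mono2')
  have bound': "ennreal (norm (u\<^sub>h t - u t)) \<le> ennreal (t powr (\<alpha> 1 - 1)) * ?S t" if t: "t \<in> {0<..T}" for t
    using bound[OF t] by (rule order_trans) (intro mult_right_mono ennreal_leI E1le t, simp)
  show ?thesis
    using rho1 bound bound' by (intro conjI ballI) auto
qed

end
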